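(* Consider the Lévy-driven polling system with varying input described in the context, with disciplines at all queues that satisfy the branching property, are non-anticipating and work conserving, and are non-degenerate. Assume that the total work arriving during the switch-over periods in one polling cycle is not identically $0$. Let $A=(a_{ij})_{i,j=1}^N$ be the rate matrix, $a_{ij}=\mathbb E A_{i,j}(1)$, and let $\rho_A$ be its eigenvalue with maximal real part. Let $A$ be irreducible. Then: (1) if $\rho_A<0$, then the polling system is stable; (2) if $\rho_A>0$, then the polling system is unstable.
   Context: Notation. An $N$-dimensional Lévy subordinator is an $\mathbb R^N$-valued Lévy process started at $\boldsymbol 0$ with paths non-decreasing in each coordinate (coordinates may be dependent). The Laplace exponent of a (multidimensional) spectrally positive Lévy process $\boldsymbol L$ is the function $\phi$ with $\mathbb E e^{-\boldsymbol u\cdot\boldsymbol L(t)}=e^{-t\phi(\boldsymbol u)}$, $\boldsymbol u\ge\boldsymbol 0$. $\boldsymbol e_i$ is the $i$th unit vector; $\tilde X(u)=\mathbb E e^{-u\cdot X}$. Polling system with varying input. There are $N$ infinite-buffer fluid queues $Q_1,\dots,Q_N$ and one server visiting them cyclically ($Q_{N+1}:=Q_1$). After leaving $Q_i$ and before reaching $Q_{i+1}$ the server incurs a switch-over period whose duration is a positive random variable $S_i$, independent of anything else. During the switch-over period following the visit to $Q_i$ the workload vector increases according to an $N$-dimensional Lévy subordinator $\hat{\boldsymbol W}_i$ with Laplace exponent $\hat\phi_i$. While the server is at $Q_i$, the input process is an $N$-dimensional subordinator $\boldsymbol W_i=(W_{i,1},\dots,W_{i,N})$ and the workload vector evolves as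 its value on arrival plus the Lévy process $$\boldsymbol A_i(t)=(A_{i,1}(t),\dots,A_{i,N}(t))=(W_{i,1}(t),\dots,W_{i,i-1}(t),A_i(t),W_{i,i+1}(t),\dots,W_{i,N}(t)),$$ where $A_i$ is a spectrally positive Lévy process with negative drift ($\mathbb E A_i(1)<0$). Independent copies are used in different visits and switch-over periods, independently of the past. Disciplines. $\mathcal F_i$ is an augmented right-continuous filtration such that $\boldsymbol A_i$ is a Lévy process with respect to $\mathcal F_i$; $\tau_i(x)$ is the time the server spends at $Q_i$ when it finds $x$ units of work there on arrival; $T_i(x)=\inf\{t\ge0:A_i(t)=-x\}$. Non-anticipating: $\tau_i(x)$ is an $\mathcal F_i$-stopping time for every $x$. Work conserving: $\tau_i(x)\le T_i(x)$ a.s. for every $x$. Then a workload vector $\boldsymbol x$ on arrival at $Q_i$ becomes $\boldsymbol x-x_i\boldsymbol e_i+\boldsymbol H_i(x_i)$ at the end of the visit, with $\boldsymbol H_i(x)=x\boldsymbol e_i+\boldsymbol A_i(\tau_i(x))$. Branching property: $\{\boldsymbol H_i(x),x\ge0\}$ is an $N$-dimensional Lévy subordinator, with Laplace exponent denoted $\eta_i$. Non-degenerate: the case $\tau_i(x)=0$ (never serving $Q_i$) is excluded for every $i$. Rate matrix. The rates $a_{ij}=\mathbb E A_{i,j}(1)$ (finite) are the rates of the work evolution at $Q_j$ while the server is at $Q_i$; $A$ has non-negative off-diagonal elements, so by Perron–Frobenius theory it has a real eigenvalue $\rho_A$ that is larger than the real part of any other eigenvalue. Stability. Let $\boldsymbol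 B^n$ be the workload vector at the $n$th epoch at which the server reaches $Q_1$, and let $\boldsymbol G$ be a non-negative random vector with transform $\tilde{\boldsymbol G}(\boldsymbol u)=\prod_{i=1}^N\tilde S_i(\hat\phi_i(u_1,\ldots,u_i,\kappa_{i+1}(\boldsymbol u),\ldots,\kappa_N(\boldsymbol u)))$, where $\kappa_i(\boldsymbol u)=\eta_i(u_1,\ldots,u_i,\kappa_{i+1}(\boldsymbol u),\ldots,\kappa_N(\boldsymbol u))$ (this is the workload left at the end of a cycle stemming from input during the switch-over periods of that cycle). It is assumed that $\|\boldsymbol G\|$ is integrable. The system is called stable if $\boldsymbol B^n$ converges in distribution to a random vector in $\mathbb R_+^N$, and unstable if $\|\boldsymbol B^n\|\to\infty$ almost surely, as $n\to\infty$. *)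

theory Defs
  imports "HOL-Probability.Probability"
begin

section \<open>Levy processes\<close>

text \<open>Processes are indexed by \<open>real\<close>; only indices \<open>t \<ge> 0\<close> are ever constrained or used.\<close>

definition generated_events ::
    "'a measure \<Rightarrow> 't set \<Rightarrow> ('t \<Rightarrow> 'a \<Rightarrow> 'b::topological_space) \<Rightarrow> 'a set set" where
  "generated_events M T X =
     sigma_sets (space M) {X t -` B \<inter> space M | t B. t \<in> T \<and> B \<in> sets borel}"

definition natural_filtration ::
    "'a measure \<Rightarrow> (real \<Rightarrow> 'a \<Rightarrow> 'b::topological_space) \<Rightarrow> real \<Rightarrow> 'a measure" where
  "natural_filtration M X t = sigma (space M) (generated_events M {0..t} X)"

definition process_law ::
    "'a measure \<Rightarrow> (real \<Rightarrow> 'a \<Rightarrow> 'b::topological_space) \<Rightarrow> (real \<Rightarrow> 'b) measure" where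
  "process_law M X = distr M (\<Pi>\<^sub>M t\<in>{0..}. borel) (\<lambda>\<omega>. \<lambda>t\<in>{0..}. X t \<omega>)"

text \<open>
  Path regularity is not part of the definition of a Levy process: cadlag paths are required
  separately where a process is observed at a stopping time. For non-decreasing paths this is
  immaterial, since such a process agrees almost surely with its right-continuous version at every
  independent random time.
\<close>

definition levy_process_wrt ::
    "'a measure \<Rightarrow> (real \<Rightarrow> 'a measure) \<Rightarrow> (real \<Rightarrow> 'a \<Rightarrow> 'b::euclidean_space) \<Rightarrow> bool" where
  "levy_process_wrt M F X \<longleftrightarrow>
     (\<forall>t\<ge>0. X t \<in> borel_measurable M \<and> X t \<in> borel_measurable (F t)) \<and>
     (AE \<omega> in M. X 0 \<omega> = 0) \<and>
     (\<forall>s t. 0 \<le> s \<and> s \<le> t \<longrightarrow>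
        prob_space.indep_set M (sets (F s))
          {(\<lambda>\<omega>. X t \<omega> - X s \<omega>) -` B \<inter> space M | B. B \<in> sets borel}) \<and>
     (\<forall>s t. 0 \<le> s \<and> 0 \<le> t \<longrightarrow>
        distr M borel (\<lambda>\<omega>. X (s + t) \<omega> - X s \<omega>) = distr M borel (X t)) \<and>
     (\<forall>s\<ge>0. \<forall>\<epsilon>>0.
        ((\<lambda>t. measure M {\<omega> \<in> space M. \<epsilon> < norm (X t \<omega> - X s \<omega>)}) \<longlongrightarrow> 0) (at s within {0..}))"

definition levy_process :: "'a measure \<Rightarrow> (real \<Rightarrow> 'a \<Rightarrow> 'b::euclidean_space) \<Rightarrow> bool" where
  "levy_process M X \<longleftrightarrow> levy_process_wrt M (natural_filtration M X) X"

definition subordinator :: "'a measure \<Rightarrow> (real \<Rightarrow> 'a \<Rightarrow> real ^ 'n) \<Rightarrow> bool" where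
  "subordinator M X \<longleftrightarrow>
     levy_process M X \<and> (AE \<omega> in M. \<forall>s t. 0 \<le> s \<and> s \<le> t \<longrightarrow> X s \<omega> \<le> X t \<omega>)"

definition cadlag :: "(real \<Rightarrow> 'b::topological_space) \<Rightarrow> bool" where
  "cadlag f \<longleftrightarrow>
     (\<forall>t\<ge>0. (f \<longlongrightarrow> f t) (at_right t)) \<and> (\<forall>t>0. \<exists>l. (f \<longlongrightarrow> l) (at_left t))"

definition spectrally_positive :: "'a measure \<Rightarrow> (real \<Rightarrow> 'a \<Rightarrow> real) \<Rightarrow> bool" where
  "spectrally_positive M X \<longleftrightarrow>
     levy_process M X \<and>
     (AE \<omega> in M. cadlag (\<lambda>t. X t \<omega>) \<and>
        (\<forall>t>0. \<forall>l. ((\<lambda>s. X s \<omega>) \<longlongrightarrow> l) (at_left t) \<longrightarrow> l \<le> X t \<omega>))"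

definition laplace_exponent ::
    "'a measure \<Rightarrow> (real \<Rightarrow> 'a \<Rightarrow> real ^ 'n) \<Rightarrow> real ^ 'n \<Rightarrow> real" where
  "laplace_exponent M X u =
     (THE c. \<forall>t\<ge>0. (\<integral>\<omega>. exp (- (u \<bullet> X t \<omega>)) \<partial>M) = exp (- (t * c)))"


section \<open>A single visit of the server\<close>

definition work_process ::
    "'n \<Rightarrow> (real \<Rightarrow> 'a \<Rightarrow> real ^ 'n) \<Rightarrow> (real \<Rightarrow> 'a \<Rightarrow> real) \<Rightarrow> real \<Rightarrow> 'a \<Rightarrow> real ^ 'n" where
  "work_process i W A t \<omega> = (\<chi> j. if j = i then A t \<omega> else W t \<omega> $ j)"

definition hitting_time :: "(real \<Rightarrow> 'a \<Rightarrow> real) \<Rightarrow> real \<Rightarrow> 'a \<Rightarrow> ereal" where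
  "hitting_time A x \<omega> = (INF t \<in> {t. 0 \<le> t \<and> A t \<omega> = - x}. ereal t)"

text \<open>What \<open>x\<close> units of work found in queue \<open>i\<close> have become by the end of the visit.\<close>

definition offspring ::
    "'n::finite \<Rightarrow> (real \<Rightarrow> 'a \<Rightarrow> real ^ 'n) \<Rightarrow> (real \<Rightarrow> 'a \<Rightarrow> real) \<Rightarrow> (real \<Rightarrow> 'a \<Rightarrow> real)
      \<Rightarrow> real \<Rightarrow> 'a \<Rightarrow> real ^ 'n" where
  "offspring i W A \<tau> x \<omega> = x *\<^sub>R axis i 1 + work_process i W A (\<tau> x \<omega>) \<omega>"

definition augmented_right_continuous_filtration ::
    "'a measure \<Rightarrow> (real \<Rightarrow> 'a measure) \<Rightarrow> bool" where
  "augmented_right_continuous_filtration M F \<longleftrightarrow>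
     filtration (space M) F \<and>
     (\<forall>t. sets (F t) \<subseteq> sets M) \<and>
     null_sets M \<subseteq> sets (F 0) \<and>
     (\<forall>t\<ge>0. sets (F t) = (\<Inter>s\<in>{t<..}. sets (F s)))"

text \<open>
  The service time \<open>\<tau> x\<close> is taken to be real-valued; being dominated by \<open>hitting_time A x\<close>, it is
  almost surely finite anyway. The branching property does not ask for right-continuity
  in \<open>x\<close>: for exhaustive service, \<open>\<tau> = hitting_time A\<close>, with \<open>A\<close> having a Brownian component, \<open>\<tau>\<close> is
  only left-continuous at its jumps. The measure space is complete because the filtration is
  augmented by the null sets.
\<close>

locale service_visit = prob_space M + complete_measure M
  for M :: "'a measure" +
  fixes i :: "'n::finite"
    and W :: "real \<Rightarrow> 'a \<Rightarrow> real ^ 'n"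
    and A :: "real \<Rightarrow> 'a \<Rightarrow> real"
    and F :: "real \<Rightarrow> 'a measure"
    and \<tau> :: "real \<Rightarrow> 'a \<Rightarrow> real"
  assumes input: "subordinator M W"
    and spectrally_positive: "spectrally_positive M A"
    and filtration: "augmented_right_continuous_filtration M F"
    and levy: "levy_process_wrt M F (work_process i W A)"
    and cadlag: "AE \<omega> in M. cadlag (\<lambda>t. work_process i W A t \<omega>)"
    and finite_rates: "\<And>j. integrable M (\<lambda>\<omega>. work_process i W A 1 \<omega> $ j)"
    and negative_drift: "(\<integral>\<omega>. A 1 \<omega> \<partial>M) < 0"
    and nonneg: "\<And>x \<omega>. 0 \<le> x \<Longrightarrow> \<omega> \<in> space M \<Longrightarrow> 0 \<le> \<tau> x \<omega>"
    and non_anticipating: "\<And>x. 0 \<le> x \<Longrightarrow> stopping_time F (\<tau> x)"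
    and work_conserving: "\<And>x. 0 \<le> x \<Longrightarrow> AE \<omega> in M. ereal (\<tau> x \<omega>) \<le> hitting_time A x \<omega>"
    and branching: "subordinator M (offspring i W A \<tau>)"


section \<open>The polling system\<close>

text \<open>
  The queues are the elements of a finite linearly ordered type and are visited in increasing
  order. Index \<open>n\<close> numbers the cycles from 0; \<open>W n i\<close>, \<open>A n i\<close>, \<open>F n i\<close>, \<open>\<tau> n i\<close> belong to the
  visit to queue \<open>i\<close> in cycle \<open>n\<close>, and \<open>S n i\<close>, \<open>V n i\<close> are duration and input process of the
  switch-over period that follows. Combining \<open>W\<close>, \<open>A\<close> and \<open>\<tau>\<close> into one process lets joint law and
  independence refer to all of them together, although the index is a time for \<open>W\<close> and \<open>A\<close>, but an
  amount of work for \<open>\<tau>\<close>.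
\<close>

datatype 'n source = Initial | Visit nat 'n | Switch_Input nat 'n | Switch_Duration nat 'n

locale polling_system = prob_space M + complete_measure M
  for M :: "'a measure" +
  fixes S :: "nat \<Rightarrow> 'n::{finite,linorder} \<Rightarrow> 'a \<Rightarrow> real"
    and V :: "nat \<Rightarrow> 'n \<Rightarrow> real \<Rightarrow> 'a \<Rightarrow> (real, 'n) vec"
    and W :: "nat \<Rightarrow> 'n \<Rightarrow> real \<Rightarrow> 'a \<Rightarrow> (real, 'n) vec"
    and A :: "nat \<Rightarrow> 'n \<Rightarrow> real \<Rightarrow> 'a \<Rightarrow> real"
    and F :: "nat \<Rightarrow> 'n \<Rightarrow> real \<Rightarrow> 'a measure"
    and \<tau> :: "nat \<Rightarrow> 'n \<Rightarrow> real \<Rightarrow> 'a \<Rightarrow> real"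
    and B\<^sub>0 :: "'a \<Rightarrow> (real, 'n) vec"
  assumes initial_measurable: "B\<^sub>0 \<in> borel_measurable M"
    and initial_nonneg: "AE \<omega> in M. 0 \<le> B\<^sub>0 \<omega>"
    and duration_measurable: "\<And>n i. S n i \<in> borel_measurable M"
    and duration_pos: "\<And>n i. AE \<omega> in M. 0 < S n i \<omega>"
    and switch_input: "\<And>n i. subordinator M (V n i)"
    and visit: "\<And>n i. service_visit M i (W n i) (A n i) (F n i) (\<tau> n i)"
    and duration_copies: "\<And>n i. distr M borel (S n i) = distr M borel (S 0 i)"
    and switch_input_copies: "\<And>n i. process_law M (V n i) = process_law M (V 0 i)"
    and visit_copies:
      "\<And>n i. process_law M (\<lambda>r \<omega>. (W n i r \<omega>, A n i r \<omega>, \<tau> n i r \<omega>)) =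
             process_law M (\<lambda>r \<omega>. (W 0 i r \<omega>, A 0 i r \<omega>, \<tau> 0 i r \<omega>))"
    and independent:
      "indep_sets
        (\<lambda>s. case s of
            Initial \<Rightarrow> generated_events M {()} (\<lambda>_. B\<^sub>0)
          | Visit n i \<Rightarrow> generated_events M {0..} (\<lambda>r \<omega>. (W n i r \<omega>, A n i r \<omega>, \<tau> n i r \<omega>))
          | Switch_Input n i \<Rightarrow> generated_events M {0..} (V n i)
          | Switch_Duration n i \<Rightarrow> generated_events M {()} (\<lambda>_. S n i))
        UNIV"

text \<open>The workload vector at the epochs at which the server reaches the first queue.\<close>

primrec workload ::
    "(nat \<Rightarrow> 'n::{finite,linorder} \<Rightarrow> 'a \<Rightarrow> real) \<Rightarrow> (nat \<Rightarrow> 'n \<Rightarrow> real \<Rightarrow> 'a \<Rightarrow> (real, 'n) vec)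
      \<Rightarrow> (nat \<Rightarrow> 'n \<Rightarrow> real \<Rightarrow> 'a \<Rightarrow> (real, 'n) vec) \<Rightarrow> (nat \<Rightarrow> 'n \<Rightarrow> real \<Rightarrow> 'a \<Rightarrow> real)
      \<Rightarrow> (nat \<Rightarrow> 'n \<Rightarrow> real \<Rightarrow> 'a \<Rightarrow> real) \<Rightarrow> ('a \<Rightarrow> (real, 'n) vec) \<Rightarrow> nat \<Rightarrow> 'a \<Rightarrow> (real, 'n) vec" where
  "workload S V W A \<tau> B\<^sub>0 0 \<omega> = B\<^sub>0 \<omega>"
| "workload S V W A \<tau> B\<^sub>0 (Suc n) \<omega> =
     fold (\<lambda>i x. x + work_process i (W n i) (A n i) (\<tau> n i (x $ i) \<omega>) \<omega> + V n i (S n i \<omega>) \<omega>)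
       (sorted_list_of_set UNIV) (workload S V W A \<tau> B\<^sub>0 n \<omega>)"

definition non_degenerate :: "'a measure \<Rightarrow> ('n \<Rightarrow> real \<Rightarrow> 'a \<Rightarrow> real) \<Rightarrow> bool" where
  "non_degenerate M \<tau> \<longleftrightarrow> (\<forall>i. \<not> (\<forall>x\<ge>0. AE \<omega> in M. \<tau> i x \<omega> = 0))"

function kappa ::
    "('n::{finite,linorder} \<Rightarrow> (real, 'n) vec \<Rightarrow> real) \<Rightarrow> 'n \<Rightarrow> (real, 'n) vec \<Rightarrow> real" where
  "kappa \<eta> i u = \<eta> i (\<chi> j. if j \<le> i then u $ j else kappa \<eta> j u)"
  by pat_completeness auto
termination
  by (relation "Wellfounded.measure (\<lambda>(\<eta>, i, u). card {i<..})") (auto intro!: psubset_card_mono)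

declare kappa.simps [simp del]

text \<open>The transform of the work left at the end of a cycle stemming from its switch-over periods.\<close>

definition cycle_input_transform ::
    "'a measure \<Rightarrow> ('n::{finite,linorder} \<Rightarrow> 'a \<Rightarrow> real) \<Rightarrow> ('n \<Rightarrow> real \<Rightarrow> 'a \<Rightarrow> (real, 'n) vec)
      \<Rightarrow> ('n \<Rightarrow> real \<Rightarrow> 'a \<Rightarrow> (real, 'n) vec) \<Rightarrow> ('n \<Rightarrow> real \<Rightarrow> 'a \<Rightarrow> real)
      \<Rightarrow> ('n \<Rightarrow> real \<Rightarrow> 'a \<Rightarrow> real) \<Rightarrow> (real, 'n) vec \<Rightarrow> real" where
  "cycle_input_transform M S V W A \<tau> u =
     (let \<eta> = (\<lambda>i. laplace_exponent M (offspring i (W i) (A i) (\<tau> i)))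
      in \<Prod>i\<in>UNIV. \<integral>\<omega>. exp (- (laplace_exponent M (V i)
             (\<chi> j. if j \<le> i then u $ j else kappa \<eta> j u) * S i \<omega>)) \<partial>M)"

definition polling_stable :: "'a measure \<Rightarrow> (nat \<Rightarrow> 'a \<Rightarrow> real ^ 'n) \<Rightarrow> bool" where
  "polling_stable M B \<longleftrightarrow>
     (\<exists>\<mu> :: (real ^ 'n) measure.
        prob_space \<mu> \<and> sets \<mu> = sets borel \<and> (AE x in \<mu>. 0 \<le> x) \<and>
        (\<forall>f :: real ^ 'n \<Rightarrow> real. continuous_on UNIV f \<and> bounded (range f) \<longrightarrow>
           (\<lambda>n. \<integral>x. f x \<partial>distr M borel (B n)) \<longlonglongrightarrow> (\<integral>x. f x \<partial>\<mu>)))"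

definition polling_unstable :: "'a measure \<Rightarrow> (nat \<Rightarrow> 'a \<Rightarrow> real ^ 'n) \<Rightarrow> bool" where
  "polling_unstable M B \<longleftrightarrow> (AE \<omega> in M. filterlim (\<lambda>n. norm (B n \<omega>)) at_top sequentially)"


section \<open>The rate matrix\<close>

definition rate_matrix ::
    "'a measure \<Rightarrow> ('n \<Rightarrow> real \<Rightarrow> 'a \<Rightarrow> real ^ 'n) \<Rightarrow> ('n \<Rightarrow> real \<Rightarrow> 'a \<Rightarrow> real) \<Rightarrow> real ^ 'n ^ 'n" where
  "rate_matrix M W A = (\<chi> i j. \<integral>\<omega>. work_process i (W i) (A i) 1 \<omega> $ j \<partial>M)"

definition irreducible_matrix :: "real ^ 'n ^ 'n \<Rightarrow> bool" where
  "irreducible_matrix Q \<longleftrightarrow> (\<forall>I. I \<noteq> {} \<and> I \<noteq> UNIV \<longrightarrow> (\<exists>i\<in>I. \<exists>j\<in>-I. Q $ i $ j \<noteq> 0))"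

definition is_eigenvalue :: "real ^ 'n ^ 'n \<Rightarrow> complex \<Rightarrow> bool" where
  "is_eigenvalue Q z \<longleftrightarrow>
     (\<exists>v :: complex ^ 'n. v \<noteq> 0 \<and> (\<chi> i j. complex_of_real (Q $ i $ j)) *v v = z *s v)"

text \<open>Existence, for matrices with non-negative off-diagonal entries, is Perron-Frobenius theory.\<close>

definition dominant_eigenvalue :: "real ^ 'n ^ 'n \<Rightarrow> real" where
  "dominant_eigenvalue Q =
     (THE r. is_eigenvalue Q (complex_of_real r) \<and>
             (\<forall>z. is_eigenvalue Q z \<and> z \<noteq> complex_of_real r \<longrightarrow> Re z < r))"

end

theory Submission
  imports Defs "HOL-Real_Asymp.Real_Asymp"
begin

text \<open>
  For a positive eigenvector \<open>v\<close> of the rate matrix with eigenvalue \<open>\<rho>\<close>, Wald's identity for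
  the Levy process \<open>v \<bullet> A\<^sub>i\<close> shows that a visit to queue \<open>i\<close> turns \<open>x\<close> units of work into work of mean
  weight \<open>v\<^sub>i x + \<rho> v\<^sub>i E \<tau>\<^sub>i(x)\<close>, where \<open>E\<close> denotes the mean and \<open>E \<tau>\<^sub>i(x)\<close> is a positive multiple of \<open>x\<close>.

  If \<open>\<rho> < 0\<close>, one cycle is a random monotone map that contracts mean weighted differences, and
  iterating it backwards from the empty system gives an increasing sequence with bounded mean. Its
  limit attracts the backward iteration from every starting point, and the backward iterates have the
  laws of the workload. Comparing Laplace transforms identifies the mean input of one cycle with that
  of \<open>G\<close>, which is finite.

  If \<open>\<rho> > 0\<close>, then \<open>\<eta>\<^sub>i(u) \<ge> u\<^sub>i\<close> for all \<open>i\<close> at \<open>u = \<epsilon> v\<close> with small \<open>\<epsilon>\<close>, so that visits do not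
  increase the mean of \<open>exp(- u \<bullet> B)\<close>, whereas the switch-over input of each cycle multiplies it by a
  constant below 1. The means are therefore summable over the cycles, and \<open>u \<bullet> B\<^sup>n\<close> tends to
  infinity almost surely.
\<close>

section \<open>Positive eigenvectors\<close>

text \<open>Visits are controlled one by one instead of through the mean matrix of a cycle: row
  \<open>i\<close> of the rate matrix governs a visit to queue \<open>i\<close>, so a right
  eigenvector makes the sign of the eigenvalue act in the same direction at every queue. Linearity
  of the mean service time in \<open>x\<close> is forced by the branching property together with the
  nonzero drift. Its finiteness, which Wald's identity presupposes, comes from truncated times, as
  work conservation and the absence of downward jumps keep \<open>A\<close> above
  \<open>- x\<close>. Mean growth by itself does not exclude bounded paths; therefore instability
  goes through Laplace exponents, whose slope at 0 is the mean. The obstacle that shapes the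
  development is measurability. Offspring need not be right-continuous in the amount of work, so
  their value at a random amount is not evidently measurable, nor obviously given by conditioning.
  An independent time almost surely avoids the jumps, and every such value is replaced, up to a null
  set, by a limit along dyadic times from above.\<close>

lemma positive_eigenvector:
  fixes Q :: "real ^ 'n ^ 'n"
  assumes off: "\<And>i j. i \<noteq> j \<Longrightarrow> 0 \<le> Q $ i $ j" and irr: "irreducible_matrix Q"
  obtains r v where "\<And>i. 0 < v $ i" "Q *v v = r *s v"
proof -
  \<comment> \<open>The summand 1 makes the diagonal of \<open>P\<close> strictly positive, so that
    \<open>P\<close> maps no point of the simplex to 0 and the normalization below is
    defined.\<close>
  define c where "c = 1 + (\<Sum>i\<in>UNIV. \<bar>Q $ i $ i\<bar>)"
  define P where "P = Q + c *\<^sub>R mat 1"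
  have c: "\<bar>Q $ i $ i\<bar> < c" for i
    using member_le_sum[of i UNIV "\<lambda>i. \<bar>Q $ i $ i\<bar>"] by (simp add: c_def)
  have P_nth: "P $ i $ j = Q $ i $ j + (if i = j then c else 0)" for i j
    by (simp add: P_def mat_def)
  have P_nonneg: "0 \<le> P $ i $ j" for i j
    using off[of i j] c[of i] by (auto simp: P_nth)
  have P_diag: "0 < P $ i $ i" for i
    using c[of i] by (auto simp: P_nth)
  have Pv: "P *v x = Q *v x + c *s x" for x
    by (simp add: P_def vec_eq_iff matrix_vector_mult_def mat_def algebra_simps sum.distrib
        if_distrib[where f="\<lambda>t. _ * t"] cong: if_cong)
  define D where "D = {x :: real ^ 'n. 0 \<le> x \<and> (\<Sum>i\<in>UNIV. x $ i) = 1}"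
  have Pnn: "0 \<le> (P *v x) $ i" if "x \<in> D" for x i
    using that P_nonneg by (auto simp: matrix_vector_mult_def D_def less_eq_vec_def intro!: sum_nonneg)
  have Ppos: "0 < (\<Sum>i\<in>UNIV. (P *v x) $ i)" if x: "x \<in> D" for x
  proof -
    have "\<exists>i. x $ i \<noteq> 0"
    proof (rule ccontr)
      assume "\<nexists>i. x $ i \<noteq> 0"
      then show False using x by (simp add: D_def)
    qed
    then obtain i where i: "0 < x $ i"
      using x by (auto simp: D_def less_eq_vec_def less_le)
    have "0 < P $ i $ i * x $ i" using i P_diag by simp
    also have "\<dots> \<le> (P *v x) $ i"
      using member_le_sum[of i UNIV "\<lambda>j. P $ i $ j * x $ j"] P_nonneg x
      by (simp add: matrix_vector_mult_def D_def less_eq_vec_def)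
    also have "\<dots> \<le> (\<Sum>i\<in>UNIV. (P *v x) $ i)"
      using Pnn[OF x] by (intro member_le_sum) auto
    finally show ?thesis .
  qed
  \<comment> \<open>Perron's vector arises as a Brouwer fixed point of the action of
    \<open>P\<close> on the simplex, rescaled to sum 1.\<close>
  define f where "f x = inverse (\<Sum>i\<in>UNIV. (P *v x) $ i) *\<^sub>R (P *v x)" for x
  obtain v where v: "v \<in> D" "f v = v"
  proof (rule brouwer[of D f])
    have "D = {x. \<forall>i. 0 \<le> x $ i} \<inter> {x. (\<Sum>i\<in>UNIV. x $ i) = 1}"
      by (auto simp: D_def less_eq_vec_def)
    moreover have "closed {x :: real ^ 'n. \<forall>i. 0 \<le> x $ i}"
      by (intro closed_Collect_all closed_Collect_le continuous_intros)
    moreover have "closed {x :: real ^ 'n. (\<Sum>i\<in>UNIV. x $ i) = 1}"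
      by (intro closed_Collect_eq continuous_intros)
    moreover have "D \<subseteq> cball 0 1"
    proof
      fix x assume "x \<in> D"
      then show "x \<in> cball 0 1"
        using norm_le_l1_cart[of x] by (simp add: D_def less_eq_vec_def)
    qed
    ultimately show "compact D"
      using bounded_subset[OF bounded_cball] by (simp add: compact_eq_bounded_closed closed_Int)
    show "convex D"
      by (auto simp: convex_def D_def less_eq_vec_def sum.distrib simp flip: sum_distrib_left)
    have "axis undefined 1 \<in> D"
      by (auto simp: D_def less_eq_vec_def axis_def)
    then show "D \<noteq> {}" by auto
    show "continuous_on D f"
      unfolding f_def using Ppos
      by (intro continuous_intros matrix_vector_mult_linear_continuous_on
          continuous_on_component) (auto simp: less_le)
    show "f \<in> D \<rightarrow> D"
    proof
      fix x assume x: "x \<in> D"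
      have "(\<Sum>i\<in>UNIV. f x $ i) = 1"
        using Ppos[OF x] by (simp add: f_def less_le flip: sum_distrib_left)
      moreover have "0 \<le> f x"
        using Ppos[OF x] Pnn[OF x] by (simp add: f_def less_eq_vec_def)
      ultimately show "f x \<in> D" by (simp add: D_def)
    qed
  qed
  define l where "l = (\<Sum>i\<in>UNIV. (P *v v) $ i)"
  have "P *v v = l *s f v"
    using Ppos[OF v(1)] by (simp add: f_def l_def vec_eq_iff)
  then have eig: "P *v v = l *s v"
    by (simp only: v(2))
  have v0: "0 \<le> v $ i" for i using v(1) by (simp add: D_def less_eq_vec_def)
  \<comment> \<open>Irreducibility forbids zeros of \<open>v\<close>: it supplies a row in the zero
    set with a nonzero entry in a column of the support, and that entry makes
    \<open>(P *v v) $ i\<close> positive although it equals \<open>l * v $ i = 0\<close>.\<close>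
  define I where "I = {i. v $ i = 0}"
  have "I \<noteq> UNIV" 
  proof
    assume "I = UNIV"
    then have "v $ i = 0" for i by (auto simp: I_def)
    then show False using v(1) by (simp add: D_def)
  qed
  moreover have False if I: "I \<noteq> {}" "I \<noteq> UNIV"
  proof -
    obtain i j where ij: "i \<in> I" "j \<notin> I" "Q $ i $ j \<noteq> 0"
      using irr I unfolding irreducible_matrix_def by blast
    then have "i \<noteq> j" by auto
    then have "0 < P $ i $ j * v $ j"
      using ij off[of i j] v0[of j] by (simp add: P_nth I_def less_le)
    also have "\<dots> \<le> (P *v v) $ i"
      using member_le_sum[of j UNIV "\<lambda>j. P $ i $ j * v $ j"] P_nonneg v0
      by (simp add: matrix_vector_mult_def)
    also have "\<dots> = 0" using ij(1) by (simp add: eig I_def)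
    finally show False by simp
  qed
  ultimately have "I = {}" by blast
  then have "0 < v $ i" for i using v0[of i] by (auto simp: I_def less_le)
  moreover have "Q *v v = (l - c) *s v"
    using eig by (simp add: Pv vec_eq_iff algebra_simps)
  ultimately show ?thesis using that by blast
qed

text \<open>An eigenvector \<open>w\<close> for \<open>z\<close> is measured by the largest ratio
  \<open>cmod (w $ j) / v $ j\<close>. The shifted matrix \<open>P\<close> is nonnegative and maps
  \<open>v\<close> to \<open>r + c\<close> times \<open>v\<close>, so \<open>z + c\<close> has
  modulus at most \<open>r + c\<close>; the disc of this radius about \<open>- c\<close> meets the
  line \<open>Re z = r\<close> only in \<open>r\<close>.\<close>

lemma eigenvalue_of_positive_eigenvector_dominant:
  fixes Q :: "real ^ 'n ^ 'n"
  assumes off: "\<And>i j. i \<noteq> j \<Longrightarrow> 0 \<le> Q $ i $ j"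
    and v: "\<And>i. 0 < v $ i" and eig: "Q *v v = r *s v"
    and z: "is_eigenvalue Q z" "z \<noteq> complex_of_real r"
  shows "Re z < r"
proof -
  obtain w :: "complex ^ 'n" where w: "w \<noteq> 0" "(\<chi> i j. complex_of_real (Q $ i $ j)) *v w = z *s w"
    using z(1) by (auto simp: is_eigenvalue_def)
  define c where "c = (\<Sum>i\<in>UNIV. \<bar>Q $ i $ i\<bar>)"
  have c: "\<bar>Q $ i $ i\<bar> \<le> c" for i
    using member_le_sum[of i UNIV "\<lambda>i. \<bar>Q $ i $ i\<bar>"] by (simp add: c_def)
  define P where "P i j = Q $ i $ j + (if i = j then c else 0)" for i j
  have P_nonneg: "0 \<le> P i j" for i j
    using off[of i j] c[of i] by (auto simp: P_def)
  have Pv: "(\<Sum>j\<in>UNIV. P i j * v $ j) = (r + c) * v $ i" for i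
    using arg_cong[OF eig, of "\<lambda>x. x $ i"]
    by (simp add: P_def matrix_vector_mult_def algebra_simps sum.distrib
        if_distrib[where f="\<lambda>t. _ * t"] cong: if_cong)
  have Pw: "(\<Sum>j\<in>UNIV. of_real (P i j) * w $ j) = (z + of_real c) * w $ i" for i
    using arg_cong[OF w(2), of "\<lambda>x. x $ i"]
    by (simp add: P_def matrix_vector_mult_def algebra_simps sum.distrib
        if_distrib[where f="\<lambda>t. _ * t"] if_distrib[where f=complex_of_real] cong: if_cong)
  obtain k where k: "\<And>j. cmod (w $ j) / v $ j \<le> cmod (w $ k) / v $ k"
  proof -
    have "finite (range (\<lambda>j. cmod (w $ j) / v $ j))" by simp
    from Max_in[OF this] obtain k where
      "Max (range (\<lambda>j. cmod (w $ j) / v $ j)) = cmod (w $ k) / v $ k" by fastforce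
    moreover have "cmod (w $ j) / v $ j \<le> Max (range (\<lambda>j. cmod (w $ j) / v $ j))" for j by simp
    ultimately show ?thesis using that[of k] by simp
  qed
  define t where "t = cmod (w $ k) / v $ k"
  have wj: "cmod (w $ j) \<le> t * v $ j" for j
    using k[of j] v[of j] by (simp add: t_def pos_divide_le_eq)
  have wk: "cmod (w $ k) = t * v $ k" using v[of k] by (simp add: t_def)
  have "t > 0"
  proof (rule ccontr)
    assume "\<not> t > 0"
    then have "t * v $ j \<le> 0" for j using v[of j] by (simp add: mult_nonpos_nonneg less_imp_le)
    then have "cmod (w $ j) \<le> 0" for j using wj[of j] by (rule order_trans[rotated])
    then show False using w(1) by (simp add: vec_eq_iff)
  qed
  have "cmod (z + of_real c) * cmod (w $ k) = cmod (\<Sum>j\<in>UNIV. of_real (P k j) * w $ j)"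
    by (simp add: Pw norm_mult)
  also have "\<dots> \<le> (\<Sum>j\<in>UNIV. P k j * (t * v $ j))"
    using wj P_nonneg by (intro sum_norm_le) (auto simp: norm_mult intro!: mult_left_mono)
  also have "\<dots> = (r + c) * cmod (w $ k)"
    using Pv[of k] by (simp add: wk mult.left_commute[of _ t] flip: sum_distrib_left)
  finally have le: "cmod (z + of_real c) \<le> r + c"
    using \<open>t > 0\<close> v[of k] wk by simp
  then have "Re z + c \<le> r + c"
    using complex_Re_le_cmod[of "z + of_real c"] by simp
  moreover have "z = of_real r" if "Re z = r"
  proof -
    have "cmod (z + of_real c) = Re (z + of_real c)"
      using le complex_Re_le_cmod[of "z + of_real c"] that by simp
    then have "Im (z + of_real c) = 0"
      using cmod_power2[of "z + of_real c"] by simp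
    then show ?thesis using that by (simp add: complex_eq_iff)
  qed
  ultimately show ?thesis using z(2) by (cases "Re z = r") auto
qed

text \<open>Strict domination makes the eigenvalue unique, which gives the definite description in
  \<open>dominant_eigenvalue\<close> its value: of two candidates each would have to exceed the
  other.\<close>

theorem dominant_eigenvalue_positive_eigenvector:
  fixes Q :: "real ^ 'n ^ 'n"
  assumes off: "\<And>i j. i \<noteq> j \<Longrightarrow> 0 \<le> Q $ i $ j" and irr: "irreducible_matrix Q"
  obtains v where "\<And>i. 0 < v $ i" "Q *v v = dominant_eigenvalue Q *s v"
proof -
  obtain r v where v: "\<And>i. 0 < v $ i" "Q *v v = r *s v"
    using positive_eigenvector[OF off irr] by metis
  have dom: "Re z < r" if "is_eigenvalue Q z" "z \<noteq> complex_of_real r" for z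
    using eigenvalue_of_positive_eigenvector_dominant[OF off v that] .
  have ev: "is_eigenvalue Q (complex_of_real r)"
    unfolding is_eigenvalue_def
  proof (intro exI conjI)
    show "(\<chi> i. complex_of_real (v $ i)) \<noteq> 0"
      using v(1)[of undefined] by (auto simp: vec_eq_iff intro!: exI[of _ undefined])
    show "(\<chi> i j. complex_of_real (Q $ i $ j)) *v (\<chi> i. complex_of_real (v $ i)) =
        complex_of_real r *s (\<chi> i. complex_of_real (v $ i))"
      using v(2) by (simp add: vec_eq_iff matrix_vector_mult_def flip: of_real_mult of_real_sum)
  qed
  have "dominant_eigenvalue Q = r"
    unfolding dominant_eigenvalue_def
  proof (rule the_equality)
    show "is_eigenvalue Q (complex_of_real r) \<and>
        (\<forall>z. is_eigenvalue Q z \<and> z \<noteq> complex_of_real r \<longrightarrow> Re z < r)"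
      using ev dom by blast
    fix r' assume r': "is_eigenvalue Q (complex_of_real r') \<and>
        (\<forall>z. is_eigenvalue Q z \<and> z \<noteq> complex_of_real r' \<longrightarrow> Re z < r')"
    show "r' = r"
    proof (rule ccontr)
      assume "r' \<noteq> r"
      then have "r' < r" "r < r'" using dom[of "of_real r'"] r' ev by auto
      then show False by simp
    qed
  qed
  then show ?thesis using that v by blast
qed

section \<open>Independence and dyadic approximation\<close>

text \<open>Independence of two sub-sigma-algebras says that the diagonal map into
  \<open>N1 \<Otimes>\<^sub>M N2\<close> has the product law. By Fubini the first argument may then
  be frozen at \<open>\<omega>'\<close>; this takes the place of conditioning on
  \<open>N1\<close>.\<close>

lemma (in prob_space) nn_integral_indep_pair:
  assumes indep: "indep_set (sets N1) (sets N2)"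
    and sp: "space N1 = space M" "space N2 = space M"
    and h: "h \<in> borel_measurable (N1 \<Otimes>\<^sub>M N2)"
  shows "(\<integral>\<^sup>+\<omega>. h (\<omega>, \<omega>) \<partial>M) = (\<integral>\<^sup>+\<omega>'. \<integral>\<^sup>+\<omega>. h (\<omega>', \<omega>) \<partial>M \<partial>M)"
proof -
  have ev: "sets N1 \<subseteq> events" "sets N2 \<subseteq> events"
    using indep_setD_ev1[OF indep] indep_setD_ev2[OF indep] by auto
  have id: "(\<lambda>\<omega>. \<omega>) \<in> M \<rightarrow>\<^sub>M N1" "(\<lambda>\<omega>. \<omega>) \<in> M \<rightarrow>\<^sub>M N2"
    using ev sp by (auto intro!: measurableI dest: sets.sets_into_space simp: Int_absorb2)
  have vim: "{(\<lambda>\<omega>. \<omega>) -` A \<inter> space M |A. A \<in> sets N} = sets N" if "space N = space M" for N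
  proof -
    have "A \<inter> space M = A" if "A \<in> sets N" for A
      using sets.sets_into_space[OF that] \<open>space N = space M\<close> by auto
    then have "(B \<in> {(\<lambda>\<omega>. \<omega>) -` A \<inter> space M |A. A \<in> sets N}) = (B \<in> sets N)" for B
      unfolding vimage_ident mem_Collect_eq by metis
    then show ?thesis by blast
  qed
  have sig: "sigma_sets (space M) (sets N) = sets N" if "space N = space M" for N
    using sets.sigma_sets_eq[of N] that by simp
  have "indep_var N1 (\<lambda>\<omega>. \<omega>) N2 (\<lambda>\<omega>. \<omega>)"
    unfolding indep_var_eq vim[OF sp(1)] vim[OF sp(2)] sig[OF sp(1)] sig[OF sp(2)]
    using id indep by simp
  then have eq: "distr M N1 (\<lambda>\<omega>. \<omega>) \<Otimes>\<^sub>M distr M N2 (\<lambda>\<omega>. \<omega>) = distr M (N1 \<Otimes>\<^sub>M N2) (\<lambda>\<omega>. (\<omega>, \<omega>))"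
    unfolding indep_var_distribution_eq by blast
  interpret D1: prob_space "distr M N1 (\<lambda>\<omega>. \<omega>)" by (rule prob_space_distr) (rule id)
  interpret D2: prob_space "distr M N2 (\<lambda>\<omega>. \<omega>)" by (rule prob_space_distr) (rule id)
  have "(\<integral>\<^sup>+\<omega>. h (\<omega>, \<omega>) \<partial>M) = (\<integral>\<^sup>+z. h z \<partial>distr M (N1 \<Otimes>\<^sub>M N2) (\<lambda>\<omega>. (\<omega>, \<omega>)))"
    using h id by (subst nn_integral_distr) auto
  also have "\<dots> = (\<integral>\<^sup>+z. h z \<partial>(distr M N1 (\<lambda>\<omega>. \<omega>) \<Otimes>\<^sub>M distr M N2 (\<lambda>\<omega>. \<omega>)))"
    by (simp add: eq)
  also have "\<dots> = (\<integral>\<^sup>+x. \<integral>\<^sup>+y. h (x, y) \<partial>distr M N2 (\<lambda>\<omega>. \<omega>) \<partial>distr M N1 (\<lambda>\<omega>. \<omega>))"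
    using h by (intro D2.nn_integral_fst[symmetric]) (simp cong: measurable_cong_sets)
  also have "\<dots> = (\<integral>\<^sup>+x. \<integral>\<^sup>+y. h (x, y) \<partial>distr M N2 (\<lambda>\<omega>. \<omega>) \<partial>M)"
    using h id by (intro nn_integral_distr D2.borel_measurable_nn_integral)
      (simp_all cong: measurable_cong_sets)
  also have "\<dots> = (\<integral>\<^sup>+x. \<integral>\<^sup>+y. h (x, y) \<partial>M \<partial>M)"
  proof (rule nn_integral_cong)
    fix x assume "x \<in> space M"
    then have "(\<lambda>y. h (x, y)) \<in> borel_measurable N2"
      using h sp by (auto intro!: measurable_compose[OF measurable_Pair1'])
    then show "(\<integral>\<^sup>+y. h (x, y) \<partial>distr M N2 (\<lambda>\<omega>. \<omega>)) = (\<integral>\<^sup>+y. h (x, y) \<partial>M)"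
      using id by (simp add: nn_integral_distr)
  qed
  finally show ?thesis .
qed

lemma (in prob_space) nn_integral_indep_mult:
  fixes U :: "'a \<Rightarrow> ennreal"
  assumes indep: "indep_set (sets N) {Y -` B \<inter> space M |B. B \<in> sets borel}"
    and sp: "space N = space M"
    and U: "U \<in> borel_measurable N" and Y: "Y \<in> borel_measurable M" and g: "g \<in> borel_measurable borel"
  shows "(\<integral>\<^sup>+\<omega>. U \<omega> * g (Y \<omega>) \<partial>M) = (\<integral>\<^sup>+\<omega>. U \<omega> \<partial>M) * (\<integral>\<^sup>+\<omega>. g (Y \<omega>) \<partial>M)"
proof -
  let ?N2 = "vimage_algebra (space M) Y borel"
  have s2: "sets ?N2 = {Y -` B \<inter> space M |B. B \<in> sets borel}"
    by (rule sets_vimage_algebra2) auto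
  have [measurable]: "Y \<in> borel_measurable ?N2"
    by (rule measurable_vimage_algebra1) auto
  note [measurable] = U g
  have ev: "sets N \<subseteq> events" using indep_setD_ev1[OF indep] .
  have UM: "U \<in> borel_measurable M"
    using U ev sp by (auto simp: measurable_def)
  have "(\<integral>\<^sup>+\<omega>. (\<lambda>(\<omega>', \<omega>). U \<omega>' * g (Y \<omega>)) (\<omega>, \<omega>) \<partial>M) =
      (\<integral>\<^sup>+\<omega>'. \<integral>\<^sup>+\<omega>. (\<lambda>(\<omega>', \<omega>). U \<omega>' * g (Y \<omega>)) (\<omega>', \<omega>) \<partial>M \<partial>M)"
    by (rule nn_integral_indep_pair[of N ?N2]) (use indep sp s2 in auto)
  also have "\<dots> = (\<integral>\<^sup>+\<omega>'. U \<omega>' * (\<integral>\<^sup>+\<omega>. g (Y \<omega>) \<partial>M) \<partial>M)"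
    using Y g by (auto intro!: nn_integral_cong nn_integral_cmult)
  also have "\<dots> = (\<integral>\<^sup>+\<omega>. U \<omega> \<partial>M) * (\<integral>\<^sup>+\<omega>. g (Y \<omega>) \<partial>M)"
    by (rule nn_integral_multc[OF UM])
  finally show ?thesis by simp
qed

text \<open>Values at random times are reached only as almost sure limits; completeness makes them
  measurable.\<close>

lemma (in complete_measure) borel_measurable_AE_eq:
  fixes f :: "'a \<Rightarrow> 'b::topological_space"
  assumes g: "g \<in> borel_measurable M" and ae: "AE x in M. f x = g x"
  shows "f \<in> borel_measurable M"
proof (rule measurableI)
  fix B :: "'b set" assume "B \<in> sets borel"
  then have "g -` B \<inter> space M \<in> sets M" using g by (rule measurable_sets[rotated])
  then show "f -` B \<inter> space M \<in> sets M"
    by (rule in_sets_AE[rotated]) (use ae in auto)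
qed auto

text \<open>The summand 1 puts the grid point strictly above \<open>t\<close>, even if
  \<open>t\<close> lies on the grid. The limit in \<open>n\<close> is thus a limit from the right,
  and which grid cell contains a stopping time is known once the grid point is reached.\<close>

definition dyadic_above :: "nat \<Rightarrow> real \<Rightarrow> real" where
  "dyadic_above n t = (real (nat \<lfloor>2 ^ n * t\<rfloor>) + 1) / 2 ^ n"

lemma dyadic_above_bounds:
  assumes "0 \<le> t"
  shows "t < dyadic_above n t" "dyadic_above n t \<le> t + 1 / 2 ^ n"
proof -
  have "real (nat \<lfloor>2 ^ n * t\<rfloor>) \<le> 2 ^ n * t" "2 ^ n * t < real (nat \<lfloor>2 ^ n * t\<rfloor>) + 1"
    using assms by (simp, linarith)
  then show "t < dyadic_above n t" "dyadic_above n t \<le> t + 1 / 2 ^ n"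
    by (simp_all add: dyadic_above_def field_simps)
qed

lemma dyadic_above_nonneg: "0 \<le> dyadic_above n t"
  by (simp add: dyadic_above_def)

lemma dyadic_above_le:
  assumes "0 \<le> t" "t < real k / 2 ^ n"
  shows "dyadic_above n t \<le> real k / 2 ^ n"
proof -
  have "2 ^ n * t < real k" using assms(2) by (simp add: field_simps)
  then have "nat \<lfloor>2 ^ n * t\<rfloor> < k" using assms(1)
    by (simp add: nat_less_iff floor_less_iff)
  then show ?thesis by (simp add: dyadic_above_def divide_right_mono)
qed

lemma dyadic_above_antimono:
  assumes "0 \<le> t" "n \<le> m"
  shows "dyadic_above m t \<le> dyadic_above n t"
proof -
  \<comment> \<open>The coarse grid point also belongs to the finer grid and lies above
    \<open>t\<close>, so the first fine grid point above \<open>t\<close> cannot exceed it.\<close>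
  have eq: "dyadic_above n t = real ((nat \<lfloor>2 ^ n * t\<rfloor> + 1) * 2 ^ (m - n)) / 2 ^ m"
    using assms(2) by (simp add: dyadic_above_def field_simps flip: power_add)
  show ?thesis
    unfolding eq using dyadic_above_bounds(1)[OF assms(1), of n] eq
    by (intro dyadic_above_le assms) simp
qed

lemma dyadic_above_mono: "s \<le> t \<Longrightarrow> dyadic_above n s \<le> dyadic_above n t"
  unfolding dyadic_above_def by (intro divide_right_mono) (auto intro!: nat_mono floor_mono mult_left_mono)

lemma dyadic_above_tendsto:
  assumes "0 \<le> t"
  shows "(\<lambda>n. dyadic_above n t) \<longlonglongrightarrow> t"
proof (rule tendsto_sandwich)
  show "\<forall>\<^sub>F n in sequentially. t \<le> dyadic_above n t"
    by (intro always_eventually allI less_imp_le dyadic_above_bounds(1)[OF assms])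
  show "\<forall>\<^sub>F n in sequentially. dyadic_above n t \<le> t + 1 / 2 ^ n"
    by (intro always_eventually allI dyadic_above_bounds(2)[OF assms])
  show "(\<lambda>n. t + 1 / 2 ^ n) \<longlonglongrightarrow> t"
    by real_asymp
qed auto

lemma dyadic_above_filterlim:
  assumes "0 \<le> t"
  shows "filterlim (\<lambda>n. dyadic_above n t) (at_right t) sequentially"
  unfolding filterlim_at
  using dyadic_above_tendsto[OF assms] dyadic_above_bounds(1)[OF assms]
  by (intro conjI always_eventually allI) (simp_all add: order.strict_implies_not_eq[THEN not_sym])

text \<open>Only countably many times occur, so measurability at each fixed time suffices.\<close>

lemma measurable_dyadic_above:
  assumes "\<And>t. 0 \<le> t \<Longrightarrow> X t \<in> M \<rightarrow>\<^sub>M N" and "T \<in> borel_measurable M"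
  shows "(\<lambda>\<omega>. X (dyadic_above n (T \<omega>)) \<omega>) \<in> M \<rightarrow>\<^sub>M N"
proof -
  have "(\<lambda>\<omega>. nat \<lfloor>2 ^ n * T \<omega>\<rfloor>) \<in> M \<rightarrow>\<^sub>M count_space UNIV"
    using assms(2) by measurable
  moreover have "(\<lambda>\<omega>. X ((real k + 1) / 2 ^ n) \<omega>) \<in> M \<rightarrow>\<^sub>M N" for k
    by (rule assms(1)) simp
  ultimately have "(\<lambda>\<omega>. (\<lambda>k \<omega>. X ((real k + 1) / 2 ^ n) \<omega>) (nat \<lfloor>2 ^ n * T \<omega>\<rfloor>) \<omega>) \<in> M \<rightarrow>\<^sub>M N"
    by (rule measurable_compose_countable[rotated])
  then show ?thesis by (simp add: dyadic_above_def)
qed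

section \<open>Wald's identity for Levy processes\<close>

lemma emeasure_abs_le:
  fixes X :: "'a \<Rightarrow> real"
  assumes [measurable]: "X \<in> borel_measurable M"
  shows "emeasure M {\<omega> \<in> space M. \<bar>X \<omega>\<bar> \<le> K} = (\<integral>\<^sup>+\<omega>. indicator {x. \<bar>x\<bar> \<le> K} (X \<omega>) \<partial>M)"
proof -
  have "(\<integral>\<^sup>+\<omega>. indicator {x. \<bar>x\<bar> \<le> K} (X \<omega>) \<partial>M) =
      (\<integral>\<^sup>+\<omega>. indicator {\<omega> \<in> space M. \<bar>X \<omega>\<bar> \<le> K} \<omega> \<partial>M)"
    by (intro nn_integral_cong) (auto simp: indicator_def)
  then show ?thesis by simp
qed

lemma levy_process_wrt_distr_increment:
  assumes "levy_process_wrt M F X" "0 \<le> s" "s \<le> t"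
  shows "distr M borel (\<lambda>\<omega>. X t \<omega> - X s \<omega>) = distr M borel (X (t - s))"
proof -
  have "\<forall>s t. 0 \<le> s \<and> 0 \<le> t \<longrightarrow>
      distr M borel (\<lambda>\<omega>. X (s + t) \<omega> - X s \<omega>) = distr M borel (X t)"
    using assms(1) unfolding levy_process_wrt_def by blast
  from this[rule_format, of s "t - s"] show ?thesis using assms(2,3) by simp
qed

lemma nn_integral_distr_eq:
  assumes "distr M borel X = distr M' borel X'"
    and "X \<in> borel_measurable M" "X' \<in> borel_measurable M'" "f \<in> borel_measurable borel"
  shows "(\<integral>\<^sup>+\<omega>. f (X \<omega>) \<partial>M) = (\<integral>\<^sup>+\<omega>. f (X' \<omega>) \<partial>M')"
  using nn_integral_distr[OF assms(2), of f] nn_integral_distr[OF assms(3), of f] assms(1,4) by simp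

context prob_space begin

lemma levy_nn_integral_increment:
  fixes X :: "real \<Rightarrow> 'a \<Rightarrow> 'b::euclidean_space"
  assumes levy: "levy_process_wrt M F X" and st: "0 \<le> s" "s \<le> t" and g: "g \<in> borel_measurable borel"
  shows "(\<integral>\<^sup>+\<omega>. g (X t \<omega> - X s \<omega>) \<partial>M) = (\<integral>\<^sup>+\<omega>. g (X (t - s) \<omega>) \<partial>M)"
proof -
  have m: "X r \<in> borel_measurable M" if "0 \<le> r" for r
    using levy that by (simp add: levy_process_wrt_def)
  show ?thesis
    by (rule nn_integral_distr_eq[OF levy_process_wrt_distr_increment[OF levy st]])
      (use st g in \<open>auto intro!: borel_measurable_diff m\<close>)
qed

text \<open>The simple Markov property for nonnegative functions; it serves Wald's identity and the
  multiplicativity of Laplace transforms alike.\<close>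

lemma levy_nn_integral_mult_increment:
  fixes U :: "'a \<Rightarrow> ennreal" and X :: "real \<Rightarrow> 'a \<Rightarrow> 'b::euclidean_space"
  assumes levy: "levy_process_wrt M F X" and sp: "space (F s) = space M"
    and st: "0 \<le> s" "s \<le> t" and U: "U \<in> borel_measurable (F s)" and g: "g \<in> borel_measurable borel"
  shows "(\<integral>\<^sup>+\<omega>. U \<omega> * g (X t \<omega> - X s \<omega>) \<partial>M) = (\<integral>\<^sup>+\<omega>. U \<omega> \<partial>M) * (\<integral>\<^sup>+\<omega>. g (X (t - s) \<omega>) \<partial>M)"
  unfolding levy_nn_integral_increment[OF levy st g, symmetric]
proof (rule nn_integral_indep_mult[where N="F s" and g=g and Y="\<lambda>\<omega>. X t \<omega> - X s \<omega>"])
  show "indep_set (sets (F s)) {(\<lambda>\<omega>. X t \<omega> - X s \<omega>) -` B \<inter> space M |B. B \<in> sets borel}"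
    using levy st unfolding levy_process_wrt_def by blast
  show "(\<lambda>\<omega>. X t \<omega> - X s \<omega>) \<in> borel_measurable M"
    using levy st by (intro borel_measurable_diff) (auto simp: levy_process_wrt_def)
qed (use sp U g in auto)

end

locale integrable_levy_process = prob_space M + complete_measure M + filtration "space M" F
  for M :: "'a measure" and F :: "real \<Rightarrow> 'a measure" +
  fixes Z :: "real \<Rightarrow> 'a \<Rightarrow> real"
  assumes subalgebra: "\<And>t. sets (F t) \<subseteq> sets M"
    and levy: "levy_process_wrt M F Z"
    and integrable_1: "integrable M (Z 1)"
begin

lemma measurable_F: "0 \<le> t \<Longrightarrow> Z t \<in> borel_measurable (F t)"
  using levy by (simp add: levy_process_wrt_def)

lemma measurable_M [measurable (raw)]: "0 \<le> t \<Longrightarrow> Z t \<in> borel_measurable M"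
  using levy by (simp add: levy_process_wrt_def)

lemma AE_start: "AE \<omega> in M. Z 0 \<omega> = 0"
  using levy by (simp add: levy_process_wrt_def)

lemmas nn_integral_increment = levy_nn_integral_increment[OF levy]
lemmas nn_integral_mult_increment = levy_nn_integral_mult_increment[OF levy space_F]

text \<open>Splitting \<open>Z 1 = Z s + (Z 1 - Z s)\<close> on the independent event that the second summand is at
  most \<open>K\<close> transfers integrability bounds from \<open>Z 1\<close> to \<open>Z s\<close>.\<close>

lemma nn_integral_le_1:
  assumes s: "0 \<le> s" "s \<le> 1" and L: "L \<in> sets (F s)"
  shows "(\<integral>\<^sup>+\<omega>. ennreal \<bar>Z s \<omega>\<bar> * indicator L \<omega> \<partial>M) * emeasure M {\<omega> \<in> space M. \<bar>Z (1 - s) \<omega>\<bar> \<le> K}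
    \<le> (\<integral>\<^sup>+\<omega>. ennreal (\<bar>Z 1 \<omega>\<bar> + \<bar>K\<bar>) * indicator L \<omega> \<partial>M)"
proof -
  have [measurable]: "L \<in> sets (F s)" "Z s \<in> borel_measurable (F s)"
    using L s by (auto intro: measurable_F)
  have "(\<integral>\<^sup>+\<omega>. ennreal \<bar>Z s \<omega>\<bar> * indicator L \<omega> \<partial>M) * emeasure M {\<omega> \<in> space M. \<bar>Z (1 - s) \<omega>\<bar> \<le> K} =
     (\<integral>\<^sup>+\<omega>. ennreal \<bar>Z s \<omega>\<bar> * indicator L \<omega> \<partial>M) * (\<integral>\<^sup>+\<omega>. indicator {x. \<bar>x\<bar> \<le> K} (Z (1 - s) \<omega>) \<partial>M)"
    using s by (intro arg_cong2[where f="(*)"] refl emeasure_abs_le measurable_M) auto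
  also have "\<dots> = (\<integral>\<^sup>+\<omega>. ennreal \<bar>Z s \<omega>\<bar> * indicator L \<omega> * indicator {x. \<bar>x\<bar> \<le> K} (Z 1 \<omega> - Z s \<omega>) \<partial>M)"
    using s by (intro nn_integral_mult_increment[symmetric]) auto
  also have "\<dots> \<le> (\<integral>\<^sup>+\<omega>. ennreal (\<bar>Z 1 \<omega>\<bar> + \<bar>K\<bar>) * indicator L \<omega> \<partial>M)"
    by (intro nn_integral_mono) (auto simp: indicator_def simp del: ennreal_plus intro!: ennreal_leI)
  finally show ?thesis .
qed

lemma exists_bound:
  assumes "0 \<le> s" "0 < e"
  obtains K :: real where "0 \<le> K" "prob {\<omega> \<in> space M. K < \<bar>Z s \<omega>\<bar>} < e"
proof -
  have [measurable]: "Z s \<in> borel_measurable M" using assms by (intro measurable_M)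
  have "(\<lambda>n. prob {\<omega> \<in> space M. real n < \<bar>Z s \<omega>\<bar>}) \<longlonglongrightarrow> prob (\<Inter>n. {\<omega> \<in> space M. real n < \<bar>Z s \<omega>\<bar>})"
    by (rule finite_Lim_measure_decseq) (auto simp: decseq_def)
  moreover have "(\<Inter>n. {\<omega> \<in> space M. real n < \<bar>Z s \<omega>\<bar>}) = {}"
  proof -
    have "\<exists>n. \<not> real n < \<bar>Z s \<omega>\<bar>" for \<omega>
      using real_arch_simple[of "\<bar>Z s \<omega>\<bar>"] by (auto simp: not_less)
    then show ?thesis by blast
  qed
  ultimately have "(\<lambda>n. prob {\<omega> \<in> space M. real n < \<bar>Z s \<omega>\<bar>}) \<longlonglongrightarrow> 0" by simp
  from order_tendstoD(2)[OF this \<open>0 < e\<close>] obtain n where "prob {\<omega> \<in> space M. real n < \<bar>Z s \<omega>\<bar>} < e"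
    by (auto simp: eventually_sequentially)
  then show ?thesis by (intro that[of "real n"]) auto
qed

text \<open>\<open>nn_integral_le_1\<close> bounds the mean of \<open>|Z s|\<close> times the
  probability that \<open>|Z (1 - s)| \<le> K\<close>; a \<open>K\<close> that makes this
  probability positive leaves a finite mean.\<close>

lemma integrable_le_1:
  assumes s: "0 \<le> s" "s \<le> 1"
  shows "integrable M (Z s)"
proof -
  have [measurable]: "Z s \<in> borel_measurable M" "Z (1 - s) \<in> borel_measurable M" "Z 1 \<in> borel_measurable M"
    using s by (auto intro!: measurable_M)
  obtain K where K: "0 \<le> K" "prob {\<omega> \<in> space M. K < \<bar>Z (1 - s) \<omega>\<bar>} < 1"
    using exists_bound[of "1 - s" 1] s by auto
  have "prob {\<omega> \<in> space M. \<bar>Z (1 - s) \<omega>\<bar> \<le> K} = 1 - prob {\<omega> \<in> space M. K < \<bar>Z (1 - s) \<omega>\<bar>}"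
    by (subst prob_compl[symmetric]) (auto intro!: arg_cong[where f=prob])
  with K have pos: "0 < prob {\<omega> \<in> space M. \<bar>Z (1 - s) \<omega>\<bar> \<le> K}" by simp
  have "(\<integral>\<^sup>+\<omega>. ennreal \<bar>Z s \<omega>\<bar> * indicator (space M) \<omega> \<partial>M) * emeasure M {\<omega> \<in> space M. \<bar>Z (1 - s) \<omega>\<bar> \<le> K}
    \<le> (\<integral>\<^sup>+\<omega>. ennreal (\<bar>Z 1 \<omega>\<bar> + \<bar>K\<bar>) * indicator (space M) \<omega> \<partial>M)"
    using sets.top[of "F s"] by (intro nn_integral_le_1 s) (simp add: space_F)
  also have "\<dots> = (\<integral>\<^sup>+\<omega>. ennreal (\<bar>Z 1 \<omega>\<bar> + \<bar>K\<bar>) \<partial>M)"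
    by (intro nn_integral_cong) auto
  also have "\<dots> < \<infinity>"
    using integrable_1 by (subst nn_integral_eq_integral) auto
  finally have "(\<integral>\<^sup>+\<omega>. ennreal \<bar>Z s \<omega>\<bar> * indicator (space M) \<omega> \<partial>M) < \<infinity>"
    using pos by (auto simp: ennreal_mult_less_top emeasure_eq_measure)
  also have "(\<integral>\<^sup>+\<omega>. ennreal \<bar>Z s \<omega>\<bar> * indicator (space M) \<omega> \<partial>M) = (\<integral>\<^sup>+\<omega>. ennreal (norm (Z s \<omega>)) \<partial>M)"
    by (intro nn_integral_cong) auto
  finally show ?thesis by (intro integrableI_bounded) auto
qed

lemma integral_increment:
  assumes "0 \<le> s" "s \<le> t" "integrable M (Z (t - s))"
  shows "integrable M (\<lambda>\<omega>. Z t \<omega> - Z s \<omega>)" "(\<integral>\<omega>. Z t \<omega> - Z s \<omega> \<partial>M) = (\<integral>\<omega>. Z (t - s) \<omega> \<partial>M)"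
proof -
  note d = levy_process_wrt_distr_increment[OF levy assms(1,2)]
  have m: "Z (t - s) \<in> borel_measurable M" "(\<lambda>\<omega>. Z t \<omega> - Z s \<omega>) \<in> borel_measurable M"
    using assms by (auto intro!: measurable_M borel_measurable_diff)
  have "integrable M (\<lambda>\<omega>. Z t \<omega> - Z s \<omega>) \<longleftrightarrow> integrable (distr M borel (\<lambda>\<omega>. Z t \<omega> - Z s \<omega>)) (\<lambda>x. x)"
    by (rule integrable_distr_eq[OF m(2), symmetric]) simp
  also have "\<dots> \<longleftrightarrow> integrable (distr M borel (Z (t - s))) (\<lambda>x. x)"
    by (simp only: d)
  also have "\<dots> \<longleftrightarrow> integrable M (Z (t - s))"
    by (rule integrable_distr_eq[OF m(1)]) simp
  finally show "integrable M (\<lambda>\<omega>. Z t \<omega> - Z s \<omega>)" using assms(3) by blast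
  have "(\<integral>\<omega>. Z t \<omega> - Z s \<omega> \<partial>M) = (\<integral>x. x \<partial>distr M borel (\<lambda>\<omega>. Z t \<omega> - Z s \<omega>))"
    by (rule integral_distr[OF m(2), symmetric]) simp
  also have "\<dots> = (\<integral>x. x \<partial>distr M borel (Z (t - s)))"
    by (simp only: d)
  also have "\<dots> = (\<integral>\<omega>. Z (t - s) \<omega> \<partial>M)"
    by (rule integral_distr[OF m(1)]) simp
  finally show "(\<integral>\<omega>. Z t \<omega> - Z s \<omega> \<partial>M) = (\<integral>\<omega>. Z (t - s) \<omega> \<partial>M)" .
qed

section \<open>Means at all times and their continuity at 0\<close>

lemma integrable_Z:
  assumes "0 \<le> t"
  shows "integrable M (Z t)"
proof -
  have "integrable M (Z t)" if "0 \<le> t" "t \<le> real n + 1" for n t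
    using that
  proof (induction n arbitrary: t)
    case 0
    then show ?case by (intro integrable_le_1) auto
  next
    case (Suc n)
    show ?case
    proof (cases "t \<le> 1")
      case True
      then show ?thesis using Suc.prems by (intro integrable_le_1)
    next
      case False
      then have "integrable M (\<lambda>\<omega>. (Z t \<omega> - Z 1 \<omega>) + Z 1 \<omega>)"
        using Suc.prems integrable_1 by (intro Bochner_Integration.integrable_add integral_increment Suc.IH) auto
      then show ?thesis by simp
    qed
  qed
  from this[of t "nat \<lceil>t\<rceil>"] show ?thesis using assms by linarith
qed

lemma expectation_add:
  assumes "0 \<le> s" "0 \<le> t"
  shows "expectation (Z (s + t)) = expectation (Z s) + expectation (Z t)"
  using integral_increment(2)[of s "s + t"] assms integrable_Z[of "s + t"] integrable_Z[of s] integrable_Z[of t]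
  by simp

lemma expectation_multiple:
  assumes "0 \<le> h"
  shows "expectation (Z (real k * h)) = real k * expectation (Z h)"
proof (induction k)
  case 0
  show ?case using expectation_add[of 0 0] by simp
next
  case (Suc k)
  then show ?case using expectation_add[of "real k * h" h] assms by (simp add: algebra_simps)
qed

lemma expectation_dyadic: "expectation (Z (1 / 2 ^ n)) = expectation (Z 1) / 2 ^ n"
  using expectation_multiple[of "1 / 2 ^ n" "2 ^ n"] by (simp add: field_simps)

text \<open>Stochastic continuity at 0 becomes continuity in mean because the variables
  \<open>Z s\<close> with small \<open>s\<close> are uniformly integrable: over an event known at
  time \<open>s\<close>, the integral of \<open>|Z s|\<close> is at most twice that of the single
  integrable variable \<open>B\<close>.\<close>

lemma mean_continuous_at_0:
  assumes e: "0 < e"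
  obtains d where "0 < d" "d \<le> 1" "\<And>s. 0 \<le> s \<Longrightarrow> s \<le> d \<Longrightarrow> (\<integral>\<^sup>+\<omega>. ennreal \<bar>Z s \<omega>\<bar> \<partial>M) \<le> ennreal e"
proof -
  have small: "\<exists>d>0. \<forall>s. 0 \<le> s \<and> s \<le> d \<longrightarrow> prob {\<omega> \<in> space M. a < \<bar>Z s \<omega>\<bar>} < p" if a: "0 < a" and p: "0 < p" for a p
  proof -
    have "((\<lambda>t. prob {\<omega> \<in> space M. a < norm (Z t \<omega> - Z 0 \<omega>)}) \<longlongrightarrow> 0) (at 0 within {0..})"
      using levy a unfolding levy_process_wrt_def by (meson order_refl)
    from order_tendstoD(2)[OF this p] obtain d where d: "0 < d"
      "\<And>t. 0 < t \<Longrightarrow> t < d \<Longrightarrow> prob {\<omega> \<in> space M. a < norm (Z t \<omega> - Z 0 \<omega>)} < p"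
      by (auto simp: eventually_at dist_real_def)
    have eq: "prob {\<omega> \<in> space M. a < norm (Z t \<omega> - Z 0 \<omega>)} = prob {\<omega> \<in> space M. a < \<bar>Z t \<omega>\<bar>}" if "0 \<le> t" for t
    proof (rule finite_measure_eq_AE)
      have [measurable]: "Z t \<in> borel_measurable M" "Z 0 \<in> borel_measurable M"
        using that by (auto intro: measurable_M)
      show "{\<omega> \<in> space M. a < norm (Z t \<omega> - Z 0 \<omega>)} \<in> events" "{\<omega> \<in> space M. a < \<bar>Z t \<omega>\<bar>} \<in> events" by auto
      show "AE x in M. (x \<in> {\<omega> \<in> space M. a < norm (Z t \<omega> - Z 0 \<omega>)}) = (x \<in> {\<omega> \<in> space M. a < \<bar>Z t \<omega>\<bar>})"
        using AE_start by eventually_elim auto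
    qed
    have "prob {\<omega> \<in> space M. a < \<bar>Z 0 \<omega>\<bar>} = 0"
      using a eq[of 0] by simp
    then have "prob {\<omega> \<in> space M. a < \<bar>Z s \<omega>\<bar>} < p" if "0 \<le> s" "s \<le> d / 2" for s
      using that d(2)[of s] d(1) eq[of s] p by (cases "s = 0") auto
    then show ?thesis using d(1) by (intro exI[of _ "d / 2"]) auto
  qed
  have [measurable]: "Z 1 \<in> borel_measurable M" by (intro measurable_M) simp
  obtain K where K: "0 \<le> K" "prob {\<omega> \<in> space M. K < \<bar>Z 1 \<omega>\<bar>} < 1 / 4"
    using exists_bound[of 1 "1/4"] by auto
  define B where "B = (\<lambda>\<omega>. \<bar>Z 1 \<omega>\<bar> + \<bar>K + 1\<bar>)"
  have [measurable]: "B \<in> borel_measurable M" by (simp add: B_def)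
  have Bint: "integrable M B" using integrable_1 by (simp add: B_def)
  have Bn: "integrable M (\<lambda>\<omega>. B \<omega> * indicator {\<omega> \<in> space M. real n < B \<omega>} \<omega>)"
    "AE \<omega> in M. 0 \<le> B \<omega> * indicator {\<omega> \<in> space M. real n < B \<omega>} \<omega>" for n
    by (rule Bochner_Integration.integrable_bound[OF Bint]) (auto simp: B_def indicator_def)
  have "(\<lambda>n. \<integral>\<omega>. B \<omega> * indicator {\<omega> \<in> space M. real n < B \<omega>} \<omega> \<partial>M) \<longlonglongrightarrow> (\<integral>\<omega>. 0 \<partial>M)"
  proof (rule integral_dominated_convergence[where w=B])
    show "AE x in M. (\<lambda>n. B x * indicat_real {\<omega> \<in> space M. real n < B \<omega>} x) \<longlonglongrightarrow> 0"
    proof (rule AE_I2)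
      fix x
      obtain N where N: "B x \<le> real N" using real_arch_simple by blast
      have "\<forall>\<^sub>F n in sequentially. B x * indicat_real {\<omega> \<in> space M. real n < B \<omega>} x = 0"
        using eventually_ge_at_top[of N] by eventually_elim (use N in \<open>auto simp: indicator_def\<close>)
      then show "(\<lambda>n. B x * indicat_real {\<omega> \<in> space M. real n < B \<omega>} x) \<longlonglongrightarrow> 0"
        by (rule tendsto_eventually)
    qed
  qed (use Bint in \<open>auto simp: B_def indicator_def\<close>)
  then have "(\<lambda>n. \<integral>\<omega>. B \<omega> * indicator {\<omega> \<in> space M. real n < B \<omega>} \<omega> \<partial>M) \<longlonglongrightarrow> 0" by simp
  from order_tendstoD(2)[OF this, of "e / 8"] e obtain n where
    n: "(\<integral>\<omega>. B \<omega> * indicator {\<omega> \<in> space M. real n < B \<omega>} \<omega> \<partial>M) < e / 8"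
    by (auto simp: eventually_sequentially)
  \<comment> \<open>Together with \<open>K\<close> this gives \<open>|Z 1 - Z s| \<le> K + 1\<close>
    with probability at least 1/2, so that dividing by the probability costs a factor 2.\<close>
  obtain d1 where d1: "0 < d1" "\<And>s. 0 \<le> s \<Longrightarrow> s \<le> d1 \<Longrightarrow> prob {\<omega> \<in> space M. 1 < \<bar>Z s \<omega>\<bar>} < 1 / 4"
    using small[of 1 "1/4"] by auto
  \<comment> \<open>Error budget: values of \<open>Z s\<close> up to \<open>e / 2\<close> contribute
    \<open>e / 2\<close>. On the event beyond, splitting \<open>B\<close> at level \<open>n\<close>
    gives \<open>e / 8 + e / 8\<close>, and the factor 2 turns this into the other
    \<open>e / 2\<close>.\<close>
  define p where "p = e / (8 * (real n + 1))"
  have p: "0 < p" "real n * p \<le> e / 8" using e by (auto simp: p_def field_simps)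
  obtain d2 where d2: "0 < d2" "\<And>s. 0 \<le> s \<Longrightarrow> s \<le> d2 \<Longrightarrow> prob {\<omega> \<in> space M. e / 2 < \<bar>Z s \<omega>\<bar>} < p"
    using small[of "e/2" p] e p by auto
  show ?thesis
  proof (rule that[of "min 1 (min d1 d2)"])
    fix s assume s: "0 \<le> s" "s \<le> min 1 (min d1 d2)"
    have [measurable]: "Z s \<in> borel_measurable M" "Z (1 - s) \<in> borel_measurable M"
      "Z s \<in> borel_measurable (F s)"
      using s by (auto intro!: measurable_M measurable_F)
    let ?L = "{\<omega> \<in> space (F s). e / 2 < \<bar>Z s \<omega>\<bar>}"
    have LF: "?L \<in> sets (F s)" by measurable
    then have [measurable]: "?L \<in> sets M" using subalgebra by blast
    have PL: "prob ?L < p" using d2(2)[of s] s by (simp add: space_F)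
    have "prob {\<omega> \<in> space M. K + 1 < \<bar>Z 1 \<omega> - Z s \<omega>\<bar>} \<le>
        prob ({\<omega> \<in> space M. K < \<bar>Z 1 \<omega>\<bar>} \<union> {\<omega> \<in> space M. 1 < \<bar>Z s \<omega>\<bar>})"
      by (intro finite_measure_mono) auto
    also have "\<dots> \<le> 1 / 4 + 1 / 4"
      using K(2) d1(2)[of s] s by (intro order_trans[OF measure_Un_le]) auto
    finally have "prob {\<omega> \<in> space M. K + 1 < \<bar>Z 1 \<omega> - Z s \<omega>\<bar>} \<le> 1 / 2" by simp
    moreover have "prob {\<omega> \<in> space M. \<bar>Z 1 \<omega> - Z s \<omega>\<bar> \<le> K + 1} = 1 - prob {\<omega> \<in> space M. K + 1 < \<bar>Z 1 \<omega> - Z s \<omega>\<bar>}"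
      by (subst prob_compl[symmetric]) (auto intro!: arg_cong[where f=prob])
    ultimately have half': "1 / 2 \<le> prob {\<omega> \<in> space M. \<bar>Z 1 \<omega> - Z s \<omega>\<bar> \<le> K + 1}" by simp
    have "emeasure M {\<omega> \<in> space M. \<bar>Z 1 \<omega> - Z s \<omega>\<bar> \<le> K + 1} = emeasure M {\<omega> \<in> space M. \<bar>Z (1 - s) \<omega>\<bar> \<le> K + 1}"
    proof -
      have "emeasure M {\<omega> \<in> space M. \<bar>Z 1 \<omega> - Z s \<omega>\<bar> \<le> K + 1} = (\<integral>\<^sup>+\<omega>. indicator {x. \<bar>x\<bar> \<le> K + 1} (Z 1 \<omega> - Z s \<omega>) \<partial>M)"
        by (intro emeasure_abs_le) measurable
      also have "\<dots> = (\<integral>\<^sup>+\<omega>. indicator {x. \<bar>x\<bar> \<le> K + 1} (Z (1 - s) \<omega>) \<partial>M)"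
        using s by (intro nn_integral_increment) auto
      also have "\<dots> = emeasure M {\<omega> \<in> space M. \<bar>Z (1 - s) \<omega>\<bar> \<le> K + 1}"
        by (intro emeasure_abs_le[symmetric]) measurable
      finally show ?thesis .
    qed
    with ennreal_leI[OF half'] have half: "ennreal (1 / 2) \<le> emeasure M {\<omega> \<in> space M. \<bar>Z (1 - s) \<omega>\<bar> \<le> K + 1}"
      by (simp only: emeasure_eq_measure)
    have "(\<integral>\<^sup>+\<omega>. ennreal \<bar>Z s \<omega>\<bar> * indicator ?L \<omega> \<partial>M) * ennreal (1 / 2) \<le>
       (\<integral>\<^sup>+\<omega>. ennreal \<bar>Z s \<omega>\<bar> * indicator ?L \<omega> \<partial>M) * emeasure M {\<omega> \<in> space M. \<bar>Z (1 - s) \<omega>\<bar> \<le> K + 1}"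
      using half by (intro mult_left_mono) auto
    also have "\<dots> \<le> (\<integral>\<^sup>+\<omega>. ennreal (B \<omega>) * indicator ?L \<omega> \<partial>M)"
      unfolding B_def using s by (intro nn_integral_le_1 LF) auto
    also have "\<dots> \<le> (\<integral>\<^sup>+\<omega>. ennreal (B \<omega> * indicator {\<omega> \<in> space M. real n < B \<omega>} \<omega>) + ennreal (real n) * indicator ?L \<omega> \<partial>M)"
      by (intro nn_integral_mono) (auto simp: indicator_def B_def simp del: ennreal_plus simp flip: ennreal_plus intro!: ennreal_leI)
    also have "\<dots> = (\<integral>\<^sup>+\<omega>. ennreal (B \<omega> * indicator {\<omega> \<in> space M. real n < B \<omega>} \<omega>) \<partial>M) +
        (\<integral>\<^sup>+\<omega>. ennreal (real n) * indicator ?L \<omega> \<partial>M)"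
      by (rule nn_integral_add) measurable
    also have "\<dots> = ennreal (\<integral>\<omega>. B \<omega> * indicator {\<omega> \<in> space M. real n < B \<omega>} \<omega> \<partial>M) + ennreal (real n) * ennreal (prob ?L)"
      using nn_integral_cmult_indicator[OF \<open>?L \<in> sets M\<close>, of "ennreal (real n)"]
      unfolding nn_integral_eq_integral[OF Bn] emeasure_eq_measure by (rule arg_cong)
    also have "\<dots> \<le> ennreal (e / 8) + ennreal (e / 8)"
    proof (intro add_mono)
      have "real n * prob ?L \<le> real n * p" using PL by (intro mult_left_mono) auto
      then have "real n * prob ?L \<le> e / 8" using p(2) by linarith
      then show "ennreal (real n) * ennreal (prob ?L) \<le> ennreal (e / 8)"
        by (simp add: ennreal_leI flip: ennreal_mult)
    qed (use n in \<open>auto intro!: ennreal_leI\<close>)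
    also have "\<dots> = ennreal (e / 4)" using e by (simp flip: ennreal_plus)
    finally have tail: "(\<integral>\<^sup>+\<omega>. ennreal \<bar>Z s \<omega>\<bar> * indicator ?L \<omega> \<partial>M) * ennreal (1 / 2) \<le> ennreal (e / 4)" .
    have tail': "(\<integral>\<^sup>+\<omega>. ennreal \<bar>Z s \<omega>\<bar> * indicator ?L \<omega> \<partial>M) \<le> ennreal (e / 2)"
    proof -
      let ?x = "\<integral>\<^sup>+\<omega>. ennreal \<bar>Z s \<omega>\<bar> * indicator ?L \<omega> \<partial>M"
      have "ennreal (1 / 2) * ennreal 2 = 1" by (subst ennreal_mult[symmetric]) auto
      then have "?x = ?x * ennreal (1 / 2) * ennreal 2"
        by (simp only: mult.assoc mult_1_right)
      also have "\<dots> \<le> ennreal (e / 4) * ennreal 2" by (intro mult_right_mono tail) auto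
      also have "\<dots> = ennreal (e / 2)" using e by (subst ennreal_mult[symmetric]) auto
      finally show ?thesis .
    qed
    have "(\<integral>\<^sup>+\<omega>. ennreal \<bar>Z s \<omega>\<bar> \<partial>M) \<le> (\<integral>\<^sup>+\<omega>. ennreal (e / 2) + ennreal \<bar>Z s \<omega>\<bar> * indicator ?L \<omega> \<partial>M)"
      using e by (intro nn_integral_mono) (auto simp: indicator_def space_F simp del: ennreal_plus simp flip: ennreal_plus intro!: ennreal_leI)
    also have "\<dots> = ennreal (e / 2) + (\<integral>\<^sup>+\<omega>. ennreal \<bar>Z s \<omega>\<bar> * indicator ?L \<omega> \<partial>M)"
    proof (subst nn_integral_add)
      show "(\<lambda>\<omega>. ennreal \<bar>Z s \<omega>\<bar> * indicator ?L \<omega>) \<in> borel_measurable M" by measurable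
    qed (simp_all add: emeasure_space_1)
    also have "\<dots> \<le> ennreal (e / 2) + ennreal (e / 2)" by (intro add_mono tail') auto
    also have "\<dots> = ennreal e" using e by (simp flip: ennreal_plus)
    finally show "(\<integral>\<^sup>+\<omega>. ennreal \<bar>Z s \<omega>\<bar> \<partial>M) \<le> ennreal e" .
  qed (use d1 d2 in auto)
qed

section \<open>Wald's identity at dyadic times and in the limit\<close>

lemma sets_stopping_interval:
  assumes st: "stopping_time F T" and nonneg: "\<And>\<omega>. \<omega> \<in> space M \<Longrightarrow> 0 \<le> T \<omega>"
  shows "{\<omega> \<in> space M. s \<le> T \<omega>} \<in> sets (F s)" "{\<omega> \<in> space M. s \<le> T \<omega> \<and> T \<omega> < t} \<in> sets (F t)"
proof -
  have lt: "{\<omega> \<in> space M. T \<omega> < t} \<in> sets (F t)" for t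
    using stopping_time_less_const[OF st, of t] by (simp add: pred_def space_F)
  have "space M - {\<omega> \<in> space M. T \<omega> < s} \<in> sets (F s)" for s
    using sets.compl_sets[OF lt[of s]] by (simp add: space_F)
  moreover have "space M - {\<omega> \<in> space M. T \<omega> < s} = {\<omega> \<in> space M. s \<le> T \<omega>}" for s by auto
  ultimately have ge: "{\<omega> \<in> space M. s \<le> T \<omega>} \<in> sets (F s)" for s by simp
  then show "{\<omega> \<in> space M. s \<le> T \<omega>} \<in> sets (F s)" .
  show "{\<omega> \<in> space M. s \<le> T \<omega> \<and> T \<omega> < t} \<in> sets (F t)"
  proof (cases "s \<le> t")
    case True
    have "{\<omega> \<in> space M. s \<le> T \<omega>} \<inter> {\<omega> \<in> space M. T \<omega> < t} \<in> sets (F t)"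
      using ge[of s] sets_F_mono[OF True] lt by blast
    moreover have "{\<omega> \<in> space M. s \<le> T \<omega>} \<inter> {\<omega> \<in> space M. T \<omega> < t} = {\<omega> \<in> space M. s \<le> T \<omega> \<and> T \<omega> < t}"
      by auto
    ultimately show ?thesis by simp
  next
    case False
    then have *: "{\<omega> \<in> space M. s \<le> T \<omega> \<and> T \<omega> < t} = {}" by auto
    show ?thesis unfolding * by (rule sets.empty_sets)
  qed
qed

text \<open>Wald's identity for the random walk of the grid increments. Step \<open>k\<close> counts
  on the event \<open>E k\<close> that \<open>T\<close> has not occurred before \<open>k h\<close>;
  this is known at time \<open>k h\<close> and so independent of the increment that follows. The
  expected number of steps is finite, which lets sum and mean be interchanged.\<close>

lemma wald_dyadic:
  assumes st: "stopping_time F T" and nonneg: "\<And>\<omega>. \<omega> \<in> space M \<Longrightarrow> 0 \<le> T \<omega>"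
    and int: "integrable M T"
  shows "integrable M (\<lambda>\<omega>. Z (dyadic_above n (T \<omega>)) \<omega>)"
    "expectation (\<lambda>\<omega>. Z (dyadic_above n (T \<omega>)) \<omega>) = expectation (Z 1) * expectation (\<lambda>\<omega>. dyadic_above n (T \<omega>))"
proof -
  define h :: real where "h = 1 / 2 ^ n"
  have h: "0 < h" by (simp add: h_def)
  have [measurable]: "T \<in> borel_measurable M" using int by auto
  define N where "N \<omega> = nat \<lfloor>2 ^ n * T \<omega>\<rfloor> + 1" for \<omega>
  have [measurable]: "N \<in> M \<rightarrow>\<^sub>M count_space UNIV" unfolding N_def by measurable
  have d: "dyadic_above n (T \<omega>) = real (N \<omega>) * h" for \<omega>
    by (simp add: dyadic_above_def N_def h_def)
  have N: "k < N \<omega> \<longleftrightarrow> real k * h \<le> T \<omega>" if "\<omega> \<in> space M" for k \<omega>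
  proof -
    have "k < N \<omega> \<longleftrightarrow> int k \<le> \<lfloor>2 ^ n * T \<omega>\<rfloor>"
      using nonneg[OF that] by (auto simp: N_def less_Suc_eq_le le_nat_iff)
    also have "\<dots> \<longleftrightarrow> real k \<le> 2 ^ n * T \<omega>" by (simp add: le_floor_iff)
    also have "\<dots> \<longleftrightarrow> real k * h \<le> T \<omega>" by (simp add: h_def field_simps)
    finally show ?thesis .
  qed
  have Nint: "integrable M (\<lambda>\<omega>. real (N \<omega>))"
  proof (rule Bochner_Integration.integrable_bound)
    show "integrable M (\<lambda>\<omega>. 2 ^ n * T \<omega> + 1)" using int by auto
    show "AE \<omega> in M. norm (real (N \<omega>)) \<le> norm (2 ^ n * T \<omega> + 1)"
      using nonneg by (intro AE_I2) (simp add: N_def)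
  qed simp
  define E where "E k = {\<omega> \<in> space M. real k * h \<le> T \<omega>}" for k
  have E: "E k \<in> sets (F (real k * h))" for k
    unfolding E_def using sets_stopping_interval(1)[OF st nonneg] .
  then have [measurable]: "E k \<in> events" for k using subalgebra by blast
  have summable_prob: "summable (\<lambda>k. prob (E k))"
  proof (rule summableI_nonneg_bounded)
    fix m
    have "(\<Sum>k<m. prob (E k)) = expectation (\<lambda>\<omega>. \<Sum>k<m. indicat_real (E k) \<omega>)"
      by (subst Bochner_Integration.integral_sum) (auto simp: less_top[symmetric])
    also have "\<dots> \<le> expectation (\<lambda>\<omega>. real (N \<omega>))"
    proof (rule integral_mono)
      fix \<omega> assume \<omega>: "\<omega> \<in> space M"
      have "(\<Sum>k<m. indicat_real (E k) \<omega>) = (\<Sum>k<m. if k < N \<omega> then 1 else 0)"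
        using N[OF \<omega>] \<omega> by (intro sum.cong) (auto simp: E_def)
      also have "\<dots> = real (card ({..<m} \<inter> {k. k < N \<omega>}))" by (simp add: sum.If_cases)
      also have "\<dots> \<le> real (card {..<N \<omega>})" by (intro of_nat_mono card_mono) auto
      finally show "(\<Sum>k<m. indicat_real (E k) \<omega>) \<le> real (N \<omega>)" by simp
    qed (use Nint in \<open>auto simp: less_top[symmetric] intro!: Bochner_Integration.integrable_sum\<close>)
    finally show "(\<Sum>k<m. prob (E k)) \<le> expectation (\<lambda>\<omega>. real (N \<omega>))" .
  qed simp
  define xi where "xi k \<omega> = Z (real (Suc k) * h) \<omega> - Z (real k * h) \<omega>" for k \<omega>
  have Zh: "integrable M (Z h)" using h by (intro integrable_Z) simp
  have step: "real (Suc k) * h - real k * h = h" for k by (simp add: algebra_simps)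
  have le: "0 \<le> real k * h" "real k * h \<le> real (Suc k) * h" for k
    using h by (auto simp: algebra_simps)
  have xi: "integrable M (xi k)" "expectation (xi k) = expectation (Z h)" for k
    unfolding xi_def using integral_increment[OF le[of k]] Zh unfolding step by auto
  have [measurable]: "xi k \<in> borel_measurable M" for k using xi(1) by auto
  have part: "(\<integral>\<^sup>+\<omega>. indicator (E k) \<omega> * g (xi k \<omega>) \<partial>M) = ennreal (prob (E k)) * (\<integral>\<^sup>+\<omega>. g (Z h \<omega>) \<partial>M)"
    if "g \<in> borel_measurable borel" for g :: "real \<Rightarrow> ennreal" and k
    using nn_integral_mult_increment[OF le[of k], of "indicator (E k)" g] E[of k] that
    unfolding step xi_def by (simp add: emeasure_eq_measure)
  have Ik: "integrable M (\<lambda>\<omega>. indicat_real (E k) \<omega> * xi k \<omega>)" for k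
    by (rule Bochner_Integration.integrable_bound[OF xi(1)[of k]]) (auto simp: indicator_def)
  have absk: "expectation (\<lambda>\<omega>. norm (indicat_real (E k) \<omega> * xi k \<omega>)) = prob (E k) * expectation (\<lambda>\<omega>. \<bar>Z h \<omega>\<bar>)" for k
  proof -
    have "ennreal (expectation (\<lambda>\<omega>. norm (indicat_real (E k) \<omega> * xi k \<omega>))) =
      (\<integral>\<^sup>+\<omega>. ennreal (norm (indicat_real (E k) \<omega> * xi k \<omega>)) \<partial>M)"
      using Ik by (intro nn_integral_eq_integral[symmetric]) auto
    also have "\<dots> = (\<integral>\<^sup>+\<omega>. indicator (E k) \<omega> * ennreal \<bar>xi k \<omega>\<bar> \<partial>M)"
      by (intro nn_integral_cong) (auto simp: indicator_def)
    also have "\<dots> = ennreal (prob (E k)) * (\<integral>\<^sup>+\<omega>. ennreal \<bar>Z h \<omega>\<bar> \<partial>M)"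
      by (rule part) simp
    also have "(\<integral>\<^sup>+\<omega>. ennreal \<bar>Z h \<omega>\<bar> \<partial>M) = ennreal (expectation (\<lambda>\<omega>. \<bar>Z h \<omega>\<bar>))"
      using Zh by (intro nn_integral_eq_integral) auto
    finally show ?thesis by (simp flip: ennreal_mult)
  qed
  \<comment> \<open>The product rule is available for nonnegative integrals, so it is applied to the
    positive and the negative part of the increment separately.\<close>
  have exk: "expectation (\<lambda>\<omega>. indicat_real (E k) \<omega> * xi k \<omega>) = expectation (\<lambda>\<omega>. indicat_real (E k) \<omega> * expectation (Z h))" for k
  proof -
    have "expectation (\<lambda>\<omega>. indicat_real (E k) \<omega> * xi k \<omega>) =
      enn2real (\<integral>\<^sup>+\<omega>. ennreal (indicat_real (E k) \<omega> * xi k \<omega>) \<partial>M) - enn2real (\<integral>\<^sup>+\<omega>. ennreal (- (indicat_real (E k) \<omega> * xi k \<omega>)) \<partial>M)"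
      by (rule real_lebesgue_integral_def[OF Ik])
    also have "(\<integral>\<^sup>+\<omega>. ennreal (indicat_real (E k) \<omega> * xi k \<omega>) \<partial>M) = (\<integral>\<^sup>+\<omega>. indicator (E k) \<omega> * ennreal (xi k \<omega>) \<partial>M)"
      by (intro nn_integral_cong) (auto simp: indicator_def)
    also have "\<dots> = ennreal (prob (E k)) * (\<integral>\<^sup>+\<omega>. ennreal (Z h \<omega>) \<partial>M)"
      by (rule part) simp
    also have "(\<integral>\<^sup>+\<omega>. ennreal (- (indicat_real (E k) \<omega> * xi k \<omega>)) \<partial>M) = (\<integral>\<^sup>+\<omega>. indicator (E k) \<omega> * ennreal (- xi k \<omega>) \<partial>M)"
      by (intro nn_integral_cong) (auto simp: indicator_def)
    also have "\<dots> = ennreal (prob (E k)) * (\<integral>\<^sup>+\<omega>. ennreal (- Z h \<omega>) \<partial>M)"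
      by (rule part) simp
    also have "enn2real (ennreal (prob (E k)) * (\<integral>\<^sup>+\<omega>. ennreal (Z h \<omega>) \<partial>M)) - enn2real (ennreal (prob (E k)) * (\<integral>\<^sup>+\<omega>. ennreal (- Z h \<omega>) \<partial>M)) = prob (E k) * expectation (Z h)"
      by (simp add: real_lebesgue_integral_def[OF Zh] enn2real_mult algebra_simps)
    finally show ?thesis by simp
  qed
  have abs_summable: "summable (\<lambda>k. expectation (\<lambda>\<omega>. norm (indicat_real (E k) \<omega> * xi k \<omega>)))"
    unfolding absk by (intro summable_mult2 summable_prob)
  have abs_summable': "summable (\<lambda>k. expectation (\<lambda>\<omega>. norm (indicat_real (E k) \<omega> * expectation (Z h))))"
    using summable_mult2[OF summable_prob, of "\<bar>expectation (Z h)\<bar>"] by (simp add: abs_mult)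
  have fin: "(\<Sum>k. indicat_real (E k) \<omega> * f k) = (\<Sum>k<N \<omega>. f k)" "summable (\<lambda>k. norm (indicat_real (E k) \<omega> * f k))"
    if "\<omega> \<in> space M" for \<omega> and f :: "nat \<Rightarrow> real"
  proof -
    have 0: "indicat_real (E k) \<omega> * f k = 0" if "k \<notin> {..<N \<omega>}" for k
      using N[OF \<open>\<omega> \<in> space M\<close>, of k] that by (auto simp: E_def indicator_def)
    have 1: "indicat_real (E k) \<omega> * f k = f k" if "k \<in> {..<N \<omega>}" for k
      using N[OF \<open>\<omega> \<in> space M\<close>, of k] that \<open>\<omega> \<in> space M\<close> by (auto simp: E_def indicator_def)
    have "(\<Sum>k. indicat_real (E k) \<omega> * f k) = (\<Sum>k<N \<omega>. indicat_real (E k) \<omega> * f k)"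
      by (rule suminf_finite) (use 0 in auto)
    also have "\<dots> = (\<Sum>k<N \<omega>. f k)" by (intro sum.cong refl 1)
    finally show "(\<Sum>k. indicat_real (E k) \<omega> * f k) = (\<Sum>k<N \<omega>. f k)" .
    show "summable (\<lambda>k. norm (indicat_real (E k) \<omega> * f k))"
      by (rule summable_finite[of "{..<N \<omega>}"]) (use 0 in auto)
  qed
  \<comment> \<open>\<open>Z 0\<close> remains in the telescoping sum because it vanishes only
    almost surely.\<close>
  have S: "(\<Sum>k. indicat_real (E k) \<omega> * xi k \<omega>) = Z (dyadic_above n (T \<omega>)) \<omega> - Z 0 \<omega>" if "\<omega> \<in> space M" for \<omega>
  proof -
    have "(\<Sum>k<m. xi k \<omega>) = Z (real m * h) \<omega> - Z 0 \<omega>" for m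
      by (induction m) (simp_all add: xi_def)
    then show ?thesis using fin(1)[OF that] by (simp add: d)
  qed
  have ae: "AE \<omega> in M. summable (\<lambda>k. norm (indicat_real (E k) \<omega> * xi k \<omega>))"
    "AE \<omega> in M. summable (\<lambda>k. norm (indicat_real (E k) \<omega> * expectation (Z h)))"
    using fin(2) by (auto intro!: AE_I2)
  have int1: "integrable M (\<lambda>\<omega>. \<Sum>k. indicat_real (E k) \<omega> * xi k \<omega>)"
    by (rule integrable_suminf[OF Ik ae(1) abs_summable])
  then have int2: "integrable M (\<lambda>\<omega>. Z (dyadic_above n (T \<omega>)) \<omega> - Z 0 \<omega>)"
    using S by (simp cong: Bochner_Integration.integrable_cong)
  have "integrable M (\<lambda>\<omega>. (Z (dyadic_above n (T \<omega>)) \<omega> - Z 0 \<omega>) + Z 0 \<omega>)"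
    by (intro Bochner_Integration.integrable_add int2 integrable_Z) simp
  then show int3: "integrable M (\<lambda>\<omega>. Z (dyadic_above n (T \<omega>)) \<omega>)" by simp
  have "expectation (\<lambda>\<omega>. Z (dyadic_above n (T \<omega>)) \<omega>) = expectation (\<lambda>\<omega>. \<Sum>k. indicat_real (E k) \<omega> * xi k \<omega>)"
    by (rule integral_cong_AE) (use int1 int3 AE_start in \<open>auto simp: S elim!: AE_mp intro!: AE_I2\<close>)
  also have "\<dots> = (\<Sum>k. expectation (\<lambda>\<omega>. indicat_real (E k) \<omega> * xi k \<omega>))"
    by (rule integral_suminf[OF Ik ae(1) abs_summable])
  also have "\<dots> = (\<Sum>k. expectation (\<lambda>\<omega>. indicat_real (E k) \<omega> * expectation (Z h)))"
    by (simp only: exk)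
  also have "\<dots> = expectation (\<lambda>\<omega>. \<Sum>k. indicat_real (E k) \<omega> * expectation (Z h))"
    by (rule integral_suminf[OF _ ae(2) abs_summable', symmetric]) (simp add: less_top[symmetric])
  also have "\<dots> = expectation (\<lambda>\<omega>. real (N \<omega>) * expectation (Z h))"
    by (intro Bochner_Integration.integral_cong refl) (simp add: fin(1))
  also have "\<dots> = expectation (Z 1) * expectation (\<lambda>\<omega>. dyadic_above n (T \<omega>))"
    unfolding d using expectation_dyadic[of n] by (simp add: h_def)
  finally show "expectation (\<lambda>\<omega>. Z (dyadic_above n (T \<omega>)) \<omega>) = expectation (Z 1) * expectation (\<lambda>\<omega>. dyadic_above n (T \<omega>))" .
qed

text \<open>On a cell \<open>E k\<close> of the finer grid both dyadic points are constants. The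
  finer one, \<open>(k + 1) h\<close>, is a time at which \<open>E k\<close> is already known, so
  the increment from there to the coarser point is independent of \<open>E k\<close>, and its length
  is at most \<open>1 / 2 ^ n\<close>. The bound does not depend on \<open>m\<close>.\<close>

lemma dyadic_distance:
  assumes st: "stopping_time F T" and nonneg: "\<And>\<omega>. \<omega> \<in> space M \<Longrightarrow> 0 \<le> T \<omega>"
    and nm: "n \<le> m" and c: "\<And>s. 0 \<le> s \<Longrightarrow> s \<le> 1 / 2 ^ n \<Longrightarrow> (\<integral>\<^sup>+\<omega>. ennreal \<bar>Z s \<omega>\<bar> \<partial>M) \<le> c"
  shows "(\<integral>\<^sup>+\<omega>. ennreal \<bar>Z (dyadic_above n (T \<omega>)) \<omega> - Z (dyadic_above m (T \<omega>)) \<omega>\<bar> \<partial>M) \<le> c"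
proof -
  define h :: real where "h = 1 / 2 ^ m"
  have h: "0 < h" by (simp add: h_def)
  have "sets (F t) \<subseteq> sets M" "space (F t) = space M" for t using subalgebra space_F by auto
  then have [measurable]: "T \<in> borel_measurable M" using measurable_stopping_time[OF st] by blast
  define E where "E k = {\<omega> \<in> space M. real k * h \<le> T \<omega> \<and> T \<omega> < real (Suc k) * h}" for k
  have E: "E k \<in> sets (F (real (Suc k) * h))" for k
    unfolding E_def using sets_stopping_interval(2)[OF st nonneg] .
  then have [measurable]: "E k \<in> events" for k using subalgebra by blast
  have disj: "disjoint_family E"
    unfolding disjoint_family_on_def
  proof (intro ballI impI)
    fix j k :: nat assume "j \<noteq> k"
    have False if "\<omega> \<in> E j" "\<omega> \<in> E k" "j < k" for \<omega> j k
    proof -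
      have "real (Suc j) * h \<le> real k * h" using \<open>j < k\<close> h by (intro mult_right_mono) auto
      then show False using that by (auto simp: E_def)
    qed
    then show "E j \<inter> E k = {}" using \<open>j \<noteq> k\<close> by (metis disjoint_iff linorder_neqE_nat)
  qed
  have cover: "(\<Union>k. E k) = space M"
  proof
    show "space M \<subseteq> (\<Union>k. E k)"
    proof
      fix \<omega> assume \<omega>: "\<omega> \<in> space M"
      have "real (nat \<lfloor>2 ^ m * T \<omega>\<rfloor>) \<le> 2 ^ m * T \<omega>" "2 ^ m * T \<omega> < real (nat \<lfloor>2 ^ m * T \<omega>\<rfloor>) + 1"
        using nonneg[OF \<omega>] by (simp, linarith)
      then have "\<omega> \<in> E (nat \<lfloor>2 ^ m * T \<omega>\<rfloor>)" using \<omega> by (simp add: E_def h_def field_simps)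
      then show "\<omega> \<in> (\<Union>k. E k)" by blast
    qed
  qed (auto simp: E_def)
  define r where "r k = dyadic_above n (real k * h)" for k
  have on_E: "dyadic_above m (T \<omega>) = real (Suc k) * h" "dyadic_above n (T \<omega>) = r k"
    "real (Suc k) * h \<le> r k" "r k - real (Suc k) * h \<le> 1 / 2 ^ n" if "\<omega> \<in> E k" for \<omega> k
  proof -
    have T: "0 \<le> real k * h" "real k * h \<le> T \<omega>" "T \<omega> < real (Suc k) * h" and T0: "0 \<le> T \<omega>"
      using that h nonneg by (auto simp: E_def)
    have "real k \<le> 2 ^ m * T \<omega>" "2 ^ m * T \<omega> < real k + 1"
      using T by (auto simp: h_def field_simps)
    then have "\<lfloor>2 ^ m * T \<omega>\<rfloor> = int k" by (intro floor_unique) auto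
    then show *: "dyadic_above m (T \<omega>) = real (Suc k) * h"
      by (simp add: dyadic_above_def h_def)
    have "\<lfloor>2 ^ m * (real k * h)\<rfloor> = int k" by (simp add: h_def)
    then have "dyadic_above m (real k * h) = real (Suc k) * h"
      by (simp add: dyadic_above_def h_def)
    then show ge: "real (Suc k) * h \<le> r k"
      using dyadic_above_antimono[OF T(1) nm] by (simp add: r_def)
    show "r k - real (Suc k) * h \<le> 1 / 2 ^ n"
      using dyadic_above_bounds(2)[OF T(1), of n] h by (simp add: r_def algebra_simps)
    have "T \<omega> < r k" using ge T by linarith
    then have "dyadic_above n (T \<omega>) \<le> r k"
      using dyadic_above_le[OF T0, of "Suc (nat \<lfloor>2 ^ n * (real k * h)\<rfloor>)" n]
      by (simp add: r_def dyadic_above_def add.commute)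
    moreover have "r k \<le> dyadic_above n (T \<omega>)"
      unfolding r_def by (rule dyadic_above_mono[OF T(2)])
    ultimately show "dyadic_above n (T \<omega>) = r k" by simp
  qed
  let ?f = "\<lambda>\<omega>. ennreal \<bar>Z (dyadic_above n (T \<omega>)) \<omega> - Z (dyadic_above m (T \<omega>)) \<omega>\<bar>"
  have [measurable]: "(\<lambda>\<omega>. Z (dyadic_above n (T \<omega>)) \<omega>) \<in> borel_measurable M" for n
    by (rule measurable_dyadic_above) (auto intro: measurable_M)
  have part: "(\<integral>\<^sup>+\<omega>. ?f \<omega> * indicator (E k) \<omega> \<partial>M) \<le> c * emeasure M (E k)" for k
  proof (cases "E k = {}")
    case True
    then show ?thesis by simp
  next
    case False
    then have rk: "real (Suc k) * h \<le> r k" "r k - real (Suc k) * h \<le> 1 / 2 ^ n"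
      using on_E(3,4) by auto
    have "(\<integral>\<^sup>+\<omega>. ?f \<omega> * indicator (E k) \<omega> \<partial>M) = (\<integral>\<^sup>+\<omega>. indicator (E k) \<omega> * ennreal \<bar>Z (r k) \<omega> - Z (real (Suc k) * h) \<omega>\<bar> \<partial>M)"
      using on_E(1,2) by (intro nn_integral_cong) (auto simp: indicator_def)
    also have "\<dots> = (\<integral>\<^sup>+\<omega>. indicator (E k) \<omega> \<partial>M) * (\<integral>\<^sup>+\<omega>. ennreal \<bar>Z (r k - real (Suc k) * h) \<omega>\<bar> \<partial>M)"
      using rk h E[of k] by (intro nn_integral_mult_increment) auto
    also have "\<dots> \<le> emeasure M (E k) * c"
      using rk by (intro mult_mono c) auto
    finally show ?thesis by (simp add: mult.commute)
  qed
  have "(\<integral>\<^sup>+\<omega>. ?f \<omega> \<partial>M) = (\<integral>\<^sup>+\<omega>. ?f \<omega> * indicator (\<Union>k. E k) \<omega> \<partial>M)"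
    unfolding cover by (intro nn_integral_cong) auto
  also have "\<dots> = (\<Sum>k. \<integral>\<^sup>+\<omega>. ?f \<omega> * indicator (E k) \<omega> \<partial>M)"
    by (rule nn_integral_disjoint_family) (use disj in auto)
  also have "\<dots> \<le> (\<Sum>k. c * emeasure M (E k))"
    by (intro suminf_le part) auto
  also have "\<dots> = c * emeasure M (\<Union>k. E k)"
    using disj by (subst suminf_emeasure[symmetric]) auto
  also have "\<dots> = c" by (simp add: cover emeasure_space_1)
  finally show ?thesis .
qed

text \<open>Pathwise convergence along dyadic times would not carry the means to the limit. Fatou in
  the finer level turns \<open>dyadic_distance\<close> into a bound on the distance in mean between
  the level-\<open>n\<close> value and the value at \<open>T\<close>, and
  \<open>mean_continuous_at_0\<close> makes that bound small.\<close>

theorem wald: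
  assumes st: "stopping_time F T" and nonneg: "\<And>\<omega>. \<omega> \<in> space M \<Longrightarrow> 0 \<le> T \<omega>"
    and int: "integrable M T"
    and right_cont: "AE \<omega> in M. \<forall>t\<ge>0. ((\<lambda>t. Z t \<omega>) \<longlongrightarrow> Z t \<omega>) (at_right t)"
  shows "integrable M (\<lambda>\<omega>. Z (T \<omega>) \<omega>)" "expectation (\<lambda>\<omega>. Z (T \<omega>) \<omega>) = expectation (Z 1) * expectation T"
proof -
  have [measurable]: "T \<in> borel_measurable M" using int by auto
  have dm [measurable]: "(\<lambda>\<omega>. Z (dyadic_above n (T \<omega>)) \<omega>) \<in> borel_measurable M" for n
    by (rule measurable_dyadic_above) (auto intro: measurable_M)
  have lim: "AE \<omega> in M. (\<lambda>n. Z (dyadic_above n (T \<omega>)) \<omega>) \<longlonglongrightarrow> Z (T \<omega>) \<omega>"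
    using right_cont
  proof (rule AE_mp, intro AE_I2 impI)
    fix \<omega> assume \<omega>: "\<omega> \<in> space M" and "\<forall>t\<ge>0. ((\<lambda>t. Z t \<omega>) \<longlongrightarrow> Z t \<omega>) (at_right t)"
    then have "((\<lambda>t. Z t \<omega>) \<longlongrightarrow> Z (T \<omega>) \<omega>) (at_right (T \<omega>))" using nonneg by blast
    then show "(\<lambda>n. Z (dyadic_above n (T \<omega>)) \<omega>) \<longlonglongrightarrow> Z (T \<omega>) \<omega>"
      by (rule filterlim_compose[OF _ dyadic_above_filterlim[OF nonneg[OF \<omega>]]])
  qed
  have [measurable]: "(\<lambda>\<omega>. Z (T \<omega>) \<omega>) \<in> borel_measurable M"
  proof (rule borel_measurable_AE_eq)
    show "(\<lambda>\<omega>. lim (\<lambda>n. Z (dyadic_above n (T \<omega>)) \<omega>)) \<in> borel_measurable M" by measurable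
    show "AE \<omega> in M. Z (T \<omega>) \<omega> = lim (\<lambda>n. Z (dyadic_above n (T \<omega>)) \<omega>)"
      using lim by eventually_elim (simp add: limI)
  qed
  let ?D = "\<lambda>n \<omega>. Z (dyadic_above n (T \<omega>)) \<omega> - Z (T \<omega>) \<omega>"
  have dist: "(\<integral>\<^sup>+\<omega>. ennreal \<bar>?D n \<omega>\<bar> \<partial>M) \<le> c"
    if c: "\<And>s. 0 \<le> s \<Longrightarrow> s \<le> 1 / 2 ^ n \<Longrightarrow> (\<integral>\<^sup>+\<omega>. ennreal \<bar>Z s \<omega>\<bar> \<partial>M) \<le> c" for n c
  proof -
    let ?f = "\<lambda>m \<omega>. ennreal \<bar>Z (dyadic_above n (T \<omega>)) \<omega> - Z (dyadic_above m (T \<omega>)) \<omega>\<bar>"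
    have "(\<integral>\<^sup>+\<omega>. ennreal \<bar>?D n \<omega>\<bar> \<partial>M) = (\<integral>\<^sup>+\<omega>. liminf (\<lambda>m. ?f m \<omega>) \<partial>M)"
    proof (rule nn_integral_cong_AE)
      show "AE \<omega> in M. ennreal \<bar>?D n \<omega>\<bar> = liminf (\<lambda>m. ?f m \<omega>)"
        using lim
      proof eventually_elim
        case (elim \<omega>)
        have "(\<lambda>m. ?f m \<omega>) \<longlonglongrightarrow> ennreal \<bar>?D n \<omega>\<bar>"
          by (intro tendsto_intros elim)
        then show ?case by (intro lim_imp_Liminf[symmetric]) auto
      qed
    qed
    also have "\<dots> \<le> liminf (\<lambda>m. \<integral>\<^sup>+\<omega>. ?f m \<omega> \<partial>M)"
      by (rule nn_integral_liminf) measurable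
    also have "\<dots> \<le> liminf (\<lambda>m. c)"
      by (rule Liminf_mono) (use dyadic_distance[OF st nonneg _ c] in \<open>auto simp: eventually_sequentially\<close>)
    also have "\<dots> = c" by (simp add: Liminf_const)
    finally show ?thesis .
  qed
  have small: "\<exists>N. \<forall>n\<ge>N. (\<integral>\<^sup>+\<omega>. ennreal \<bar>?D n \<omega>\<bar> \<partial>M) \<le> ennreal e" if e: "0 < e" for e
  proof -
    obtain d where d: "0 < d" "\<And>s. 0 \<le> s \<Longrightarrow> s \<le> d \<Longrightarrow> (\<integral>\<^sup>+\<omega>. ennreal \<bar>Z s \<omega>\<bar> \<partial>M) \<le> ennreal e"
      using mean_continuous_at_0[OF e] by metis
    have "(\<lambda>n. 1 / 2 ^ n :: real) \<longlonglongrightarrow> 0" by real_asymp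
    from order_tendstoD(2)[OF this d(1)] obtain N where "\<forall>n\<ge>N. 1 / 2 ^ n < d"
      by (auto simp: eventually_sequentially)
    then show ?thesis using d(2) by (intro exI[of _ N] allI impI dist) force
  qed
  have Dint: "\<exists>N. \<forall>n\<ge>N. integrable M (?D n) \<and> \<bar>expectation (?D n)\<bar> \<le> e" if e: "0 < e" for e
  proof -
    obtain N where N: "\<And>n. n \<ge> N \<Longrightarrow> (\<integral>\<^sup>+\<omega>. ennreal \<bar>?D n \<omega>\<bar> \<partial>M) \<le> ennreal e"
      using small[OF e] by blast
    have "integrable M (?D n) \<and> \<bar>expectation (?D n)\<bar> \<le> e" if n: "n \<ge> N" for n
    proof
      have "(\<integral>\<^sup>+\<omega>. ennreal (norm (?D n \<omega>)) \<partial>M) < \<infinity>"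
        using order_le_less_trans[OF N[OF n] ennreal_less_top] by simp
      then show i: "integrable M (?D n)" by (intro integrableI_bounded) measurable
      have "ennreal \<bar>expectation (?D n)\<bar> \<le> (\<integral>\<^sup>+\<omega>. ennreal \<bar>?D n \<omega>\<bar> \<partial>M)"
        using integral_norm_bound_ennreal[OF i] by simp
      also have "\<dots> \<le> ennreal e" by (rule N[OF n])
      finally show "\<bar>expectation (?D n)\<bar> \<le> e" using e by simp
    qed
    then show ?thesis by blast
  qed
  obtain n0 where n0: "integrable M (?D n0)" using Dint[of 1] by auto
  have wd: "integrable M (\<lambda>\<omega>. Z (dyadic_above n (T \<omega>)) \<omega>)"
    "expectation (\<lambda>\<omega>. Z (dyadic_above n (T \<omega>)) \<omega>) = expectation (Z 1) * expectation (\<lambda>\<omega>. dyadic_above n (T \<omega>))" for n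
    using wald_dyadic[OF st nonneg int] by auto
  have "integrable M (\<lambda>\<omega>. Z (dyadic_above n0 (T \<omega>)) \<omega> - ?D n0 \<omega>)"
    by (rule Bochner_Integration.integrable_diff[OF wd(1) n0])
  then show intT: "integrable M (\<lambda>\<omega>. Z (T \<omega>) \<omega>)" by simp
  have "(\<lambda>n. expectation (?D n)) \<longlonglongrightarrow> 0"
  proof (rule LIMSEQ_I)
    fix e :: real assume "0 < e"
    then show "\<exists>N. \<forall>n\<ge>N. norm (expectation (?D n) - 0) < e"
      using Dint[of "e / 2"] by force
  qed
  moreover have "expectation (?D n) = expectation (Z 1) * expectation (\<lambda>\<omega>. dyadic_above n (T \<omega>)) - expectation (\<lambda>\<omega>. Z (T \<omega>) \<omega>)" for n
    using wd intT by simp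
  moreover have "(\<lambda>n. expectation (\<lambda>\<omega>. dyadic_above n (T \<omega>))) \<longlonglongrightarrow> expectation T"
  proof (rule integral_dominated_convergence[where w="\<lambda>\<omega>. T \<omega> + 1"])
    show "AE \<omega> in M. (\<lambda>n. dyadic_above n (T \<omega>)) \<longlonglongrightarrow> T \<omega>"
      using nonneg by (intro AE_I2 dyadic_above_tendsto)
    fix n
    show "AE \<omega> in M. norm (dyadic_above n (T \<omega>)) \<le> T \<omega> + 1"
    proof (rule AE_I2)
      fix \<omega> assume "\<omega> \<in> space M"
      have "dyadic_above n (T \<omega>) \<le> T \<omega> + 1 / 2 ^ n"
        by (rule dyadic_above_bounds(2)[OF nonneg[OF \<open>\<omega> \<in> space M\<close>]])
      also have "\<dots> \<le> T \<omega> + 1" by simp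
      finally show "norm (dyadic_above n (T \<omega>)) \<le> T \<omega> + 1"
        using dyadic_above_nonneg[of n "T \<omega>"] by simp
    qed
    show "(\<lambda>\<omega>. dyadic_above n (T \<omega>)) \<in> borel_measurable M" unfolding dyadic_above_def by measurable
  qed (use int in auto)
  then have "(\<lambda>n. expectation (Z 1) * expectation (\<lambda>\<omega>. dyadic_above n (T \<omega>)) - expectation (\<lambda>\<omega>. Z (T \<omega>) \<omega>))
    \<longlonglongrightarrow> expectation (Z 1) * expectation T - expectation (\<lambda>\<omega>. Z (T \<omega>) \<omega>)"
    by (intro tendsto_intros)
  ultimately have "expectation (Z 1) * expectation T - expectation (\<lambda>\<omega>. Z (T \<omega>) \<omega>) = 0"
    by (auto dest: LIMSEQ_unique)
  then show "expectation (\<lambda>\<omega>. Z (T \<omega>) \<omega>) = expectation (Z 1) * expectation T" by simp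
qed

end

section \<open>Subordinators at independent random times\<close>

lemma space_natural_filtration: "space (natural_filtration M X t) = space M"
proof -
  have "generated_events M {0..t} X \<subseteq> Pow (space M)"
    unfolding generated_events_def
    by (rule subsetI, rule PowI, rule sigma_sets_into_sp[rotated], assumption) auto
  then show ?thesis unfolding natural_filtration_def by (rule space_measure_of)
qed

text \<open>Cauchy's functional equation: nonnegativity makes \<open>f\<close> monotone, and
  comparison with the fractions \<open>m / N\<close> and \<open>(m + 1) / N\<close> around
  \<open>t\<close> leaves an error of at most \<open>f 1 / N\<close>.\<close>

lemma additive_nonneg_linear:
  fixes f :: "real \<Rightarrow> real"
  assumes add: "\<And>s t. 0 \<le> s \<Longrightarrow> 0 \<le> t \<Longrightarrow> f (s + t) = f s + f t"
    and nonneg: "\<And>t. 0 \<le> t \<Longrightarrow> 0 \<le> f t"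
    and t: "0 \<le> t"
  shows "f t = t * f 1"
proof -
  have mono: "f s \<le> f t" if "0 \<le> s" "s \<le> t" for s t
    using add[of s "t - s"] nonneg[of "t - s"] that by simp
  have mult: "f (real n * s) = real n * f s" if "0 \<le> s" for n s
  proof (induction n)
    case 0
    show ?case using add[of 0 0] by simp
  next
    case (Suc n)
    then show ?case using add[of "real n * s" s] that by (simp add: algebra_simps)
  qed
  have near: "\<bar>f t - t * f 1\<bar> \<le> f 1 / real (Suc n)" for n
  proof -
    let ?N = "real (Suc n)"
    define m where "m = nat \<lfloor>?N * t\<rfloor>"
    have m: "real m \<le> ?N * t" "?N * t \<le> real (Suc m)"
      using t by (simp_all add: m_def) linarith+
    have f1: "f (real k) = real k * f 1" for k using mult[of 1 k] by simp
    have "f (real m) \<le> f (?N * t)" "f (?N * t) \<le> f (real (Suc m))"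
      using m t by (auto intro!: mono)
    then have "real m * f 1 \<le> ?N * f t" "?N * f t \<le> real (Suc m) * f 1"
      using f1[of m] f1[of "Suc m"] mult[OF t, of "Suc n"] by auto
    moreover have "real m * f 1 \<le> ?N * t * f 1" "?N * t * f 1 \<le> real (Suc m) * f 1"
      using m nonneg[of 1] by (auto intro!: mult_right_mono)
    ultimately have "\<bar>?N * f t - ?N * t * f 1\<bar> \<le> f 1"
      by (simp add: algebra_simps abs_le_iff)
    also have "?N * f t - ?N * t * f 1 = ?N * (f t - t * f 1)" by (simp add: algebra_simps)
    finally have "?N * \<bar>f t - t * f 1\<bar> \<le> f 1" by (simp add: abs_mult)
    then show ?thesis by (simp add: field_simps)
  qed
  have "(\<lambda>n. f 1 / real (Suc n)) \<longlonglongrightarrow> 0"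
    by real_asymp
  then have "\<bar>f t - t * f 1\<bar> \<le> 0"
    by (rule LIMSEQ_le_const) (use near in blast)
  then show ?thesis by simp
qed

lemma inner_nonneg_vec:
  fixes u x :: "real ^ 'n"
  assumes "0 \<le> u" "0 \<le> x"
  shows "0 \<le> u \<bullet> x"
  using assms by (auto simp: inner_vec_def less_eq_vec_def intro!: sum_nonneg)

lemma inner_mono_vec:
  fixes u x :: "real ^ 'n"
  assumes "0 \<le> u" "x \<le> y"
  shows "u \<bullet> x \<le> u \<bullet> y"
  using assms by (auto simp: inner_vec_def less_eq_vec_def intro!: sum_mono mult_left_mono)

context prob_space begin

lemma integrable_exp_neg:
  fixes Y :: "'a \<Rightarrow> real"
  assumes [measurable]: "Y \<in> borel_measurable M" and "AE \<omega> in M. 0 \<le> Y \<omega>"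
  shows "integrable M (\<lambda>\<omega>. exp (- Y \<omega>))"
proof (rule integrable_const_bound[where B=1])
  show "AE \<omega> in M. norm (exp (- Y \<omega>)) \<le> 1" using assms(2) by eventually_elim simp
qed measurable

lemma nn_integral_exp_neg:
  fixes Y :: "'a \<Rightarrow> real"
  assumes "Y \<in> borel_measurable M" "AE \<omega> in M. 0 \<le> Y \<omega>"
  shows "(\<integral>\<^sup>+\<omega>. ennreal (exp (- Y \<omega>)) \<partial>M) = ennreal (expectation (\<lambda>\<omega>. exp (- Y \<omega>)))"
  by (rule nn_integral_eq_integral[OF integrable_exp_neg[OF assms]]) simp

lemma expectation_exp_neg_le_1:
  fixes Y :: "'a \<Rightarrow> real"
  assumes "Y \<in> borel_measurable M" "AE \<omega> in M. 0 \<le> Y \<omega>"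
  shows "expectation (\<lambda>\<omega>. exp (- Y \<omega>)) \<le> 1"
proof (rule integral_le_const[OF integrable_exp_neg[OF assms]])
  show "AE \<omega> in M. exp (- Y \<omega>) \<le> 1" using assms(2) by eventually_elim simp
qed

end

section \<open>Laplace transforms of subordinators\<close>

locale subordinator_process = prob_space M for M :: "'a measure" +
  fixes X :: "real \<Rightarrow> 'a \<Rightarrow> real ^ 'n"
  assumes subordinator: "subordinator M X"
begin

lemma levy: "levy_process_wrt M (natural_filtration M X) X"
  using subordinator by (simp add: subordinator_def levy_process_def)

lemma measurable_X [measurable (raw)]: "0 \<le> t \<Longrightarrow> X t \<in> borel_measurable M"
  using levy by (simp add: levy_process_wrt_def)

lemma AE_start: "AE \<omega> in M. X 0 \<omega> = 0"
  using levy by (simp add: levy_process_wrt_def)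

lemma AE_mono: "AE \<omega> in M. \<forall>s t. 0 \<le> s \<and> s \<le> t \<longrightarrow> X s \<omega> \<le> X t \<omega>"
  using subordinator by (simp add: subordinator_def)

lemma AE_nonneg: "AE \<omega> in M. \<forall>t\<ge>0. 0 \<le> X t \<omega>"
  using AE_start AE_mono by eventually_elim force

definition nn_laplace :: "real ^ 'n \<Rightarrow> real \<Rightarrow> ennreal" where
  "nn_laplace u t = (\<integral>\<^sup>+\<omega>. ennreal (exp (- (u \<bullet> X t \<omega>))) \<partial>M)"

lemma inner_X:
  assumes "0 \<le> u" "0 \<le> t"
  shows "(\<lambda>\<omega>. u \<bullet> X t \<omega>) \<in> borel_measurable M" "AE \<omega> in M. 0 \<le> u \<bullet> X t \<omega>"
proof -
  show "(\<lambda>\<omega>. u \<bullet> X t \<omega>) \<in> borel_measurable M" using assms(2) by measurable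
  show "AE \<omega> in M. 0 \<le> u \<bullet> X t \<omega>"
    using AE_nonneg by eventually_elim (use assms in \<open>auto intro!: inner_nonneg_vec\<close>)
qed

lemmas integrable_exp = integrable_exp_neg[OF inner_X]

lemma nn_laplace_eq:
  assumes "0 \<le> u" "0 \<le> t"
  shows "nn_laplace u t = ennreal (\<integral>\<omega>. exp (- (u \<bullet> X t \<omega>)) \<partial>M)"
  unfolding nn_laplace_def by (rule nn_integral_exp_neg[OF inner_X[OF assms]])

lemma laplace_add:
  assumes "0 \<le> u" "0 \<le> s" "0 \<le> t"
  shows "(\<integral>\<omega>. exp (- (u \<bullet> X (s + t) \<omega>)) \<partial>M) = (\<integral>\<omega>. exp (- (u \<bullet> X s \<omega>)) \<partial>M) * (\<integral>\<omega>. exp (- (u \<bullet> X t \<omega>)) \<partial>M)"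
proof -
  have "nn_laplace u (s + t) = (\<integral>\<^sup>+\<omega>. ennreal (exp (- (u \<bullet> X s \<omega>))) * ennreal (exp (- (u \<bullet> (X (s + t) \<omega> - X s \<omega>)))) \<partial>M)"
    unfolding nn_laplace_def
    by (intro nn_integral_cong) (simp add: inner_diff_right flip: ennreal_mult exp_add)
  also have "\<dots> = (\<integral>\<^sup>+\<omega>. ennreal (exp (- (u \<bullet> X s \<omega>))) \<partial>M) * (\<integral>\<^sup>+\<omega>. ennreal (exp (- (u \<bullet> (X (s + t - s) \<omega>)))) \<partial>M)"
  proof (rule levy_nn_integral_mult_increment[OF levy space_natural_filtration, where g="\<lambda>x. ennreal (exp (- (u \<bullet> x)))"])
    have "X s \<in> borel_measurable (natural_filtration M X s)"
      using levy assms by (simp add: levy_process_wrt_def)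
    then show "(\<lambda>\<omega>. ennreal (exp (- (u \<bullet> X s \<omega>)))) \<in> borel_measurable (natural_filtration M X s)"
      by measurable
  qed (use assms in auto)
  also have "\<dots> = nn_laplace u s * nn_laplace u t" by (simp add: nn_laplace_def)
  finally show ?thesis
    using assms by (simp add: nn_laplace_eq integral_nonneg flip: ennreal_mult)
qed

lemma laplace_bounds:
  assumes "0 \<le> u" "0 \<le> t"
  shows "0 < (\<integral>\<omega>. exp (- (u \<bullet> X t \<omega>)) \<partial>M)" "(\<integral>\<omega>. exp (- (u \<bullet> X t \<omega>)) \<partial>M) \<le> 1"
proof -
  have "(\<integral>\<omega>. exp (- (u \<bullet> X t \<omega>)) \<partial>M) \<noteq> 0"
    using integral_nonneg_eq_0_iff_AE[OF integrable_exp[OF assms assms]] by (auto simp: AE_False)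
  moreover have "0 \<le> (\<integral>\<omega>. exp (- (u \<bullet> X t \<omega>)) \<partial>M)" by simp
  ultimately show "0 < (\<integral>\<omega>. exp (- (u \<bullet> X t \<omega>)) \<partial>M)" by linarith
  show "(\<integral>\<omega>. exp (- (u \<bullet> X t \<omega>)) \<partial>M) \<le> 1"
    by (rule expectation_exp_neg_le_1[OF inner_X[OF assms]])
qed

text \<open>Independent stationary increments make \<open>- ln (L t)\<close> additive in
  \<open>t\<close>, and nonnegative values of the process make it nonnegative. It is therefore
  linear, which determines the definite description in \<open>laplace_exponent\<close>.\<close>

lemma laplace_exponent:
  assumes u: "0 \<le> u"
  shows "0 \<le> laplace_exponent M X u"
    and "0 \<le> t \<Longrightarrow> (\<integral>\<omega>. exp (- (u \<bullet> X t \<omega>)) \<partial>M) = exp (- (t * laplace_exponent M X u))"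
proof -
  define L where "L t = (\<integral>\<omega>. exp (- (u \<bullet> X t \<omega>)) \<partial>M)" for t
  define c where "c = - ln (L 1)"
  have L: "0 < L t" "L t \<le> 1" if "0 \<le> t" for t using laplace_bounds[OF u that] by (auto simp: L_def)
  have exp_c: "L t = exp (- (t * c))" if "0 \<le> t" for t
  proof -
    have "- ln (L t) = t * (- ln (L 1))"
    proof (rule additive_nonneg_linear[where f="\<lambda>t. - ln (L t)"])
      fix s t :: real assume "0 \<le> s" "0 \<le> t"
      then show "- ln (L (s + t)) = - ln (L s) + - ln (L t)"
        using laplace_add[OF u, of s t] L[of s] L[of t] by (simp add: L_def ln_mult)
    next
      fix t :: real assume "0 \<le> t"
      then show "0 \<le> - ln (L t)" using L[of t] by simp
    qed (rule that)
    then have "ln (L t) = - (t * c)" by (simp add: c_def)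
    then show ?thesis using L(1)[OF that] by (metis exp_ln)
  qed
  have "laplace_exponent M X u = c"
    unfolding laplace_exponent_def
  proof (rule the_equality)
    show "\<forall>t\<ge>0. (\<integral>\<omega>. exp (- (u \<bullet> X t \<omega>)) \<partial>M) = exp (- (t * c))"
      using exp_c by (simp add: L_def)
    fix c' assume "\<forall>t\<ge>0. (\<integral>\<omega>. exp (- (u \<bullet> X t \<omega>)) \<partial>M) = exp (- (t * c'))"
    then have "exp (- (1 * c')) = exp (- (1 * c))" using exp_c[of 1] unfolding L_def by (metis zero_le_one)
    then show "c' = c" by simp
  qed
  moreover have "0 \<le> c" using L[of 1] by (simp add: c_def)
  ultimately show "0 \<le> laplace_exponent M X u"
    "0 \<le> t \<Longrightarrow> (\<integral>\<omega>. exp (- (u \<bullet> X t \<omega>)) \<partial>M) = exp (- (t * laplace_exponent M X u))"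
    using exp_c[of t] by (auto simp: L_def)
qed

lemma expectation_linear:
  assumes int: "\<And>t. 0 \<le> t \<Longrightarrow> integrable M (\<lambda>\<omega>. u \<bullet> X t \<omega>)" and u: "0 \<le> u" and t: "0 \<le> t"
  shows "(\<integral>\<omega>. u \<bullet> X t \<omega> \<partial>M) = t * (\<integral>\<omega>. u \<bullet> X 1 \<omega> \<partial>M)"
proof (rule additive_nonneg_linear[where f="\<lambda>t. \<integral>\<omega>. u \<bullet> X t \<omega> \<partial>M"])
  fix s t :: real assume st: "0 \<le> s" "0 \<le> t"
  have m: "X r \<in> borel_measurable M" if "0 \<le> r" for r using that by (rule measurable_X)
  have "(\<integral>\<omega>. u \<bullet> (X (s + t) \<omega> - X s \<omega>) \<partial>M) = (\<integral>x. u \<bullet> x \<partial>distr M borel (\<lambda>\<omega>. X (s + t) \<omega> - X s \<omega>))"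
    using st by (intro integral_distr[symmetric] borel_measurable_diff m) auto
  also have "\<dots> = (\<integral>x. u \<bullet> x \<partial>distr M borel (X t))"
    using levy_process_wrt_distr_increment[OF levy, of s "s + t"] st by simp
  also have "\<dots> = (\<integral>\<omega>. u \<bullet> X t \<omega> \<partial>M)"
    using st by (intro integral_distr m) auto
  finally show "(\<integral>\<omega>. u \<bullet> X (s + t) \<omega> \<partial>M) = (\<integral>\<omega>. u \<bullet> X s \<omega> \<partial>M) + (\<integral>\<omega>. u \<bullet> X t \<omega> \<partial>M)"
    using int[of s] int[of "s + t"] st by (simp add: inner_diff_right)
next
  fix t :: real assume "0 \<le> t"
  then have "AE \<omega> in M. 0 \<le> u \<bullet> X t \<omega>" by (rule inner_X(2)[OF u])
  then show "0 \<le> (\<integral>\<omega>. u \<bullet> X t \<omega> \<partial>M)" by (rule integral_nonneg_AE)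
qed (rule t)

end

text \<open>A measurable substitute for the value at a random time: it involves the process at
  countably many times only, whereas subordinators need not have right-continuous paths
  here.\<close>

definition right_eval :: "(real \<Rightarrow> 'a \<Rightarrow> real ^ 'n) \<Rightarrow> real \<Rightarrow> 'a \<Rightarrow> real ^ 'n" where
  "right_eval X t \<omega> = lim (\<lambda>k. X (dyadic_above k t) \<omega>)"

lemma measurable_right_eval:
  assumes "\<And>t. 0 \<le> t \<Longrightarrow> X t \<in> borel_measurable N" and "T \<in> borel_measurable N"
  shows "(\<lambda>\<omega>. right_eval X (T \<omega>) \<omega>) \<in> borel_measurable N"
proof -
  have [measurable]: "(\<lambda>\<omega>. X (dyadic_above k (T \<omega>)) \<omega>) \<in> borel_measurable N" for k
    by (rule measurable_dyadic_above) (use assms in auto)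
  show ?thesis unfolding right_eval_def by measurable
qed

lemma measurable_right_eval_pair:
  assumes X: "\<And>t. 0 \<le> t \<Longrightarrow> X t \<in> borel_measurable N2" and T: "T \<in> borel_measurable N1"
  shows "(\<lambda>p. right_eval X (T (fst p)) (snd p)) \<in> borel_measurable (N1 \<Otimes>\<^sub>M N2)"
proof -
  note [measurable] = X T
  have "(\<lambda>p. right_eval (\<lambda>t p. X t (snd p)) (T (fst p)) p) \<in> borel_measurable (N1 \<Otimes>\<^sub>M N2)"
    by (rule measurable_right_eval) measurable
  then show ?thesis by (simp add: right_eval_def)
qed

section \<open>Evaluation at independent random times\<close>

context subordinator_process begin

text \<open>\<open>1\<close> is the all-ones vector, so the inner product sums the coordinates. A
  subordinator may have infinite mean; truncation at 1 lets convergence in probability pass to the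
  mean.\<close>

lemma small_increment:
  "(\<lambda>k. \<integral>\<^sup>+\<omega>. ennreal (min 1 (1 \<bullet> X (1 / 2 ^ k) \<omega>)) \<partial>M) \<longlonglongrightarrow> 0"
proof (rule order_tendstoI)
  fix e :: ennreal assume "0 < e"
  then obtain d :: real where d: "0 < d" "ennreal (2 * d) < e"
  proof -
    assume *: "\<And>d. 0 < d \<Longrightarrow> ennreal (2 * d) < e \<Longrightarrow> thesis"
    obtain r where r: "0 < r" "ennreal r < e"
    proof -
      obtain x where x: "0 < x" "x < e" using dense[OF \<open>0 < e\<close>] by blast
      then obtain r where "0 \<le> r" "x = ennreal r" by (cases x) auto
      with x that show thesis by (auto simp: ennreal_less_zero_iff)
    qed
    show thesis using r by (intro *[of "r / 2"]) auto
  qed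
  define c where "c = norm (1 :: real ^ 'n)"
  have c: "0 \<le> c" by (simp add: c_def)
  have "((\<lambda>t. prob {\<omega> \<in> space M. d / (c + 1) < norm (X t \<omega> - X 0 \<omega>)}) \<longlongrightarrow> 0) (at 0 within {0..})"
    using levy d c unfolding levy_process_wrt_def by (auto simp: add_nonneg_pos)
  moreover have "filterlim (\<lambda>k. 1 / 2 ^ k :: real) (at 0 within {0..}) sequentially"
  proof (unfold filterlim_at, intro conjI)
    show "(\<lambda>k. 1 / 2 ^ k :: real) \<longlonglongrightarrow> 0" by real_asymp
  qed simp
  ultimately have "(\<lambda>k. prob {\<omega> \<in> space M. d / (c + 1) < norm (X (1 / 2 ^ k) \<omega> - X 0 \<omega>)}) \<longlonglongrightarrow> 0"
    by (rule filterlim_compose)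
  from order_tendstoD(2)[OF this d(1)]
  show "\<forall>\<^sub>F k in sequentially. (\<integral>\<^sup>+\<omega>. ennreal (min 1 (1 \<bullet> X (1 / 2 ^ k) \<omega>)) \<partial>M) < e"
  proof eventually_elim
    case (elim k)
    let ?E = "{\<omega> \<in> space M. d / (c + 1) < norm (X (1 / 2 ^ k) \<omega> - X 0 \<omega>)}"
    have [measurable]: "X (1 / 2 ^ k) \<in> borel_measurable M" "X 0 \<in> borel_measurable M"
      by (auto intro: measurable_X)
    have [measurable]: "?E \<in> events" by measurable
    have "(\<integral>\<^sup>+\<omega>. ennreal (min 1 (1 \<bullet> X (1 / 2 ^ k) \<omega>)) \<partial>M) \<le> (\<integral>\<^sup>+\<omega>. ennreal d + indicator ?E \<omega> \<partial>M)"
    proof (rule nn_integral_mono_AE, use AE_start AE_space in eventually_elim)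
      case (elim \<omega>)
      show ?case
      proof (cases "d / (c + 1) < norm (X (1 / 2 ^ k) \<omega> - X 0 \<omega>) \<and> \<omega> \<in> space M")
        case True
        then have "indicator ?E \<omega> = (1 :: ennreal)" by (simp add: indicator_def)
        moreover have "ennreal (min 1 (1 \<bullet> X (1 / 2 ^ k) \<omega>)) \<le> ennreal 1" by (intro ennreal_leI) simp
        ultimately show ?thesis by (simp add: add_increasing)
      next
        case False
        have "1 \<bullet> X (1 / 2 ^ k) \<omega> \<le> c * norm (X (1 / 2 ^ k) \<omega>)"
          unfolding c_def by (rule norm_cauchy_schwarz)
        also have "\<dots> \<le> (c + 1) * norm (X (1 / 2 ^ k) \<omega>)" by (simp add: algebra_simps)
        also have "\<dots> \<le> (c + 1) * (d / (c + 1))"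
          using False elim c by (intro mult_left_mono) auto
        also have "\<dots> = d" using c by simp
        finally have "ennreal (min 1 (1 \<bullet> X (1 / 2 ^ k) \<omega>)) \<le> ennreal d" by (intro ennreal_leI) simp
        then show ?thesis by (simp add: add_increasing2)
      qed
    qed
    also have "\<dots> = ennreal d + ennreal (prob ?E)"
      by (subst nn_integral_add) (auto simp: emeasure_eq_measure prob_space)
    also have "\<dots> \<le> ennreal (2 * d)"
      using elim d by (simp add: ennreal_leI flip: ennreal_plus)
    also have "\<dots> < e" by (rule d)
    finally show ?case .
  qed
qed simp

lemma AE_right_eval:
  assumes indep: "indep_set (sets N1) (sets N2)" and sp: "space N1 = space M" "space N2 = space M"
    and X': "\<And>t. 0 \<le> t \<Longrightarrow> X' t \<in> borel_measurable N2" "AE \<omega> in M. \<forall>t\<ge>0. X t \<omega> = X' t \<omega>"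
    and T: "T \<in> borel_measurable N1" "\<And>\<omega>. 0 \<le> T \<omega>"
  shows "AE \<omega> in M. X (T \<omega>) \<omega> = right_eval X' (T \<omega>) \<omega>"
proof -
  \<comment> \<open>Given \<open>T\<close>, the sum of the coordinates of \<open>X\<close> gained between the dyadic neighbours of \<open>T\<close> is
    distributed as that of \<open>X (1 / 2 ^ k)\<close>, which tends to 0 in probability.\<close>
  define r where "r k t \<omega> = 1 \<bullet> (X' (dyadic_above k t) \<omega> - X' (max 0 (dyadic_above k t - 1 / 2 ^ k)) \<omega>)" for k t \<omega>
  have dy: "0 \<le> dyadic_above k t - 1 / 2 ^ k" for k t by (simp add: dyadic_above_def field_simps)
  have ev: "sets N1 \<subseteq> events" "sets N2 \<subseteq> events"
    using indep_setD_ev1[OF indep] indep_setD_ev2[OF indep] by auto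
  note [measurable] = X'(1) T(1)
  have joint [measurable]: "(\<lambda>p. X' (dyadic_above k (T (fst p))) (snd p)) \<in> borel_measurable (N1 \<Otimes>\<^sub>M N2)" for k
    by (rule measurable_dyadic_above[where X="\<lambda>t p. X' t (snd p)"]) measurable
  have joint' [measurable]: "(\<lambda>p. X' (max 0 (dyadic_above k (T (fst p)) - 1 / 2 ^ k)) (snd p)) \<in> borel_measurable (N1 \<Otimes>\<^sub>M N2)" for k
    by (rule measurable_dyadic_above[where X="\<lambda>t p. X' (max 0 (t - 1 / 2 ^ k)) (snd p)"]) measurable
  have "(\<lambda>\<omega>. (\<omega>, \<omega>)) \<in> M \<rightarrow>\<^sub>M N1 \<Otimes>\<^sub>M N2"
    using ev sp by (intro measurable_Pair) (auto intro!: measurableI dest: sets.sets_into_space simp: Int_absorb2)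
  then have diag: "(\<lambda>\<omega>. f (\<omega>, \<omega>)) \<in> borel_measurable M" if "f \<in> borel_measurable (N1 \<Otimes>\<^sub>M N2)" for f :: "_ \<Rightarrow> ennreal"
    using measurable_compose[OF _ that] by blast
  have int_r: "(\<integral>\<^sup>+\<omega>. ennreal (min 1 (r k (T \<omega>) \<omega>)) \<partial>M) = (\<integral>\<^sup>+\<omega>. ennreal (min 1 (1 \<bullet> X (1 / 2 ^ k) \<omega>)) \<partial>M)" for k
  proof -
    have "(\<integral>\<^sup>+\<omega>. (\<lambda>p. ennreal (min 1 (r k (T (fst p)) (snd p)))) (\<omega>, \<omega>) \<partial>M) =
      (\<integral>\<^sup>+\<omega>'. \<integral>\<^sup>+\<omega>. (\<lambda>p. ennreal (min 1 (r k (T (fst p)) (snd p)))) (\<omega>', \<omega>) \<partial>M \<partial>M)"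
      by (rule nn_integral_indep_pair[OF indep sp]) (unfold r_def, measurable)
    also have "\<dots> = (\<integral>\<^sup>+\<omega>'. (\<integral>\<^sup>+\<omega>. ennreal (min 1 (1 \<bullet> X (1 / 2 ^ k) \<omega>)) \<partial>M) \<partial>M)"
    proof (rule nn_integral_cong)
      fix \<omega>'
      define t where "t = dyadic_above k (T \<omega>')"
      have t: "0 \<le> t - 1 / 2 ^ k" "t - 1 / 2 ^ k \<le> t" unfolding t_def using dy by auto
      have t0: "0 \<le> t" unfolding t_def by (rule dyadic_above_nonneg)
      have "(\<integral>\<^sup>+\<omega>. ennreal (min 1 (r k (T \<omega>') \<omega>)) \<partial>M) = (\<integral>\<^sup>+\<omega>. ennreal (min 1 (1 \<bullet> (X t \<omega> - X (t - 1 / 2 ^ k) \<omega>))) \<partial>M)"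
      proof (rule nn_integral_cong_AE, use X'(2) in eventually_elim)
        case (elim \<omega>)
        then have "X t \<omega> = X' t \<omega>" "X (t - 1 / 2 ^ k) \<omega> = X' (t - 1 / 2 ^ k) \<omega>" using t t0 by auto
        moreover have "max 0 (t - 1 / 2 ^ k) = t - 1 / 2 ^ k" using t(1) by simp
        ultimately show ?case unfolding r_def t_def[symmetric] by simp
      qed
      also have "\<dots> = (\<integral>\<^sup>+\<omega>. ennreal (min 1 (1 \<bullet> (X (t - (t - 1 / 2 ^ k)) \<omega>))) \<partial>M)"
        by (rule levy_nn_integral_increment[OF levy t, where g="\<lambda>x. ennreal (min 1 (1 \<bullet> x))"]) measurable
      finally show "(\<integral>\<^sup>+\<omega>. (\<lambda>p. ennreal (min 1 (r k (T (fst p)) (snd p)))) (\<omega>', \<omega>) \<partial>M) =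
          (\<integral>\<^sup>+\<omega>. ennreal (min 1 (1 \<bullet> X (1 / 2 ^ k) \<omega>)) \<partial>M)" by simp
    qed
    finally show ?thesis by (simp add: emeasure_space_1)
  qed
  have mr: "(\<lambda>\<omega>. ennreal (min 1 (r k (T \<omega>) \<omega>))) \<in> borel_measurable M" for k
    using diag[of "\<lambda>p. ennreal (min 1 (r k (T (fst p)) (snd p)))"] by (simp add: r_def)
  \<comment> \<open>An infimum over \<open>k\<close> can stand in for a limit: along a monotone
    path, a small increment at one level bounds the distance from the value at \<open>T\<close> at
    all finer levels.\<close>
  have "(\<integral>\<^sup>+\<omega>. (INF k. ennreal (min 1 (r k (T \<omega>) \<omega>))) \<partial>M) \<le> (\<integral>\<^sup>+\<omega>. ennreal (min 1 (1 \<bullet> X (1 / 2 ^ k) \<omega>)) \<partial>M)" for k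
    unfolding int_r[symmetric] by (intro nn_integral_mono INF_lower) simp
  then have "(\<integral>\<^sup>+\<omega>. (INF k. ennreal (min 1 (r k (T \<omega>) \<omega>))) \<partial>M) \<le> 0"
    using LIMSEQ_le_const[OF small_increment] by blast
  then have "AE \<omega> in M. (INF k. ennreal (min 1 (r k (T \<omega>) \<omega>))) = 0"
    using mr by (subst (asm) le_zero_eq, subst (asm) nn_integral_0_iff_AE) auto
  then show ?thesis
    using X'(2) AE_mono
  proof eventually_elim
    case (elim \<omega>)
    have mono: "X' s \<omega> \<le> X' t \<omega>" if "0 \<le> s" "s \<le> t" for s t
      using elim(2,3) that by (metis order_trans)
    let ?T = "T \<omega>"
    have XT: "X ?T \<omega> = X' ?T \<omega>" using elim(2) T(2) by simp
    have "(\<lambda>k. X' (dyadic_above k ?T) \<omega>) \<longlonglongrightarrow> X' ?T \<omega>"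
    proof (rule vec_tendstoI, rule LIMSEQ_I)
      fix j and e :: real assume "0 < e"
      then have "(INF k. ennreal (min 1 (r k ?T \<omega>))) < ennreal (min 1 e)" using elim(1) by simp
      then obtain k where k: "ennreal (min 1 (r k ?T \<omega>)) < ennreal (min 1 e)" by (auto simp: INF_less_iff)
      then have rk: "r k ?T \<omega> < e" using \<open>0 < e\<close>
        by (cases "r k ?T \<omega> \<le> 0") (auto simp: ennreal_less_iff min_def split: if_splits)
      show "\<exists>k0. \<forall>k\<ge>k0. norm (X' (dyadic_above k ?T) \<omega> $ j - X' ?T \<omega> $ j) < e"
      proof (intro exI[of _ k] allI impI)
        fix m assume "k \<le> m"
        have lo: "dyadic_above k ?T - 1 / 2 ^ k \<le> ?T" using dyadic_above_bounds(2)[OF T(2)[of \<omega>], of k] by simp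
        have a: "X' ?T \<omega> \<le> X' (dyadic_above m ?T) \<omega>"
          using dyadic_above_bounds(1)[OF T(2)[of \<omega>], of m] T(2)[of \<omega>] by (intro mono) auto
        have b: "X' (dyadic_above m ?T) \<omega> \<le> X' (dyadic_above k ?T) \<omega>"
          using dyadic_above_antimono[OF T(2) \<open>k \<le> m\<close>] by (intro mono dyadic_above_nonneg)
        have c: "X' (dyadic_above k ?T - 1 / 2 ^ k) \<omega> \<le> X' ?T \<omega>"
          using dy lo by (intro mono) auto
        have d: "X' (dyadic_above k ?T - 1 / 2 ^ k) \<omega> \<le> X' (dyadic_above k ?T) \<omega>"
          using dy by (intro mono) auto
        have "X' (dyadic_above k ?T) \<omega> $ j - X' (dyadic_above k ?T - 1 / 2 ^ k) \<omega> $ j \<le> r k ?T \<omega>"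
          using member_le_sum[of j UNIV "\<lambda>j. X' (dyadic_above k ?T) \<omega> $ j - X' (dyadic_above k ?T - 1 / 2 ^ k) \<omega> $ j"] d dy
          by (auto simp: r_def inner_vec_def less_eq_vec_def)
        then show "norm (X' (dyadic_above m ?T) \<omega> $ j - X' ?T \<omega> $ j) < e"
          using a b c rk unfolding less_eq_vec_def real_norm_def by (smt (verit))
      qed
    qed
    then show ?case by (simp add: right_eval_def XT limI)
  qed
qed

theorem nn_integral_independent_time:
  assumes indep: "indep_set (sets N1) (sets N2)" and sp: "space N1 = space M" "space N2 = space M"
    and X': "\<And>t. 0 \<le> t \<Longrightarrow> X' t \<in> borel_measurable N2" "AE \<omega> in M. \<forall>t\<ge>0. X t \<omega> = X' t \<omega>"
    and T: "T \<in> borel_measurable N1" "\<And>\<omega>. 0 \<le> T \<omega>"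
    and U: "U \<in> N1 \<rightarrow>\<^sub>M K" and f: "f \<in> borel_measurable (K \<Otimes>\<^sub>M borel)"
  shows "(\<integral>\<^sup>+\<omega>. f (U \<omega>, X (T \<omega>) \<omega>) \<partial>M) = (\<integral>\<^sup>+\<omega>'. \<integral>\<^sup>+\<omega>. f (U \<omega>', X (T \<omega>') \<omega>) \<partial>M \<partial>M)"
proof -
  note [measurable] = X'(1) T(1) U f
  have ae: "AE \<omega> in M. X (T \<omega>) \<omega> = right_eval X' (T \<omega>) \<omega>"
    by (rule AE_right_eval[OF indep sp]) (use X' T in auto)
  have [measurable]: "(\<lambda>p. right_eval X' (T (fst p)) (snd p)) \<in> borel_measurable (N1 \<Otimes>\<^sub>M N2)"
    by (rule measurable_right_eval_pair) measurable
  have "(\<integral>\<^sup>+\<omega>. f (U \<omega>, X (T \<omega>) \<omega>) \<partial>M) = (\<integral>\<^sup>+\<omega>. (\<lambda>p. f (U (fst p), right_eval X' (T (fst p)) (snd p))) (\<omega>, \<omega>) \<partial>M)"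
    by (rule nn_integral_cong_AE, use ae in eventually_elim) simp
  also have "\<dots> = (\<integral>\<^sup>+\<omega>'. \<integral>\<^sup>+\<omega>. (\<lambda>p. f (U (fst p), right_eval X' (T (fst p)) (snd p))) (\<omega>', \<omega>) \<partial>M \<partial>M)"
    by (rule nn_integral_indep_pair[OF indep sp]) measurable
  also have "\<dots> = (\<integral>\<^sup>+\<omega>'. \<integral>\<^sup>+\<omega>. f (U \<omega>', X (T \<omega>') \<omega>) \<partial>M \<partial>M)"
  proof (rule nn_integral_cong, rule nn_integral_cong_AE)
    fix \<omega>' assume "\<omega>' \<in> space M"
    have "AE \<omega> in M. X (T \<omega>') \<omega> = right_eval X' (T \<omega>') \<omega>"
      by (rule AE_right_eval[OF indep sp, where T="\<lambda>_. T \<omega>'"]) (use X' T(2) in auto)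
    then show "AE \<omega> in M. (\<lambda>p. f (U (fst p), right_eval X' (T (fst p)) (snd p))) (\<omega>', \<omega>) = f (U \<omega>', X (T \<omega>') \<omega>)"
      by eventually_elim simp
  qed
  finally show ?thesis .
qed

end

section \<open>A single visit of the server\<close>

text \<open>\<open>r\<close> is the infimum of the times up to \<open>s\<close> at which the path is
  at or below \<open>y\<close>. Right-continuity gives \<open>f r \<le> y\<close>; the left limit at
  \<open>r\<close> is at least \<open>y\<close> and cannot be followed by a downward jump.\<close>

lemma no_negative_jumps_hits_level:
  fixes f :: "real \<Rightarrow> real"
  assumes f: "cadlag f" and jumps: "\<And>t l. 0 < t \<Longrightarrow> (f \<longlongrightarrow> l) (at_left t) \<Longrightarrow> l \<le> f t"
    and start: "y \<le> f 0" and s: "0 \<le> s" "f s < y"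
  obtains r where "0 \<le> r" "r < s" "f r = y"
proof -
  define R where "R = {t. 0 \<le> t \<and> t \<le> s \<and> f t \<le> y}"
  have sR: "s \<in> R" using s by (simp add: R_def)
  have bdd: "bdd_below R" by (auto simp: R_def bdd_below_def)
  define r where "r = Inf R"
  have r: "0 \<le> r" "r \<le> s"
    unfolding r_def using sR bdd by (auto intro: cInf_lower cInf_greatest simp: R_def)
  have before: "y < f t" if "0 \<le> t" "t < r" for t
  proof (rule ccontr)
    assume "\<not> y < f t"
    then have "t \<in> R" using that r by (simp add: R_def)
    then have "r \<le> t" unfolding r_def by (rule cInf_lower[OF _ bdd])
    then show False using that by simp
  qed
  have le: "f r \<le> y"
  proof (rule ccontr)
    assume nle: "\<not> f r \<le> y"
    have "(f \<longlongrightarrow> f r) (at_right r)" using f r by (simp add: cadlag_def)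
    then have "\<forall>\<^sub>F t in at_right r. y < f t" using nle by (intro order_tendstoD) auto
    then obtain b where b: "r < b" "\<And>t. r < t \<Longrightarrow> t < b \<Longrightarrow> y < f t"
      by (auto simp: eventually_at_right_field)
    have "b \<le> Inf R"
    proof (rule cInf_greatest)
      fix t assume t: "t \<in> R"
      then have "r \<le> t" unfolding r_def by (intro cInf_lower bdd)
      moreover have "t \<noteq> r" using t nle by (auto simp: R_def)
      ultimately show "b \<le> t" using b(2)[of t] t by (cases "t < b") (auto simp: R_def)
    qed (use sR in auto)
    then show False using b(1) by (simp add: r_def)
  qed
  have ge: "y \<le> f r"
  proof (cases "r = 0")
    case False
    then have "0 < r" using r by simp
    then obtain l where l: "(f \<longlongrightarrow> l) (at_left r)" using f by (auto simp: cadlag_def)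
    have "\<forall>\<^sub>F t in at_left r. y \<le> f t"
      using eventually_at_left_real[OF \<open>0 < r\<close>] by eventually_elim (auto intro!: less_imp_le before)
    then have "y \<le> l" by (intro tendsto_lowerbound[OF l]) auto
    then show ?thesis using jumps[OF \<open>0 < r\<close> l] by simp
  qed (use start in simp)
  have "f r = y" using le ge by simp
  moreover have "r \<noteq> s" using s \<open>f r = y\<close> by auto
  ultimately show ?thesis using that r by force
qed

lemma (in prob_space) levy_process_wrt_inner:
  fixes X :: "real \<Rightarrow> 'a \<Rightarrow> 'b::euclidean_space"
  assumes "levy_process_wrt M F X"
  shows "levy_process_wrt M F (\<lambda>t \<omega>. w \<bullet> X t \<omega>)"
  unfolding levy_process_wrt_def
proof (intro conjI allI impI)
  note levy = assms[unfolded levy_process_wrt_def]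
  have m: "X t \<in> borel_measurable M" if "0 \<le> t" for t using levy that by simp
  fix t :: real assume "0 \<le> t"
  then have [measurable]: "X t \<in> borel_measurable M" "X t \<in> borel_measurable (F t)" using levy by auto
  show "(\<lambda>\<omega>. w \<bullet> X t \<omega>) \<in> borel_measurable M" "(\<lambda>\<omega>. w \<bullet> X t \<omega>) \<in> borel_measurable (F t)" by measurable
next
  have "AE \<omega> in M. X 0 \<omega> = 0" using assms by (simp add: levy_process_wrt_def)
  then show "AE \<omega> in M. w \<bullet> X 0 \<omega> = 0" by eventually_elim simp
next
  fix s t :: real assume st: "0 \<le> s \<and> s \<le> t"
  have ind: "indep_set (sets (F s)) {(\<lambda>\<omega>. X t \<omega> - X s \<omega>) -` B \<inter> space M | B. B \<in> sets borel}"
    using assms st unfolding levy_process_wrt_def by blast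
  have sub: "{(\<lambda>\<omega>. w \<bullet> X t \<omega> - w \<bullet> X s \<omega>) -` B \<inter> space M | B. B \<in> sets borel} \<subseteq>
      {(\<lambda>\<omega>. X t \<omega> - X s \<omega>) -` B \<inter> space M | B. B \<in> sets borel}"
  proof safe
    fix B :: "real set" assume "B \<in> sets borel"
    then have "(\<lambda>x. w \<bullet> x) -` B \<in> sets (borel :: 'b measure)"
      by (rule measurable_sets_borel[rotated]) simp
    moreover have "(\<lambda>\<omega>. w \<bullet> X t \<omega> - w \<bullet> X s \<omega>) -` B = (\<lambda>\<omega>. X t \<omega> - X s \<omega>) -` ((\<lambda>x. w \<bullet> x) -` B)"
      by (auto simp: inner_diff_right)
    ultimately show "\<exists>Ba. (\<lambda>\<omega>. w \<bullet> X t \<omega> - w \<bullet> X s \<omega>) -` B \<inter> space M = (\<lambda>\<omega>. X t \<omega> - X s \<omega>) -` Ba \<inter> space M \<and> Ba \<in> sets borel"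
      by (intro exI[of _ "(\<lambda>x. w \<bullet> x) -` B"]) simp
  qed
  show "indep_set (sets (F s)) {(\<lambda>\<omega>. w \<bullet> X t \<omega> - w \<bullet> X s \<omega>) -` B \<inter> space M | B. B \<in> sets borel}"
    using ind sub unfolding indep_sets2_eq by (meson order_trans subsetD)
next
  fix s t :: real assume st: "0 \<le> s \<and> 0 \<le> t"
  have m: "X t \<in> borel_measurable M" if "0 \<le> t" for t using assms that by (simp add: levy_process_wrt_def)
  have [measurable]: "X (s + t) \<in> borel_measurable M" "X s \<in> borel_measurable M" "X t \<in> borel_measurable M"
    using st by (auto intro: m)
  have "distr M borel (\<lambda>\<omega>. w \<bullet> X (s + t) \<omega> - w \<bullet> X s \<omega>) = distr (distr M borel (\<lambda>\<omega>. X (s + t) \<omega> - X s \<omega>)) borel (\<lambda>x. w \<bullet> x)"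
    by (subst distr_distr) (auto simp: comp_def inner_diff_right)
  also have "\<dots> = distr (distr M borel (X t)) borel (\<lambda>x. w \<bullet> x)"
    using assms st unfolding levy_process_wrt_def by simp
  also have "\<dots> = distr M borel (\<lambda>\<omega>. w \<bullet> X t \<omega>)"
    by (subst distr_distr) (auto simp: comp_def)
  finally show "distr M borel (\<lambda>\<omega>. w \<bullet> X (s + t) \<omega> - w \<bullet> X s \<omega>) = distr M borel (\<lambda>\<omega>. w \<bullet> X t \<omega>)" .
next
  fix s e :: real assume s: "0 \<le> s" and e: "0 < e"
  have m: "X t \<in> borel_measurable M" if "0 \<le> t" for t using assms that by (simp add: levy_process_wrt_def)
  \<comment> \<open>The summand 1 keeps the divisor positive when \<open>w\<close> is 0.\<close>
  let ?c = "norm w + 1"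
  have c: "0 < ?c" by (simp add: add_nonneg_pos)
  have "((\<lambda>t. prob {\<omega> \<in> space M. e / ?c < norm (X t \<omega> - X s \<omega>)}) \<longlongrightarrow> 0) (at s within {0..})"
    using assms s e c unfolding levy_process_wrt_def by simp
  then show "((\<lambda>t. prob {\<omega> \<in> space M. e < norm (w \<bullet> X t \<omega> - w \<bullet> X s \<omega>)}) \<longlongrightarrow> 0) (at s within {0..})"
  proof (rule tendsto_sandwich[OF _ _ tendsto_const, rotated -1])
    show "\<forall>\<^sub>F t in at s within {0..}. prob {\<omega> \<in> space M. e < norm (w \<bullet> X t \<omega> - w \<bullet> X s \<omega>)} \<le>
        prob {\<omega> \<in> space M. e / ?c < norm (X t \<omega> - X s \<omega>)}"
      unfolding eventually_at_filter
    proof (intro always_eventually allI impI finite_measure_mono subsetI)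
      fix t \<omega> assume t: "t \<noteq> s" "t \<in> {0..}"
      then have [measurable]: "X t \<in> borel_measurable M" "X s \<in> borel_measurable M" using s by (auto intro: m)
      show "{\<omega> \<in> space M. e / ?c < norm (X t \<omega> - X s \<omega>)} \<in> events" by measurable
      assume *: "\<omega> \<in> {\<omega> \<in> space M. e < norm (w \<bullet> X t \<omega> - w \<bullet> X s \<omega>)}"
      have "norm (w \<bullet> X t \<omega> - w \<bullet> X s \<omega>) \<le> norm w * norm (X t \<omega> - X s \<omega>)"
        unfolding inner_diff_right[symmetric] real_norm_def by (rule Cauchy_Schwarz_ineq2)
      also have "\<dots> \<le> ?c * norm (X t \<omega> - X s \<omega>)" by (intro mult_right_mono) auto
      finally have "e < ?c * norm (X t \<omega> - X s \<omega>)" using * by auto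
      then show "\<omega> \<in> {\<omega> \<in> space M. e / ?c < norm (X t \<omega> - X s \<omega>)}"
        using * c by (auto simp: field_simps)
    qed
  qed auto
qed

text \<open>\<open>offspring\<close> with its value at a random time replaced by a dyadic limit.
  This makes it a measurable functional of \<open>W\<close>, \<open>A\<close> and
  \<open>\<tau>\<close> at fixed indices, for which independence and equality of laws are
  assumed.\<close>

definition offspring_limit ::
    "'n::finite \<Rightarrow> (real \<Rightarrow> 'a \<Rightarrow> real ^ 'n) \<Rightarrow> (real \<Rightarrow> 'a \<Rightarrow> real) \<Rightarrow> (real \<Rightarrow> 'a \<Rightarrow> real)
      \<Rightarrow> real \<Rightarrow> 'a \<Rightarrow> real ^ 'n" where
  "offspring_limit i W A \<tau> x \<omega> = x *\<^sub>R axis i 1 + right_eval (work_process i W A) (\<tau> x \<omega>) \<omega>"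

lemma measurable_vec_nth:
  fixes f :: "'a \<Rightarrow> real ^ 'n"
  assumes "f \<in> borel_measurable N"
  shows "(\<lambda>\<omega>. f \<omega> $ j) \<in> borel_measurable N"
  using borel_measurable_inner[OF assms borel_measurable_const, of "axis j 1"] by (simp add: inner_axis)

lemma measurable_vecI:
  fixes f :: "'a \<Rightarrow> real ^ 'n"
  assumes "\<And>j. (\<lambda>\<omega>. f \<omega> $ j) \<in> borel_measurable N"
  shows "f \<in> borel_measurable N"
proof (rule borel_measurable_euclidean_space[THEN iffD2], rule ballI)
  fix b :: "real ^ 'n" assume "b \<in> Basis"
  then obtain j where "b = axis j 1" by (auto simp: Basis_vec_def)
  then show "(\<lambda>\<omega>. f \<omega> \<bullet> b) \<in> borel_measurable N" using assms by (simp add: inner_axis)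
qed

lemma measurable_work_process:
  assumes "W t \<in> borel_measurable N" "A t \<in> borel_measurable N"
  shows "work_process i W A t \<in> borel_measurable N"
proof (rule measurable_vecI)
  fix j
  show "(\<lambda>\<omega>. work_process i W A t \<omega> $ j) \<in> borel_measurable N"
    by (cases "j = i") (simp_all add: work_process_def measurable_vec_nth assms)
qed

lemma measurable_offspring_limit:
  assumes "\<And>t. 0 \<le> t \<Longrightarrow> W t \<in> borel_measurable N" "\<And>t. 0 \<le> t \<Longrightarrow> A t \<in> borel_measurable N"
    and "\<tau> x \<in> borel_measurable N"
  shows "offspring_limit i W A \<tau> x \<in> borel_measurable N"
proof -
  have [measurable]: "(\<lambda>\<omega>. right_eval (work_process i W A) (\<tau> x \<omega>) \<omega>) \<in> borel_measurable N"
    using assms by (intro measurable_right_eval measurable_work_process)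
  show ?thesis unfolding offspring_limit_def by measurable
qed

section \<open>Mean service time and mean offspring\<close>

context service_visit begin

abbreviation "work \<equiv> work_process i W A"
abbreviation "children \<equiv> offspring i W A \<tau>"
definition "rate = (\<chi> j. expectation (\<lambda>\<omega>. work 1 \<omega> $ j))"

sublocale children: subordinator_process M children
  by unfold_locales (rule branching)

sublocale input: subordinator_process M W
  by unfold_locales (rule input)

lemma space_F: "space (F t) = space M" and sets_F: "sets (F t) \<subseteq> sets M"
  using filtration unfolding augmented_right_continuous_filtration_def filtration_def by auto

lemma measurable_work: "0 \<le> t \<Longrightarrow> work t \<in> borel_measurable M"
  using levy by (simp add: levy_process_wrt_def)

lemma integrable_inner_work: "integrable M (\<lambda>\<omega>. w \<bullet> work 1 \<omega>)"
  and expectation_inner_work: "expectation (\<lambda>\<omega>. w \<bullet> work 1 \<omega>) = w \<bullet> rate"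
  using finite_rates by (simp_all add: inner_vec_def rate_def)

lemma integrable_levy_inner: "integrable_levy_process M F (\<lambda>t \<omega>. w \<bullet> work t \<omega>)"
proof -
  interpret filtration "space M" F
    using filtration unfolding augmented_right_continuous_filtration_def by auto
  show ?thesis
    by unfold_locales (use sets_F levy_process_wrt_inner[OF levy] integrable_inner_work in auto)
qed

lemma AE_right_cont: "AE \<omega> in M. \<forall>t\<ge>0. ((\<lambda>t. work t \<omega>) \<longlongrightarrow> work t \<omega>) (at_right t)"
  using cadlag by eventually_elim (simp add: cadlag_def)

lemma AE_right_cont_inner: "AE \<omega> in M. \<forall>t\<ge>0. ((\<lambda>t. w \<bullet> work t \<omega>) \<longlongrightarrow> w \<bullet> work t \<omega>) (at_right t)"
  using AE_right_cont by eventually_elim (auto intro!: tendsto_intros)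

lemma work_i: "work t \<omega> $ i = A t \<omega>"
  by (simp add: work_process_def)

lemma rate_i: "rate $ i = expectation (A 1)"
  by (simp add: rate_def work_i)

lemma measurable_service: "0 \<le> x \<Longrightarrow> \<tau> x \<in> borel_measurable M"
  using measurable_stopping_time[OF non_anticipating sets_F space_F] .

text \<open>Without downward jumps a path cannot pass below \<open>- x\<close> before having been
  equal to it. One null set serves all \<open>x\<close> and \<open>s\<close>, as is required for
  inserting random times.\<close>

lemma AE_level: "AE \<omega> in M. \<forall>x\<ge>0. \<forall>s\<ge>0. ereal s \<le> hitting_time A x \<omega> \<longrightarrow> - x \<le> A s \<omega>"
proof -
  have "AE \<omega> in M. A 0 \<omega> = 0"
    using spectrally_positive by (simp add: spectrally_positive_def levy_process_def levy_process_wrt_def)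
  moreover have "AE \<omega> in M. cadlag (\<lambda>t. A t \<omega>) \<and> (\<forall>t>0. \<forall>l. ((\<lambda>s. A s \<omega>) \<longlongrightarrow> l) (at_left t) \<longrightarrow> l \<le> A t \<omega>)"
    using spectrally_positive by (simp add: spectrally_positive_def)
  ultimately show ?thesis
  proof eventually_elim
    case (elim \<omega>)
    show ?case
    proof (intro allI impI)
      fix x s :: real assume x: "0 \<le> x" and s: "0 \<le> s" and le: "ereal s \<le> hitting_time A x \<omega>"
      show "- x \<le> A s \<omega>"
      proof (rule ccontr)
        assume "\<not> - x \<le> A s \<omega>"
        then obtain r where r: "0 \<le> r" "r < s" "A r \<omega> = - x"
          using no_negative_jumps_hits_level[of "\<lambda>t. A t \<omega>" "- x" s] elim x s by auto
        have "hitting_time A x \<omega> \<le> ereal r"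
          unfolding hitting_time_def using r by (intro INF_lower) auto
        then show False using le r(2) by (metis ereal_less_eq(3) leD order_trans)
      qed
    qed
  qed
qed

text \<open>Work conservation and \<open>AE_level\<close> keep \<open>A\<close> at or above
  \<open>- x\<close> at the truncated time, whereas Wald's identity makes its mean there the
  negative drift times the mean of that time. Truncation supplies the integrability that Wald's
  identity asks for, and since the bound is uniform in \<open>T\<close>, Fatou removes the
  truncation afterwards.\<close>

lemma service_time_truncated:
  assumes x: "0 \<le> x" and T: "0 \<le> T"
  shows "integrable M (\<lambda>\<omega>. min (\<tau> x \<omega>) T)" "expectation (\<lambda>\<omega>. min (\<tau> x \<omega>) T) \<le> x / - expectation (A 1)"
proof -
  note [measurable] = measurable_service[OF x]
  interpret Z: integrable_levy_process M F "\<lambda>t \<omega>. axis i 1 \<bullet> work t \<omega>"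
    by (rule integrable_levy_inner)
  let ?T = "\<lambda>\<omega>. min (\<tau> x \<omega>) T"
  show int: "integrable M ?T"
    by (rule integrable_const_bound[where B=T]) (use nonneg[OF x] T in \<open>auto intro!: AE_I2\<close>)
  have st: "stopping_time F ?T"
    by (intro stopping_time_min non_anticipating x stopping_time_const)
  have w: "integrable M (\<lambda>\<omega>. axis i 1 \<bullet> work (?T \<omega>) \<omega>)"
    "expectation (\<lambda>\<omega>. axis i 1 \<bullet> work (?T \<omega>) \<omega>) = expectation (\<lambda>\<omega>. axis i 1 \<bullet> work 1 \<omega>) * expectation ?T"
    using Z.wald[OF st _ int AE_right_cont_inner] nonneg[OF x] T by auto
  have "AE \<omega> in M. - x \<le> A (?T \<omega>) \<omega>"
    using AE_level work_conserving[OF x] AE_space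
  proof eventually_elim
    case (elim \<omega>)
    have "ereal (?T \<omega>) \<le> ereal (\<tau> x \<omega>)" by simp
    also have "\<dots> \<le> hitting_time A x \<omega>" by (rule elim)
    finally show ?case using elim(1) x nonneg[OF x elim(3)] T by simp
  qed
  then have "- x \<le> expectation (\<lambda>\<omega>. A (?T \<omega>) \<omega>)"
    using w(1) by (intro integral_ge_const) (simp_all add: inner_axis' work_i)
  also have "\<dots> = expectation (A 1) * expectation ?T"
    using w(2) by (simp add: inner_axis' work_i)
  finally show "expectation ?T \<le> x / - expectation (A 1)"
    using negative_drift by (simp add: field_simps)
qed

lemma integrable_service:
  assumes x: "0 \<le> x"
  shows "integrable M (\<tau> x)"
proof (rule integrableI_bounded)
  note [measurable] = measurable_service[OF x]
  show "\<tau> x \<in> borel_measurable M" by measurable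
  have trunc: "(\<integral>\<^sup>+\<omega>. ennreal (min (\<tau> x \<omega>) (real n)) \<partial>M) \<le> ennreal (x / - expectation (A 1))" for n
  proof -
    have "(\<integral>\<^sup>+\<omega>. ennreal (min (\<tau> x \<omega>) (real n)) \<partial>M) = ennreal (expectation (\<lambda>\<omega>. min (\<tau> x \<omega>) (real n)))"
      using nonneg[OF x] by (intro nn_integral_eq_integral service_time_truncated x) (auto intro!: AE_I2)
    also have "\<dots> \<le> ennreal (x / - expectation (A 1))"
      by (intro ennreal_leI service_time_truncated x) simp
    finally show ?thesis .
  qed
  have "(\<integral>\<^sup>+\<omega>. ennreal (norm (\<tau> x \<omega>)) \<partial>M) = (\<integral>\<^sup>+\<omega>. liminf (\<lambda>n. ennreal (min (\<tau> x \<omega>) (real n))) \<partial>M)"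
  proof (rule nn_integral_cong)
    fix \<omega> assume \<omega>: "\<omega> \<in> space M"
    obtain N where N: "\<tau> x \<omega> \<le> real N" using real_arch_simple by blast
    have "\<forall>\<^sub>F n in sequentially. ennreal (min (\<tau> x \<omega>) (real n)) = ennreal (\<tau> x \<omega>)"
      using eventually_ge_at_top[of N] by eventually_elim (use N in \<open>auto simp: min_def\<close>)
    then have "(\<lambda>n. ennreal (min (\<tau> x \<omega>) (real n))) \<longlonglongrightarrow> ennreal (\<tau> x \<omega>)" by (rule tendsto_eventually)
    then have "liminf (\<lambda>n. ennreal (min (\<tau> x \<omega>) (real n))) = ennreal (\<tau> x \<omega>)"
      by (rule lim_imp_Liminf[rotated]) simp
    then show "ennreal (norm (\<tau> x \<omega>)) = liminf (\<lambda>n. ennreal (min (\<tau> x \<omega>) (real n)))"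
      using nonneg[OF x \<omega>] by simp
  qed
  also have "\<dots> \<le> liminf (\<lambda>n. \<integral>\<^sup>+\<omega>. ennreal (min (\<tau> x \<omega>) (real n)) \<partial>M)"
    by (rule nn_integral_liminf) measurable
  also have "\<dots> \<le> liminf (\<lambda>n. ennreal (x / - expectation (A 1)))"
    by (rule Liminf_mono) (use trunc in auto)
  also have "\<dots> < \<infinity>" by (simp add: Liminf_const)
  finally show "(\<integral>\<^sup>+\<omega>. ennreal (norm (\<tau> x \<omega>)) \<partial>M) < \<infinity>" .
qed

lemma inner_children: "w \<bullet> children x \<omega> = x * w $ i + w \<bullet> work (\<tau> x \<omega>) \<omega>"
  by (simp add: offspring_def inner_add_right inner_axis)

lemma children_mean_service:
  assumes x: "0 \<le> x"
  shows "integrable M (\<lambda>\<omega>. w \<bullet> children x \<omega>)"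
    "expectation (\<lambda>\<omega>. w \<bullet> children x \<omega>) = x * w $ i + (w \<bullet> rate) * expectation (\<tau> x)"
proof -
  interpret Z: integrable_levy_process M F "\<lambda>t \<omega>. w \<bullet> work t \<omega>"
    by (rule integrable_levy_inner)
  have "integrable M (\<lambda>\<omega>. w \<bullet> work (\<tau> x \<omega>) \<omega>)"
    "expectation (\<lambda>\<omega>. w \<bullet> work (\<tau> x \<omega>) \<omega>) = expectation (\<lambda>\<omega>. w \<bullet> work 1 \<omega>) * expectation (\<tau> x)"
    using Z.wald[OF non_anticipating[OF x] nonneg[OF x] integrable_service[OF x] AE_right_cont_inner] by auto
  then show "integrable M (\<lambda>\<omega>. w \<bullet> children x \<omega>)"
    "expectation (\<lambda>\<omega>. w \<bullet> children x \<omega>) = x * w $ i + (w \<bullet> rate) * expectation (\<tau> x)"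
    by (simp_all add: inner_children expectation_inner_work prob_space)
qed

definition "service_rate = expectation (\<tau> 1)"

text \<open>The branching property makes the mean of coordinate \<open>i\<close> of the offspring
  linear in \<open>x\<close>. By Wald's identity this mean is \<open>x\<close> plus the drift of
  \<open>A\<close> times the mean of \<open>\<tau> x\<close>, and the drift is not 0.\<close>

lemma expectation_service:
  assumes x: "0 \<le> x"
  shows "expectation (\<tau> x) = x * service_rate"
proof -
  have "expectation (\<lambda>\<omega>. axis i 1 \<bullet> children x \<omega>) = x * expectation (\<lambda>\<omega>. axis i 1 \<bullet> children 1 \<omega>)"
    using children_mean_service(1) x by (intro children.expectation_linear) (auto simp: less_eq_vec_def axis_def)
  then have "x + rate $ i * expectation (\<tau> x) = x * (1 + rate $ i * service_rate)"
    using children_mean_service(2)[OF x, of "axis i 1"] children_mean_service(2)[of 1 "axis i 1"]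
    by (simp add: inner_axis' service_rate_def)
  then have "rate $ i * expectation (\<tau> x) = rate $ i * (x * service_rate)" by (simp add: algebra_simps)
  then show ?thesis using negative_drift by (simp add: rate_i)
qed

lemma children_mean:
  assumes x: "0 \<le> x"
  shows "expectation (\<lambda>\<omega>. w \<bullet> children x \<omega>) = x * (w $ i + service_rate * (w \<bullet> rate))"
  using children_mean_service(2)[OF x] by (simp add: expectation_service[OF x] algebra_simps)

lemma service_rate_nonneg: "0 \<le> service_rate"
  unfolding service_rate_def by (rule integral_nonneg_AE) (auto intro!: AE_I2 nonneg)

text \<open>Mean service times are proportional to the amount found, so a single amount that is
  served for a positive time with positive probability rules out
  \<open>service_rate = 0\<close>.\<close>

lemma service_rate_pos:
  assumes x: "0 \<le> x" and pos: "\<not> (AE \<omega> in M. \<tau> x \<omega> = 0)"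
  shows "0 < service_rate"
proof -
  have "service_rate \<noteq> 0"
  proof
    assume "service_rate = 0"
    then have "expectation (\<tau> x) = 0" by (simp add: expectation_service[OF x])
    then have "AE \<omega> in M. \<tau> x \<omega> = 0"
      using integral_nonneg_eq_0_iff_AE[OF integrable_service[OF x]] nonneg[OF x] by (auto intro!: AE_I2)
    then show False using pos by simp
  qed
  then show ?thesis using service_rate_nonneg by simp
qed

text \<open>This is the mean of a nonnegative variable. Since the expression is linear in
  \<open>w\<close>, it is also monotone in \<open>w\<close>, and in that form it enters the
  contraction argument.\<close>

lemma children_mean_nonneg:
  assumes "0 \<le> w"
  shows "0 \<le> w $ i + service_rate * (w \<bullet> rate)"
proof -
  from children.AE_nonneg have "AE \<omega> in M. 0 \<le> w \<bullet> children 1 \<omega>"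
    by eventually_elim (use assms in \<open>auto intro!: inner_nonneg_vec\<close>)
  then have "0 \<le> expectation (\<lambda>\<omega>. w \<bullet> children 1 \<omega>)" by (rule integral_nonneg_AE)
  then show ?thesis by (simp add: children_mean)
qed

lemma rate_nonneg:
  assumes "j \<noteq> i"
  shows "0 \<le> rate $ j"
proof -
  from input.AE_nonneg have "AE \<omega> in M. 0 \<le> work 1 \<omega> $ j"
    by eventually_elim (use assms in \<open>auto simp: work_process_def less_eq_vec_def\<close>)
  then show ?thesis unfolding rate_def by (simp add: integral_nonneg_AE)
qed

lemma AE_offspring_limit: "AE \<omega> in M. \<forall>x\<ge>0. children x \<omega> = offspring_limit i W A \<tau> x \<omega>"
  using AE_right_cont AE_space
proof eventually_elim
  case (elim \<omega>)
  show ?case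
  proof (intro allI impI)
    fix x :: real assume x: "0 \<le> x"
    have t: "0 \<le> \<tau> x \<omega>" using nonneg[OF x elim(2)] .
    have "((\<lambda>t. work t \<omega>) \<longlongrightarrow> work (\<tau> x \<omega>) \<omega>) (at_right (\<tau> x \<omega>))" using elim(1) t by blast
    then have "(\<lambda>k. work (dyadic_above k (\<tau> x \<omega>)) \<omega>) \<longlonglongrightarrow> work (\<tau> x \<omega>) \<omega>"
      by (rule filterlim_compose[OF _ dyadic_above_filterlim[OF t]])
    then show "children x \<omega> = offspring_limit i W A \<tau> x \<omega>"
      by (simp add: offspring_def offspring_limit_def right_eval_def limI)
  qed
qed

lemma measurable_A: "0 \<le> t \<Longrightarrow> A t \<in> borel_measurable M"
  using measurable_vec_nth[OF measurable_work[of t], of i] by (simp add: work_i)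

text \<open>Copies of a visit are assumed to agree in the joint law of the paths of
  \<open>W\<close>, \<open>A\<close> and \<open>\<tau>\<close>. Writing the offspring as one
  measurable functional of that path transfers the agreement to them.\<close>

lemma distr_children:
  assumes x: "0 \<le> x"
  shows "distr M borel (children x) = distr (process_law M (\<lambda>r \<omega>. (W r \<omega>, A r \<omega>, \<tau> r \<omega>))) borel
    (offspring_limit i (\<lambda>t p. fst (p t)) (\<lambda>t p. fst (snd (p t))) (\<lambda>t p. snd (snd (p t))) x)"
proof -
  let ?P = "\<Pi>\<^sub>M t\<in>{0..}. borel :: ((real ^ 'n) \<times> real \<times> real) measure"
  let ?path = "\<lambda>\<omega>. \<lambda>t\<in>{0..}. (W t \<omega>, A t \<omega>, \<tau> t \<omega>)"
  let ?G = "offspring_limit i (\<lambda>t p. fst (p t)) (\<lambda>t p. fst (snd (p t))) (\<lambda>t p. snd (snd (p t))) x"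
  have comp: "(\<lambda>p. p t) \<in> ?P \<rightarrow>\<^sub>M borel" if "0 \<le> t" for t
    using that by (intro measurable_component_singleton) simp
  have G: "?G \<in> borel_measurable ?P"
    using x by (intro measurable_offspring_limit)
      (auto intro!: measurable_compose[OF comp] borel_measurable_continuous_onI continuous_intros)
  have path: "?path \<in> M \<rightarrow>\<^sub>M ?P"
    by (intro measurable_restrict borel_measurable_Pair input.measurable_X measurable_A measurable_service) auto
  have "distr M borel (children x) = distr M borel (\<lambda>\<omega>. ?G (?path \<omega>))"
  proof (rule distr_cong_AE)
    show "AE \<omega> in M. children x \<omega> = ?G (?path \<omega>)"
      using AE_offspring_limit
      by eventually_elim (use x in \<open>simp add: offspring_limit_def right_eval_def work_process_def dyadic_above_nonneg cong: if_cong\<close>)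
  qed (use children.measurable_X[OF x] measurable_compose[OF path G] in auto)
  also have "\<dots> = distr (distr M ?P ?path) borel ?G"
    using path G by (simp add: distr_distr comp_def)
  finally show ?thesis by (simp add: process_law_def)
qed

end

section \<open>The workload as a random recursion\<close>

lemma measurable_generated_events:
  fixes X :: "'t \<Rightarrow> 'a \<Rightarrow> 'b::topological_space"
  assumes "generated_events M T X \<subseteq> sets N" "space N = space M" "t \<in> T"
  shows "X t \<in> borel_measurable N"
proof (rule measurableI)
  fix B :: "'b set" assume "B \<in> sets borel"
  then have "X t -` B \<inter> space M \<in> generated_events M T X"
    unfolding generated_events_def using assms(3) by (intro sigma_sets.Basic) blast
  then show "X t -` B \<inter> space N \<in> sets N" using assms(1,2) by auto
qed auto

lemma generated_events_subset: "generated_events M T X \<subseteq> Pow (space M)"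
  unfolding generated_events_def
  by (rule subsetI, rule PowI, rule sigma_sets_into_sp[rotated], assumption) auto

lemma Int_stable_generated_events: "Int_stable (generated_events M T X)"
proof -
  interpret sigma_algebra "space M" "generated_events M T X"
    unfolding generated_events_def by (rule sigma_algebra_sigma_sets) auto
  show ?thesis by (auto simp: Int_stable_def)
qed

lemma (in subordinator_process) AE_right_eval_const:
  assumes t: "0 \<le> t"
  shows "AE \<omega> in M. X t \<omega> = right_eval X t \<omega>"
proof -
  \<comment> \<open>A deterministic time is an independent random time for the trivial
    sigma-algebra.\<close>
  have "indep_set (sets (sigma (space M) {})) (sets M)"
    unfolding indep_sets2_eq
    by (auto simp: sigma_sets_empty_eq prob_space sets.sets_into_space Int_absorb1)
  from AE_right_eval[OF this, of X "\<lambda>_. t"] show ?thesis using t by auto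
qed

definition off :: "'n \<Rightarrow> real ^ 'n \<Rightarrow> real ^ 'n" where
  "off i x = (\<chi> j. if j = i then 0 else x $ j)"

lemma measurable_off: "off i \<in> borel_measurable borel"
  by (rule measurable_vecI) (auto simp: off_def intro!: measurable_vec_nth)

section \<open>Independent sources and the transition kernel of a step\<close>

context polling_system begin

definition events_of :: "'n source \<Rightarrow> 'a set set" where
  "events_of s = (case s of
      Initial \<Rightarrow> generated_events M {()} (\<lambda>_. B\<^sub>0)
    | Visit n i \<Rightarrow> generated_events M {0..} (\<lambda>r \<omega>. (W n i r \<omega>, A n i r \<omega>, \<tau> n i r \<omega>))
    | Switch_Input n i \<Rightarrow> generated_events M {0..} (V n i)
    | Switch_Duration n i \<Rightarrow> generated_events M {()} (\<lambda>_. S n i))"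

definition known :: "'n source set \<Rightarrow> 'a measure" where
  "known J = sigma (space M) (\<Union>s\<in>J. events_of s)"

lemma events_of_Pow: "events_of s \<subseteq> Pow (space M)"
  unfolding events_of_def by (cases s) (simp_all add: generated_events_subset)

lemma space_known [simp]: "space (known J) = space M"
  unfolding known_def using events_of_Pow by (intro space_measure_of) blast

lemma sets_known: "sets (known J) = sigma_sets (space M) (\<Union>s\<in>J. events_of s)"
  unfolding known_def using events_of_Pow by (intro sets_measure_of) blast

lemma indep_events_of: "indep_sets events_of UNIV"
  using independent by (simp add: events_of_def[abs_def])

lemma indep_known:
  assumes "J \<inter> J' = {}"
  shows "indep_set (sets (known J)) (sets (known J'))"
proof -
  have "indep_sets (\<lambda>b. sigma_sets (space M) (\<Union>s\<in>(case b of True \<Rightarrow> J | False \<Rightarrow> J'). events_of s)) UNIV"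
  proof (rule indep_sets_collect_sigma)
    show "indep_sets events_of (\<Union>b\<in>UNIV. case b of True \<Rightarrow> J | False \<Rightarrow> J')"
      using indep_events_of by (rule indep_sets_mono_index[rotated]) simp
    show "Int_stable (events_of s)" for s
      by (auto simp: events_of_def Int_stable_generated_events split: source.splits)
    show "disjoint_family_on (case_bool J J') UNIV"
      using assms by (auto simp: disjoint_family_on_def split: bool.splits)
  qed
  moreover have "(\<lambda>b. sigma_sets (space M) (\<Union>s\<in>(case b of True \<Rightarrow> J | False \<Rightarrow> J'). events_of s)) =
      case_bool (sets (known J)) (sets (known J'))"
    by (auto simp: fun_eq_iff sets_known split: bool.splits)
  ultimately show ?thesis unfolding indep_set_def by simp
qed

lemma known_subset: "sets (known J) \<subseteq> sets M"
  using indep_setD_ev1[OF indep_known[of J "{}"]] by simp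

lemma measurable_known_M: "f \<in> known J \<rightarrow>\<^sub>M N \<Longrightarrow> f \<in> M \<rightarrow>\<^sub>M N"
  using known_subset[of J] by (auto simp: measurable_def)

lemma measurable_known_mono:
  assumes "f \<in> known J \<rightarrow>\<^sub>M N" "J \<subseteq> J'"
  shows "f \<in> known J' \<rightarrow>\<^sub>M N"
proof -
  have "sets (known J) \<subseteq> sets (known J')"
    unfolding sets_known using assms(2) by (intro sigma_sets_subseteq) blast
  then show ?thesis using assms(1) by (auto simp: measurable_def)
qed

lemma events_of_known: "s \<in> J \<Longrightarrow> events_of s \<subseteq> sets (known J)"
  unfolding sets_known by (auto intro: sigma_sets.Basic)

lemma measurable_initial: "B\<^sub>0 \<in> borel_measurable (known {Initial})"
  using measurable_generated_events[of M "{()}" "\<lambda>_. B\<^sub>0" "known {Initial}" "()"] events_of_known[of Initial "{Initial}"]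
  by (simp add: events_of_def)

lemma measurable_duration: "S n i \<in> borel_measurable (known {Switch_Duration n i})"
  using measurable_generated_events[of M "{()}" "\<lambda>_. S n i" "known {Switch_Duration n i}" "()"]
    events_of_known[of "Switch_Duration n i" "{Switch_Duration n i}"]
  by (simp add: events_of_def)

lemma measurable_switch: "0 \<le> t \<Longrightarrow> V n i t \<in> borel_measurable (known {Switch_Input n i})"
  using measurable_generated_events[of M "{0..}" "V n i" "known {Switch_Input n i}" t]
    events_of_known[of "Switch_Input n i" "{Switch_Input n i}"]
  by (simp add: events_of_def)

lemma measurable_visit:
  assumes t: "0 \<le> t"
  shows "W n i t \<in> borel_measurable (known {Visit n i})" "A n i t \<in> borel_measurable (known {Visit n i})"
    "\<tau> n i t \<in> borel_measurable (known {Visit n i})"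
proof -
  have [measurable]: "(\<lambda>\<omega>. (W n i t \<omega>, A n i t \<omega>, \<tau> n i t \<omega>)) \<in> borel_measurable (known {Visit n i})"
    using measurable_generated_events[of M "{0..}" "\<lambda>r \<omega>. (W n i r \<omega>, A n i r \<omega>, \<tau> n i r \<omega>)" "known {Visit n i}" t]
      events_of_known[of "Visit n i" "{Visit n i}"] t
    by (simp add: events_of_def)
  have m: "(\<lambda>\<omega>. g (W n i t \<omega>, A n i t \<omega>, \<tau> n i t \<omega>)) \<in> borel_measurable (known {Visit n i})"
    if "continuous_on UNIV g" for g :: "(real, 'n) vec \<times> real \<times> real \<Rightarrow> 'c::topological_space"
    by (rule measurable_compose[OF _ borel_measurable_continuous_onI[OF that]]) measurable
  show "W n i t \<in> borel_measurable (known {Visit n i})"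
    using m[of fst] by (simp add: continuous_on_fst continuous_on_id)
  show "A n i t \<in> borel_measurable (known {Visit n i})"
    using m[of "\<lambda>p. fst (snd p)"] by (simp add: continuous_on_fst continuous_on_snd continuous_on_id)
  show "\<tau> n i t \<in> borel_measurable (known {Visit n i})"
    using m[of "\<lambda>p. snd (snd p)"] by (simp add: continuous_on_snd continuous_on_id)
qed

sublocale visits: service_visit M i "W n i" "A n i" "F n i" "\<tau> n i" for n i
  by (rule visit)

sublocale switches: subordinator_process M "V n i" for n i
  by unfold_locales (rule switch_input)

abbreviation "H n i \<equiv> offspring i (W n i) (A n i) (\<tau> n i)"
abbreviation "H' n i \<equiv> offspring_limit i (W n i) (A n i) (\<tau> n i)"

lemma measurable_H': "0 \<le> x \<Longrightarrow> H' n i x \<in> borel_measurable (known {Visit n i})"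
  by (intro measurable_offspring_limit measurable_visit)

lemma distr_H:
  assumes "0 \<le> x"
  shows "distr M borel (H n i x) = distr M borel (H 0 i x)"
  using visits.distr_children[OF assms, of i n] visits.distr_children[OF assms, of i 0] visit_copies[of n i] by simp

lemma distr_V:
  assumes "0 \<le> t"
  shows "distr M borel (V n i t) = distr M borel (V 0 i t)"
proof -
  have "distr M borel (V n i t) = distr (process_law M (V n i)) borel (\<lambda>p. p t)" for n
  proof -
    have "(\<lambda>\<omega>. \<lambda>t\<in>{0..}. V n i t \<omega>) \<in> M \<rightarrow>\<^sub>M (\<Pi>\<^sub>M t\<in>{0..}. borel)"
      by (intro measurable_restrict switches.measurable_X) simp
    then show ?thesis
      unfolding process_law_def using assms
      by (subst distr_distr) (auto simp: comp_def intro!: measurable_component_singleton)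
  qed
  from this[of n] this[of 0] show ?thesis using switch_input_copies[of n i] by simp
qed

definition "immigration n i \<omega> = V n i (S n i \<omega>) \<omega>"
text \<open>A version measurable for the two switch-over sources; \<open>max 0\<close> accounts for
  a duration that is positive only almost surely.\<close>

definition "immigration' n i \<omega> = right_eval (V n i) (max 0 (S n i \<omega>)) \<omega>"
abbreviation "switch_sources n i \<equiv> {Switch_Input n i, Switch_Duration n i}"

lemma AE_immigration: "AE \<omega> in M. immigration n i \<omega> = immigration' n i \<omega>"
proof -
  have "AE \<omega> in M. V n i (max 0 (S n i \<omega>)) \<omega> = immigration' n i \<omega>"
    unfolding immigration'_def
    by (rule switches.AE_right_eval[where X'="V n i" and T="\<lambda>\<omega>. max 0 (S n i \<omega>)", OF indep_known[of "{Switch_Duration n i}" "{Switch_Input n i}"]])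
      (auto intro!: measurable_switch borel_measurable_max measurable_duration)
  then show ?thesis
    using duration_pos[of n i] by eventually_elim (simp add: immigration_def max_def)
qed

lemma measurable_immigration': "immigration' n i \<in> borel_measurable (known (switch_sources n i))"
  unfolding immigration'_def
  by (intro measurable_right_eval borel_measurable_max)
    (auto intro: measurable_known_mono[OF measurable_switch] measurable_known_mono[OF measurable_duration])

lemma measurable_immigration: "immigration n i \<in> borel_measurable M"
  by (rule borel_measurable_AE_eq[OF measurable_known_M[OF measurable_immigration'] AE_immigration])

lemma AE_immigration_nonneg: "AE \<omega> in M. 0 \<le> immigration n i \<omega>"
  using switches.AE_nonneg[of n i] duration_pos[of n i] by eventually_elim (simp add: immigration_def)

text \<open>Freezing the duration reduces the law to the marginal laws of \<open>V n i\<close> at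
  fixed times and of \<open>S n i\<close>, none of which depends on \<open>n\<close>.\<close>

lemma nn_integral_immigration:
  assumes f: "f \<in> borel_measurable borel"
  shows "(\<integral>\<^sup>+\<omega>. f (immigration n i \<omega>) \<partial>M) = (\<integral>\<^sup>+\<omega>'. \<integral>\<^sup>+\<omega>. f (V 0 i (max 0 (S 0 i \<omega>')) \<omega>) \<partial>M \<partial>M)"
proof -
  have rm [measurable]: "(\<lambda>p. right_eval (V 0 i) (max 0 (fst p)) (snd p)) \<in> borel_measurable (borel \<Otimes>\<^sub>M M)"
    by (rule measurable_right_eval_pair) auto
  note [measurable] = f
  have fm: "(\<lambda>s. \<integral>\<^sup>+\<omega>. f (right_eval (V 0 i) (max 0 s) \<omega>) \<partial>M) \<in> borel_measurable borel"
    by measurable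
  have inner: "(\<integral>\<^sup>+\<omega>. f (V n i t \<omega>) \<partial>M) = (\<integral>\<^sup>+\<omega>. f (right_eval (V 0 i) t \<omega>) \<partial>M)" if t: "0 \<le> t" for n t
  proof -
    have "(\<integral>\<^sup>+\<omega>. f (V n i t \<omega>) \<partial>M) = (\<integral>\<^sup>+\<omega>. f (V 0 i t \<omega>) \<partial>M)"
      by (rule nn_integral_distr_eq[OF distr_V[OF t]]) (use t f in auto)
    also have "\<dots> = (\<integral>\<^sup>+\<omega>. f (right_eval (V 0 i) t \<omega>) \<partial>M)"
      by (rule nn_integral_cong_AE, use switches.AE_right_eval_const[OF t, where n=0 and i=i] in eventually_elim) simp
    finally show ?thesis .
  qed
  have eq: "(\<integral>\<^sup>+\<omega>. f (immigration n i \<omega>) \<partial>M) = (\<integral>\<^sup>+\<omega>'. \<integral>\<^sup>+\<omega>. f (right_eval (V 0 i) (max 0 (S n i \<omega>')) \<omega>) \<partial>M \<partial>M)" for n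
  proof -
    have "(\<integral>\<^sup>+\<omega>. f (immigration n i \<omega>) \<partial>M) = (\<integral>\<^sup>+\<omega>. (\<lambda>p. f (snd p)) ((), V n i (max 0 (S n i \<omega>)) \<omega>) \<partial>M)"
    proof (rule nn_integral_cong_AE, use duration_pos[of n i] in eventually_elim)
      case (elim \<omega>)
      then have "max 0 (S n i \<omega>) = S n i \<omega>" by simp
      then show ?case by (simp add: immigration_def)
    qed
    also have "\<dots> = (\<integral>\<^sup>+\<omega>'. \<integral>\<^sup>+\<omega>. (\<lambda>p. f (snd p)) ((), V n i (max 0 (S n i \<omega>')) \<omega>) \<partial>M \<partial>M)"
      by (rule switches.nn_integral_independent_time[where X'="V n i" and T="\<lambda>\<omega>. max 0 (S n i \<omega>)" and U="\<lambda>_. ()"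
            and K="count_space UNIV", OF indep_known[of "{Switch_Duration n i}" "{Switch_Input n i}"]])
        (auto intro!: measurable_switch borel_measurable_max measurable_duration)
    also have "\<dots> = (\<integral>\<^sup>+\<omega>'. \<integral>\<^sup>+\<omega>. f (right_eval (V 0 i) (max 0 (S n i \<omega>')) \<omega>) \<partial>M \<partial>M)"
      by (simp add: inner)
    finally show ?thesis .
  qed
  have "(\<integral>\<^sup>+\<omega>'. \<integral>\<^sup>+\<omega>. f (right_eval (V 0 i) (max 0 (S n i \<omega>')) \<omega>) \<partial>M \<partial>M) =
      (\<integral>\<^sup>+\<omega>'. \<integral>\<^sup>+\<omega>. f (right_eval (V 0 i) (max 0 (S 0 i \<omega>')) \<omega>) \<partial>M \<partial>M)"
    by (rule nn_integral_distr_eq[OF duration_copies duration_measurable duration_measurable fm])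
  then show ?thesis unfolding eq by (simp add: inner)
qed

lemma nn_integral_immigration_eq:
  "f \<in> borel_measurable borel \<Longrightarrow> (\<integral>\<^sup>+\<omega>. f (immigration n i \<omega>) \<partial>M) = (\<integral>\<^sup>+\<omega>. f (immigration 0 i \<omega>) \<partial>M)"
  by (simp add: nn_integral_immigration)

text \<open>A process evaluated at an independent random time is only almost surely equal to a functional
  of the sources involved; hence the null sets.\<close>

definition determined :: "'n source set \<Rightarrow> ('a \<Rightarrow> (real, 'n) vec) \<Rightarrow> bool" where
  "determined J X \<longleftrightarrow> (\<exists>X'. X' \<in> borel_measurable (known J) \<and> (\<forall>\<omega>. 0 \<le> X' \<omega>) \<and> (AE \<omega> in M. X \<omega> = X' \<omega>))"

lemma determinedI:
  assumes "X' \<in> borel_measurable (known J)" "AE \<omega> in M. X \<omega> = X' \<omega>" "AE \<omega> in M. 0 \<le> X \<omega>"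
  shows "determined J X"
  unfolding determined_def
proof (intro exI conjI allI)
  \<comment> \<open>Positive parts make the representative nonnegative everywhere, so that its
    coordinates can serve as time indices.\<close>
  let ?X = "\<lambda>\<omega>. \<chi> j. max 0 (X' \<omega> $ j)"
  show "?X \<in> borel_measurable (known J)"
    by (rule measurable_vecI, unfold vec_lambda_beta)
      (intro borel_measurable_max borel_measurable_const measurable_vec_nth assms(1))
  show "0 \<le> ?X \<omega>" for \<omega> by (simp add: less_eq_vec_def)
  show "AE \<omega> in M. X \<omega> = ?X \<omega>"
    using assms(2,3) by eventually_elim (auto simp: less_eq_vec_def vec_eq_iff max_def)
qed

lemma determined_measurable: "determined J X \<Longrightarrow> X \<in> borel_measurable M"
  unfolding determined_def using borel_measurable_AE_eq measurable_known_M by blast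

lemma determined_nonneg: "determined J X \<Longrightarrow> AE \<omega> in M. 0 \<le> X \<omega>"
  unfolding determined_def by auto

text \<open>The recursion of \<open>workload\<close> in the form of branching with immigration: the
  content of queue \<open>i\<close> is replaced by its offspring, which already include what is left
  of that content, and the switch-over input immigrates.\<close>

definition step :: "nat \<Rightarrow> 'n \<Rightarrow> (real, 'n) vec \<Rightarrow> 'a \<Rightarrow> (real, 'n) vec" where
  "step n i x \<omega> = off i x + H n i (x $ i) \<omega> + immigration n i \<omega>"

lemma step_eq: "step n i x \<omega> = x + work_process i (W n i) (A n i) (\<tau> n i (x $ i) \<omega>) \<omega> + V n i (S n i \<omega>) \<omega>"
  by (simp add: step_def offspring_def immigration_def off_def vec_eq_iff axis_def)

abbreviation "step_sources n i \<equiv> insert (Visit n i) (switch_sources n i)"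

text \<open>The transition operator of a step, acting on test functions. The separate integrals
  express the independence of offspring and immigration, and index 0 that all cycles share the
  operator. \<open>right_eval\<close> and \<open>max 0\<close> make it measurable on all vectors; on
  nonnegative ones \<open>kernel_eq\<close> gives the plain form.\<close>

definition kernel :: "'n \<Rightarrow> ((real, 'n) vec \<Rightarrow> ennreal) \<Rightarrow> (real, 'n) vec \<Rightarrow> ennreal" where
  "kernel i f x = (\<integral>\<^sup>+\<omega>'. \<integral>\<^sup>+\<omega>. f (off i x + right_eval (H 0 i) (max 0 (x $ i)) \<omega> + immigration 0 i \<omega>') \<partial>M \<partial>M)"

lemma measurable_right_eval_H:
  "(\<lambda>p. right_eval (H 0 i) (max 0 (fst p $ i)) (snd p)) \<in> borel_measurable (borel \<Otimes>\<^sub>M M)"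
  by (rule measurable_right_eval_pair) (auto intro!: borel_measurable_max measurable_vec_nth)

lemma measurable_kernel_inner:
  assumes [measurable]: "f \<in> borel_measurable borel"
  shows "(\<lambda>p. \<integral>\<^sup>+\<omega>. f (off i (fst p) + right_eval (H 0 i) (max 0 (fst p $ i)) \<omega> + snd p) \<partial>M) \<in> borel_measurable (borel \<Otimes>\<^sub>M borel)"
proof -
  note [measurable] = measurable_off
  have [measurable]: "(\<lambda>q. right_eval (H 0 i) (max 0 (fst (fst q) $ i)) (snd q)) \<in>
      borel_measurable ((borel \<Otimes>\<^sub>M borel) \<Otimes>\<^sub>M M)"
    using measurable_compose[OF _ measurable_right_eval_H, of "\<lambda>q. (fst (fst q), snd q)" "(borel \<Otimes>\<^sub>M borel) \<Otimes>\<^sub>M M" i]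
    by simp
  show ?thesis by measurable
qed

lemma measurable_kernel:
  assumes f: "f \<in> borel_measurable borel"
  shows "kernel i f \<in> borel_measurable borel"
proof -
  note [measurable] = measurable_kernel_inner[OF f, of i] measurable_immigration
  have "(\<lambda>q. (\<lambda>p. \<integral>\<^sup>+\<omega>. f (off i (fst p) + right_eval (H 0 i) (max 0 (fst p $ i)) \<omega> + snd p) \<partial>M) (fst q, immigration 0 i (snd q)))
     \<in> borel_measurable (borel \<Otimes>\<^sub>M M)"
    by (rule measurable_compose[OF _ measurable_kernel_inner[OF f, of i]]) measurable
  then have [measurable]: "(\<lambda>q. \<integral>\<^sup>+\<omega>. f (off i (fst q) + right_eval (H 0 i) (max 0 (fst q $ i)) \<omega> + immigration 0 i (snd q)) \<partial>M)
     \<in> borel_measurable (borel \<Otimes>\<^sub>M M)" by simp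
  have "(\<lambda>x. \<integral>\<^sup>+\<omega>'. (\<lambda>q. \<integral>\<^sup>+\<omega>. f (off i (fst q) + right_eval (H 0 i) (max 0 (fst q $ i)) \<omega> + immigration 0 i (snd q)) \<partial>M) (x, \<omega>') \<partial>M)
     \<in> borel_measurable borel"
    by measurable
  then show ?thesis by (simp add: kernel_def[abs_def])
qed

lemma nn_integral_H:
  assumes t: "0 \<le> t" and f: "f \<in> borel_measurable borel"
  shows "(\<integral>\<^sup>+\<omega>. f (H n i t \<omega>) \<partial>M) = (\<integral>\<^sup>+\<omega>. f (right_eval (H 0 i) t \<omega>) \<partial>M)"
proof -
  have "(\<integral>\<^sup>+\<omega>. f (H n i t \<omega>) \<partial>M) = (\<integral>\<^sup>+\<omega>. f (H 0 i t \<omega>) \<partial>M)"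
    by (rule nn_integral_distr_eq[OF distr_H[OF t]]) (use t f in auto)
  also have "\<dots> = (\<integral>\<^sup>+\<omega>. f (right_eval (H 0 i) t \<omega>) \<partial>M)"
    by (rule nn_integral_cong_AE, use visits.children.AE_right_eval_const[OF t, where n=0 and i=i] in eventually_elim) simp
  finally show ?thesis .
qed

lemma kernel_eq:
  assumes x: "0 \<le> x" and f: "f \<in> borel_measurable borel"
  shows "kernel i f x = (\<integral>\<^sup>+\<omega>'. \<integral>\<^sup>+\<omega>. f (off i x + H 0 i (x $ i) \<omega> + immigration 0 i \<omega>') \<partial>M \<partial>M)"
proof -
  note [measurable] = f
  have xi: "0 \<le> x $ i" using x by (simp add: less_eq_vec_def)
  have "(\<integral>\<^sup>+\<omega>. f (off i x + H 0 i (x $ i) \<omega> + y) \<partial>M) = (\<integral>\<^sup>+\<omega>. f (off i x + right_eval (H 0 i) (x $ i) \<omega> + y) \<partial>M)" for y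
    by (rule nn_integral_H[OF xi, where f="\<lambda>h. f (off i x + h + y)"]) measurable
  then show ?thesis using xi by (simp add: kernel_def)
qed

text \<open>The visit is independent of the arriving workload and the switch-over sources jointly,
  so its process may be evaluated at a frozen amount; a second use of independence separates the
  workload from the immigration. The passage to cycle 0 takes place in the inner integrals, where
  the arguments are fixed and marginal laws suffice.\<close>

lemma step_determined:
  assumes X: "determined J X" and disj: "step_sources n i \<inter> J = {}"
  shows "determined (J \<union> step_sources n i) (\<lambda>\<omega>. step n i (X \<omega>) \<omega>)"
    and "f \<in> borel_measurable borel \<Longrightarrow> (\<integral>\<^sup>+\<omega>. f (step n i (X \<omega>) \<omega>) \<partial>M) = (\<integral>\<^sup>+\<omega>. kernel i f (X \<omega>) \<partial>M)"
proof -
  obtain X' where X': "X' \<in> borel_measurable (known J)" "\<And>\<omega>. 0 \<le> X' \<omega>" "AE \<omega> in M. X \<omega> = X' \<omega>"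
    using X unfolding determined_def by blast
  have X'i: "0 \<le> X' \<omega> $ i" for \<omega> using X'(2)[of \<omega>] by (simp add: less_eq_vec_def)
  let ?J = "J \<union> switch_sources n i"
  have m1: "X' \<in> borel_measurable (known ?J)" "immigration' n i \<in> borel_measurable (known ?J)"
    using measurable_known_mono[OF X'(1), of ?J] measurable_known_mono[OF measurable_immigration', of n i ?J] by auto
  have m1i: "(\<lambda>\<omega>. X' \<omega> $ i) \<in> borel_measurable (known ?J)"
    by (rule measurable_vec_nth[OF m1(1)])
  have indep: "indep_set (sets (known ?J)) (sets (known {Visit n i}))"
    by (rule indep_known) (use disj in auto)
  have ae: "AE \<omega> in M. H n i (X' \<omega> $ i) \<omega> = right_eval (H' n i) (X' \<omega> $ i) \<omega>"
    by (rule visits.children.AE_right_eval[OF indep])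
      (use m1i X'i measurable_H' visits.AE_offspring_limit in auto)
  show "determined (J \<union> step_sources n i) (\<lambda>\<omega>. step n i (X \<omega>) \<omega>)"
  proof (rule determinedI)
    define K where "K = J \<union> step_sources n i"
    have K: "J \<subseteq> K" "switch_sources n i \<subseteq> K" "{Visit n i} \<subseteq> K" by (auto simp: K_def)
    have [measurable]: "X' \<in> borel_measurable (known K)" "immigration' n i \<in> borel_measurable (known K)"
      by (rule measurable_known_mono[OF X'(1) K(1)], rule measurable_known_mono[OF measurable_immigration' K(2)])
    have [measurable]: "(\<lambda>\<omega>. right_eval (H' n i) (X' \<omega> $ i) \<omega>) \<in> borel_measurable (known K)"
      by (rule measurable_right_eval[OF measurable_known_mono[OF measurable_H' K(3)]]) (auto intro!: measurable_vec_nth)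
    note [measurable] = measurable_off
    have "(\<lambda>\<omega>. off i (X' \<omega>) + right_eval (H' n i) (X' \<omega> $ i) \<omega> + immigration' n i \<omega>) \<in> borel_measurable (known K)"
      by measurable
    then show "(\<lambda>\<omega>. off i (X' \<omega>) + right_eval (H' n i) (X' \<omega> $ i) \<omega> + immigration' n i \<omega>) \<in> borel_measurable (known (J \<union> step_sources n i))"
      by (simp only: K_def)
    show "AE \<omega> in M. step n i (X \<omega>) \<omega> = off i (X' \<omega>) + right_eval (H' n i) (X' \<omega> $ i) \<omega> + immigration' n i \<omega>"
      using X'(3) ae AE_immigration[of n i] by eventually_elim (simp add: step_def)
    show "AE \<omega> in M. 0 \<le> step n i (X \<omega>) \<omega>"
      using X'(3) visits.children.AE_nonneg[of i n] AE_immigration_nonneg[of n i]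
    proof eventually_elim
      case (elim \<omega>)
      have "0 \<le> off i (X' \<omega>)" using X'(2)[of \<omega>] by (simp add: off_def less_eq_vec_def)
      then show ?case using elim X'i[of \<omega>] by (simp add: step_def add_nonneg_nonneg)
    qed
  qed
  assume f: "f \<in> borel_measurable borel"
  note [measurable] = f measurable_off
  let ?phi = "\<lambda>p. \<integral>\<^sup>+\<omega>. f (off i (fst p) + right_eval (H 0 i) (max 0 (fst p $ i)) \<omega> + snd p) \<partial>M"
  note phi [measurable] = measurable_kernel_inner[OF f, of i]
  have "(\<integral>\<^sup>+\<omega>. f (step n i (X \<omega>) \<omega>) \<partial>M) =
      (\<integral>\<^sup>+\<omega>. (\<lambda>p. f (off i (fst (fst p)) + snd p + snd (fst p))) ((X' \<omega>, immigration' n i \<omega>), H n i (X' \<omega> $ i) \<omega>) \<partial>M)"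
    by (rule nn_integral_cong_AE, use X'(3) AE_immigration[of n i] in eventually_elim) (simp add: step_def)
  also have "\<dots> = (\<integral>\<^sup>+\<omega>'. \<integral>\<^sup>+\<omega>. (\<lambda>p. f (off i (fst (fst p)) + snd p + snd (fst p))) ((X' \<omega>', immigration' n i \<omega>'), H n i (X' \<omega>' $ i) \<omega>) \<partial>M \<partial>M)"
    by (rule visits.children.nn_integral_independent_time[OF indep, where X'="H' n i" and K="borel \<Otimes>\<^sub>M borel"])
      (use m1 m1i X'i measurable_H' visits.AE_offspring_limit in auto)
  also have "\<dots> = (\<integral>\<^sup>+\<omega>'. ?phi (X' \<omega>', immigration' n i \<omega>') \<partial>M)"
  proof (rule nn_integral_cong)
    fix \<omega>'
    have "(\<integral>\<^sup>+\<omega>. (\<lambda>h. f (off i (X' \<omega>') + h + immigration' n i \<omega>')) (H n i (X' \<omega>' $ i) \<omega>) \<partial>M) =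
        (\<integral>\<^sup>+\<omega>. (\<lambda>h. f (off i (X' \<omega>') + h + immigration' n i \<omega>')) (right_eval (H 0 i) (X' \<omega>' $ i) \<omega>) \<partial>M)"
      by (rule nn_integral_H[OF X'i]) measurable
    then show "(\<integral>\<^sup>+\<omega>. (\<lambda>p. f (off i (fst (fst p)) + snd p + snd (fst p))) ((X' \<omega>', immigration' n i \<omega>'), H n i (X' \<omega>' $ i) \<omega>) \<partial>M) =
        ?phi (X' \<omega>', immigration' n i \<omega>')"
      using X'i[of \<omega>'] by simp
  qed
  also have "\<dots> = (\<integral>\<^sup>+\<omega>'. (\<lambda>q. ?phi (X' (fst q), immigration' n i (snd q))) (\<omega>', \<omega>') \<partial>M)" by simp
  also have "\<dots> = (\<integral>\<^sup>+\<omega>'. \<integral>\<^sup>+\<omega>. (\<lambda>q. ?phi (X' (fst q), immigration' n i (snd q))) (\<omega>', \<omega>) \<partial>M \<partial>M)"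
  proof (rule nn_integral_indep_pair)
    show "indep_set (sets (known J)) (sets (known (switch_sources n i)))"
      by (rule indep_known) (use disj in auto)
    note [measurable] = X'(1) measurable_immigration'[of n i]
    show "(\<lambda>q. ?phi (X' (fst q), immigration' n i (snd q))) \<in> borel_measurable (known J \<Otimes>\<^sub>M known (switch_sources n i))"
      by (rule measurable_compose[OF _ phi]) measurable
  qed simp_all
  also have "\<dots> = (\<integral>\<^sup>+\<omega>'. kernel i f (X' \<omega>') \<partial>M)"
  proof (rule nn_integral_cong)
    fix \<omega>'
    have pm: "(\<lambda>y. ?phi (X' \<omega>', y)) \<in> borel_measurable borel"
      by (rule measurable_compose[OF _ phi]) measurable
    have "(\<integral>\<^sup>+\<omega>. ?phi (X' \<omega>', immigration' n i \<omega>) \<partial>M) = (\<integral>\<^sup>+\<omega>. ?phi (X' \<omega>', immigration n i \<omega>) \<partial>M)"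
      by (rule nn_integral_cong_AE, use AE_immigration[of n i] in eventually_elim) simp
    also have "\<dots> = (\<integral>\<^sup>+\<omega>. ?phi (X' \<omega>', immigration 0 i \<omega>) \<partial>M)"
      by (rule nn_integral_immigration_eq[OF pm])
    finally show "(\<integral>\<^sup>+\<omega>. (\<lambda>q. ?phi (X' (fst q), immigration' n i (snd q))) (\<omega>', \<omega>) \<partial>M) = kernel i f (X' \<omega>')"
      by (simp add: kernel_def)
  qed
  also have "\<dots> = (\<integral>\<^sup>+\<omega>. kernel i f (X \<omega>) \<partial>M)"
    by (rule nn_integral_cong_AE, use X'(3) in eventually_elim) simp
  finally show "(\<integral>\<^sup>+\<omega>. f (step n i (X \<omega>) \<omega>) \<partial>M) = (\<integral>\<^sup>+\<omega>. kernel i f (X \<omega>) \<partial>M)" .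
qed

end

lemma incseq_vec_convergent:
  fixes D :: "nat \<Rightarrow> real ^ 'n"
  assumes inc: "\<And>n. D n \<le> D (Suc n)" and bd: "\<And>n j. D n $ j \<le> b"
  obtains L where "D \<longlonglongrightarrow> L"
proof -
  have "\<exists>l. (\<lambda>n. D n $ j) \<longlonglongrightarrow> l" for j
  proof (rule incseq_convergent)
    show "incseq (\<lambda>n. D n $ j)"
      by (rule incseq_SucI) (use inc in \<open>simp add: less_eq_vec_def\<close>)
    show "\<forall>n. D n $ j \<le> b" using bd by simp
  qed blast
  then obtain l where "\<And>j. (\<lambda>n. D n $ j) \<longlonglongrightarrow> l j" by metis
  then have "D \<longlonglongrightarrow> (\<chi> j. l j)" by (intro vec_tendstoI) simp
  then show ?thesis by (rule that)
qed

lemma inner_pos_component: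
  fixes v x :: "real ^ 'n"
  assumes "\<And>j. 0 < v $ j" "0 \<le> x"
  shows "v $ j * x $ j \<le> v \<bullet> x"
  unfolding inner_vec_def
  using member_le_sum[of j UNIV "\<lambda>j. v $ j * x $ j"] assms
  by (simp add: less_eq_vec_def less_imp_le)

lemma replace_inner: "w \<bullet> off i x + c * x $ i = (\<chi> j. if j = i then c else w $ j) \<bullet> x"
proof -
  have "w \<bullet> off i x + c * x $ i = (\<Sum>j\<in>UNIV. w $ j * (if j = i then 0 else x $ j) + (if j = i then c * x $ j else 0))"
    by (simp add: inner_vec_def off_def sum.distrib)
  also have "\<dots> = (\<chi> j. if j = i then c else w $ j) \<bullet> x"
    unfolding inner_vec_def by (intro sum.cong) auto
  finally show ?thesis .
qed

lemma off_nonneg: "0 \<le> x \<Longrightarrow> 0 \<le> off i x"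
  by (simp add: off_def less_eq_vec_def)

lemma off_mono: "x \<le> y \<Longrightarrow> off i x \<le> off i y"
  by (simp add: off_def less_eq_vec_def)

section \<open>Cycles and their backward composition\<close>

context polling_system begin

definition visit_all :: "nat \<Rightarrow> 'n list \<Rightarrow> (real, 'n) vec \<Rightarrow> 'a \<Rightarrow> (real, 'n) vec" where
  "visit_all n is x \<omega> = fold (\<lambda>i x. step n i x \<omega>) is x"

definition "queues = sorted_list_of_set (UNIV :: 'n set)"

lemma queues: "distinct queues" "set queues = UNIV" "sorted queues"
  by (simp_all add: queues_def)

abbreviation "full_cycle n \<equiv> visit_all n queues"

definition sources :: "nat \<Rightarrow> 'n set \<Rightarrow> 'n source set" where
  "sources n I = (\<Union>i\<in>I. step_sources n i)"

lemma visit_all_simps: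
  "visit_all n [] x \<omega> = x" "visit_all n (i # is) x \<omega> = visit_all n is (step n i x \<omega>) \<omega>"
  by (simp_all add: visit_all_def)

lemma measurable_foldr_kernel: "f \<in> borel_measurable borel \<Longrightarrow> foldr kernel is f \<in> borel_measurable borel"
  by (induction "is") (auto simp: measurable_kernel)

lemma sources_Cons_disjoint:
  assumes "distinct (i # is)" "sources n (set (i # is)) \<inter> J = {}"
  shows "step_sources n i \<inter> J = {}" "sources n (set is) \<inter> (J \<union> step_sources n i) = {}"
  using assms by (auto simp: sources_def)

lemma visit_all_determined:
  "distinct is \<Longrightarrow> determined J X \<Longrightarrow> sources n (set is) \<inter> J = {} \<Longrightarrow>
    determined (J \<union> sources n (set is)) (\<lambda>\<omega>. visit_all n is (X \<omega>) \<omega>)"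
proof (induction "is" arbitrary: J X)
  case Nil
  then show ?case by (simp add: visit_all_simps sources_def)
next
  case (Cons i "is")
  note s = sources_Cons_disjoint[OF Cons.prems(1,3)]
  have "determined ((J \<union> step_sources n i) \<union> sources n (set is)) (\<lambda>\<omega>. visit_all n is (step n i (X \<omega>) \<omega>) \<omega>)"
    by (rule Cons.IH[OF _ step_determined(1)[OF Cons.prems(2) s(1)] s(2)]) (use Cons.prems(1) in simp)
  moreover have "(J \<union> step_sources n i) \<union> sources n (set is) = J \<union> sources n (set (i # is))"
    by (auto simp: sources_def)
  ultimately show ?case by (simp only: visit_all_simps)
qed

lemma nn_integral_visit_all:
  assumes f: "f \<in> borel_measurable borel"
  shows "distinct is \<Longrightarrow> determined J X \<Longrightarrow> sources n (set is) \<inter> J = {} \<Longrightarrow>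
    (\<integral>\<^sup>+\<omega>. f (visit_all n is (X \<omega>) \<omega>) \<partial>M) = (\<integral>\<^sup>+\<omega>. foldr kernel is f (X \<omega>) \<partial>M)"
proof (induction "is" arbitrary: J X)
  case Nil
  then show ?case by (simp add: visit_all_simps)
next
  case (Cons i "is")
  note s = sources_Cons_disjoint[OF Cons.prems(1,3)]
  have "(\<integral>\<^sup>+\<omega>. f (visit_all n is (step n i (X \<omega>) \<omega>) \<omega>) \<partial>M) = (\<integral>\<^sup>+\<omega>. foldr kernel is f (step n i (X \<omega>) \<omega>) \<partial>M)"
    by (rule Cons.IH[OF _ step_determined(1)[OF Cons.prems(2) s(1)] s(2)]) (use Cons.prems(1) in simp)
  also have "\<dots> = (\<integral>\<^sup>+\<omega>. kernel i (foldr kernel is f) (X \<omega>) \<partial>M)"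
    by (rule step_determined(2)[OF Cons.prems(2) s(1) measurable_foldr_kernel[OF f]])
  finally show ?case by (simp add: visit_all_simps)
qed

text \<open>Operators on test functions compose against the order of time: the kernel of the last
  queue acts on the test function first, hence \<open>foldr\<close> here although
  \<open>visit_all\<close> uses \<open>fold\<close>.\<close>

definition "cycle_kernel = foldr kernel queues"
abbreviation "cycle_sources n \<equiv> sources n UNIV"

lemma measurable_cycle_kernel: "f \<in> borel_measurable borel \<Longrightarrow> cycle_kernel f \<in> borel_measurable borel"
  unfolding cycle_kernel_def by (rule measurable_foldr_kernel)

lemma cycle_determined:
  assumes "determined J X" "cycle_sources n \<inter> J = {}"
  shows "determined (J \<union> cycle_sources n) (\<lambda>\<omega>. full_cycle n (X \<omega>) \<omega>)"
  using visit_all_determined[OF queues(1) assms(1), of n] assms(2) by (simp add: queues(2))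

lemma nn_integral_cycle:
  assumes "determined J X" "cycle_sources n \<inter> J = {}" "f \<in> borel_measurable borel"
  shows "(\<integral>\<^sup>+\<omega>. f (full_cycle n (X \<omega>) \<omega>) \<partial>M) = (\<integral>\<^sup>+\<omega>. cycle_kernel f (X \<omega>) \<partial>M)"
  using nn_integral_visit_all[OF assms(3) queues(1) assms(1), of n] assms(2) by (simp add: queues(2) cycle_kernel_def)

abbreviation "B \<equiv> workload S V W A \<tau> B\<^sub>0"

lemma workload_Suc: "B (Suc n) \<omega> = full_cycle n (B n \<omega>) \<omega>"
proof -
  have "(\<lambda>i x. step n i x \<omega>) =
      (\<lambda>i x. x + work_process i (W n i) (A n i) (\<tau> n i (x $ i) \<omega>) \<omega> + V n i (S n i \<omega>) \<omega>)"
    by (intro ext) (rule step_eq)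
  then show ?thesis unfolding visit_all_def queues_def workload.simps by (simp only:)
qed

lemma sources_disjoint: "n \<noteq> m \<Longrightarrow> sources n I \<inter> sources m I' = {}" "Initial \<notin> sources n I"
  by (auto simp: sources_def)

lemma determined_initial: "determined {Initial} B\<^sub>0"
  by (rule determinedI[OF measurable_initial _ initial_nonneg]) simp

lemma cycle_sources_disjoint:
  assumes "m \<notin> K"
  shows "cycle_sources m \<inter> ({Initial} \<union> (\<Union>k\<in>K. cycle_sources k)) = {}"
proof -
  have "cycle_sources m \<inter> cycle_sources k = {}" if "k \<in> K" for k
    using that assms by (intro sources_disjoint) auto
  then show ?thesis using sources_disjoint(2)[of m UNIV] by blast
qed

lemma workload_determined: "determined ({Initial} \<union> (\<Union>m\<in>{..<n}. cycle_sources m)) (B n)"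
proof (induction n)
  case 0
  have "B 0 = B\<^sub>0" by auto
  then show ?case using determined_initial by simp
next
  case (Suc n)
  have "({Initial} \<union> (\<Union>m\<in>{..<n}. cycle_sources m)) \<union> cycle_sources n = {Initial} \<union> (\<Union>m\<in>{..<Suc n}. cycle_sources m)"
    unfolding lessThan_Suc by blast
  moreover have "B (Suc n) = (\<lambda>\<omega>. full_cycle n (B n \<omega>) \<omega>)" by (rule ext) (rule workload_Suc)
  moreover have "determined (({Initial} \<union> (\<Union>m\<in>{..<n}. cycle_sources m)) \<union> cycle_sources n)
      (\<lambda>\<omega>. full_cycle n (B n \<omega>) \<omega>)"
    by (rule cycle_determined[OF Suc.IH cycle_sources_disjoint]) simp
  ultimately show ?case by (simp only:)
qed

lemma nn_integral_workload_Suc: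
  "f \<in> borel_measurable borel \<Longrightarrow> (\<integral>\<^sup>+\<omega>. f (B (Suc n) \<omega>) \<partial>M) = (\<integral>\<^sup>+\<omega>. cycle_kernel f (B n \<omega>) \<partial>M)"
  unfolding workload_Suc by (rule nn_integral_cycle[OF workload_determined cycle_sources_disjoint]) auto

lemma nn_integral_workload:
  "f \<in> borel_measurable borel \<Longrightarrow> (\<integral>\<^sup>+\<omega>. f (B n \<omega>) \<partial>M) = (\<integral>\<^sup>+\<omega>. (cycle_kernel ^^ n) f (B\<^sub>0 \<omega>) \<partial>M)"
proof (induction n arbitrary: f)
  case (Suc n)
  have "(\<integral>\<^sup>+\<omega>. f (B (Suc n) \<omega>) \<partial>M) = (\<integral>\<^sup>+\<omega>. cycle_kernel f (B n \<omega>) \<partial>M)"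
    by (rule nn_integral_workload_Suc[OF Suc.prems])
  also have "\<dots> = (\<integral>\<^sup>+\<omega>. (cycle_kernel ^^ n) (cycle_kernel f) (B\<^sub>0 \<omega>) \<partial>M)"
    by (rule Suc.IH[OF measurable_cycle_kernel[OF Suc.prems]])
  finally show ?case by (simp add: funpow_swap1)
qed simp

text \<open>Composing the random cycle maps in reverse order does not change the law of the workload, but
  makes it increase with the number of cycles when the system starts empty.\<close>

primrec backward :: "nat \<Rightarrow> nat \<Rightarrow> (real, 'n) vec \<Rightarrow> 'a \<Rightarrow> (real, 'n) vec" where
  "backward m 0 x \<omega> = x"
| "backward m (Suc n) x \<omega> = full_cycle m (backward (Suc m) n x \<omega>) \<omega>"

text \<open>Seen from the inside, one more cycle only changes the starting point of the same outer
  composition. This makes successive iterates comparable.\<close>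

lemma backward_Suc: "backward m (Suc n) x \<omega> = backward m n (full_cycle (m + n) x \<omega>) \<omega>"
  by (induction n arbitrary: m) simp_all

lemma backward_determined:
  assumes X: "determined {Initial} X"
  shows "determined ({Initial} \<union> (\<Union>k\<in>{m..<m + n}. cycle_sources k)) (\<lambda>\<omega>. backward m n (X \<omega>) \<omega>)"
proof (induction n arbitrary: m)
  case 0
  then show ?case using X by simp
next
  case (Suc n)
  have "{m..<m + Suc n} = insert m {Suc m..<Suc m + n}" by auto
  then have "({Initial} \<union> (\<Union>k\<in>{Suc m..<Suc m + n}. cycle_sources k)) \<union> cycle_sources m =
      {Initial} \<union> (\<Union>k\<in>{m..<m + Suc n}. cycle_sources k)"
    by auto
  moreover have "determined (({Initial} \<union> (\<Union>k\<in>{Suc m..<Suc m + n}. cycle_sources k)) \<union> cycle_sources m)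
      (\<lambda>\<omega>. full_cycle m (backward (Suc m) n (X \<omega>) \<omega>) \<omega>)"
    by (rule cycle_determined[OF Suc.IH cycle_sources_disjoint]) simp
  ultimately show ?case by (simp only: backward.simps)
qed

lemma nn_integral_backward_Suc:
  assumes "determined {Initial} X" "f \<in> borel_measurable borel"
  shows "(\<integral>\<^sup>+\<omega>. f (backward m (Suc n) (X \<omega>) \<omega>) \<partial>M) = (\<integral>\<^sup>+\<omega>. cycle_kernel f (backward (Suc m) n (X \<omega>) \<omega>) \<partial>M)"
  unfolding backward.simps
  by (rule nn_integral_cycle[OF backward_determined[OF assms(1), of "Suc m" n] cycle_sources_disjoint assms(2)]) simp

lemma nn_integral_backward:
  assumes X: "determined {Initial} X"
  shows "f \<in> borel_measurable borel \<Longrightarrow> (\<integral>\<^sup>+\<omega>. f (backward m n (X \<omega>) \<omega>) \<partial>M) = (\<integral>\<^sup>+\<omega>. (cycle_kernel ^^ n) f (X \<omega>) \<partial>M)"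
proof (induction n arbitrary: m f)
  case (Suc n)
  have "(\<integral>\<^sup>+\<omega>. f (backward m (Suc n) (X \<omega>) \<omega>) \<partial>M) = (\<integral>\<^sup>+\<omega>. cycle_kernel f (backward (Suc m) n (X \<omega>) \<omega>) \<partial>M)"
    by (rule nn_integral_backward_Suc[OF X Suc.prems])
  also have "\<dots> = (\<integral>\<^sup>+\<omega>. (cycle_kernel ^^ n) (cycle_kernel f) (X \<omega>) \<partial>M)"
    by (rule Suc.IH[OF measurable_cycle_kernel[OF Suc.prems]])
  finally show ?case by (simp add: funpow_swap1)
qed simp

lemma measurable_B: "B n \<in> borel_measurable M"
  by (rule determined_measurable[OF workload_determined])

lemma measurable_backward: "determined {Initial} X \<Longrightarrow> (\<lambda>\<omega>. backward m n (X \<omega>) \<omega>) \<in> borel_measurable M"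
  by (rule determined_measurable[OF backward_determined])

text \<open>Both laws come from the \<open>n\<close>-th power of the same operator
  \<open>cycle_kernel\<close> applied at \<open>B\<^sub>0\<close>, whichever cycle acts
  first.\<close>

lemma distr_backward: "distr M borel (B n) = distr M borel (\<lambda>\<omega>. backward 0 n (B\<^sub>0 \<omega>) \<omega>)"
proof (rule measure_eqI)
  fix E assume "E \<in> sets (distr M borel (B n))"
  then have E: "E \<in> sets borel" by simp
  have "emeasure (distr M borel (B n)) E = (\<integral>\<^sup>+\<omega>. indicator E (B n \<omega>) \<partial>M)"
    using E by (subst nn_integral_distr[OF measurable_B, symmetric]) auto
  also have "\<dots> = (\<integral>\<^sup>+\<omega>. indicator E (backward 0 n (B\<^sub>0 \<omega>) \<omega>) \<partial>M)"
    using E by (simp add: nn_integral_workload nn_integral_backward[OF determined_initial])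
  also have "\<dots> = emeasure (distr M borel (\<lambda>\<omega>. backward 0 n (B\<^sub>0 \<omega>) \<omega>)) E"
    using E by (subst nn_integral_distr[OF measurable_backward[OF determined_initial], symmetric]) auto
  finally show "emeasure (distr M borel (B n)) E = emeasure (distr M borel (\<lambda>\<omega>. backward 0 n (B\<^sub>0 \<omega>) \<omega>)) E" .
qed simp

text \<open>Collected so that one null set serves all cycles, queues and amounts; the amounts
  inserted later are random.\<close>

definition "good \<omega> \<longleftrightarrow> (\<forall>n i. 0 \<le> immigration n i \<omega> \<and> (\<forall>s\<ge>0. 0 \<le> H n i s \<omega>) \<and>
    (\<forall>s t. 0 \<le> s \<and> s \<le> t \<longrightarrow> H n i s \<omega> \<le> H n i t \<omega>))"

lemma AE_good: "AE \<omega> in M. good \<omega>"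
  unfolding good_def AE_all_countable AE_conj_iff
  using AE_immigration_nonneg visits.children.AE_nonneg visits.children.AE_mono by blast

lemma good_visit_all:
  assumes "good \<omega>" "0 \<le> x"
  shows "0 \<le> visit_all n is x \<omega>" "x \<le> y \<Longrightarrow> visit_all n is x \<omega> \<le> visit_all n is y \<omega>"
proof -
  have step: "0 \<le> step n i x \<omega>" "x \<le> y \<Longrightarrow> step n i x \<omega> \<le> step n i y \<omega>" if "0 \<le> x" for i x y
  proof -
    have xi: "0 \<le> x $ i" using that by (simp add: less_eq_vec_def)
    show "0 \<le> step n i x \<omega>"
      unfolding step_def using assms(1) xi that by (intro add_nonneg_nonneg off_nonneg) (auto simp: good_def)
    assume "x \<le> y"
    then have "x $ i \<le> y $ i" by (simp add: less_eq_vec_def)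
    then show "step n i x \<omega> \<le> step n i y \<omega>"
      unfolding step_def using assms(1) xi \<open>x \<le> y\<close> by (intro add_mono off_mono) (auto simp: good_def)
  qed
  show "0 \<le> visit_all n is x \<omega>"
    using assms(2) by (induction "is" arbitrary: x) (auto simp: visit_all_simps step)
  show "visit_all n is x \<omega> \<le> visit_all n is y \<omega>" if "x \<le> y"
    using assms(2) that by (induction "is" arbitrary: x y) (auto simp: visit_all_simps step)
qed

lemma good_backward_nonneg: "good \<omega> \<Longrightarrow> 0 \<le> x \<Longrightarrow> 0 \<le> backward m n x \<omega>"
  by (induction n arbitrary: m) (auto intro: good_visit_all)

lemma good_backward_mono: "good \<omega> \<Longrightarrow> 0 \<le> x \<Longrightarrow> x \<le> y \<Longrightarrow> backward m n x \<omega> \<le> backward m n y \<omega>"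
  by (induction n arbitrary: m) (auto intro: good_visit_all good_backward_nonneg)

text \<open>The empty state is the least starting point, and a cycle started from it ends in a
  nonnegative state; the outer maps are monotone.\<close>

lemma good_backward_Suc: "good \<omega> \<Longrightarrow> backward m n 0 \<omega> \<le> backward m (Suc n) 0 \<omega>"
  unfolding backward_Suc by (intro good_backward_mono good_visit_all) auto

end

section \<open>Stability\<close>

text \<open>The sum of all \<open>f n\<close> has finite mean and is therefore almost surely
  finite.\<close>

lemma AE_tendsto_zero_of_summable:
  fixes f :: "nat \<Rightarrow> 'a \<Rightarrow> real"
  assumes [measurable]: "\<And>n. f n \<in> borel_measurable M" and nonneg: "\<And>n. AE \<omega> in M. 0 \<le> f n \<omega>"
    and le: "\<And>n. (\<integral>\<^sup>+\<omega>. ennreal (f n \<omega>) \<partial>M) \<le> ennreal (a n)" and a: "summable a" "\<And>n. 0 \<le> a n"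
  shows "AE \<omega> in M. (\<lambda>n. f n \<omega>) \<longlonglongrightarrow> 0"
proof -
  have "(\<integral>\<^sup>+\<omega>. (\<Sum>n. ennreal (f n \<omega>)) \<partial>M) = (\<Sum>n. \<integral>\<^sup>+\<omega>. ennreal (f n \<omega>) \<partial>M)"
    by (rule nn_integral_suminf) measurable
  also have "\<dots> \<le> (\<Sum>n. ennreal (a n))" by (intro suminf_le le) auto
  also have "\<dots> < \<infinity>" using ennreal_suminf_neq_top[OF a] by (simp add: less_top)
  finally have "AE \<omega> in M. (\<Sum>n. ennreal (f n \<omega>)) \<noteq> \<infinity>"
    by (intro nn_integral_noteq_infinite) (auto simp: less_top)
  moreover have "AE \<omega> in M. \<forall>n. 0 \<le> f n \<omega>" using nonneg by (simp add: AE_all_countable)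
  ultimately show ?thesis
  proof eventually_elim
    case (elim \<omega>)
    have "summable (\<lambda>n. f n \<omega>)"
      by (rule summable_suminf_not_top) (use elim in auto)
    then show ?case by (rule summable_LIMSEQ_zero)
  qed
qed

lemma scaleR_vec_mono:
  fixes v w :: "real ^ 'n"
  shows "w \<le> c *\<^sub>R v \<longleftrightarrow> (\<forall>j. w $ j \<le> c * v $ j)"
  by (simp add: less_eq_vec_def)

section \<open>Mean weights\<close>

context polling_system begin

definition "service_rate i = expectation (\<tau> 0 i 1)"

definition "rates = rate_matrix M (W 0) (A 0)"

lemma rate_eq: "visits.rate i 0 = rates $ i"
  by (simp add: visits.rate_def rates_def rate_matrix_def vec_eq_iff)

lemma H_mean:
  assumes "0 \<le> x"
  shows "integrable M (\<lambda>\<omega>. w \<bullet> H 0 i x \<omega>)"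
    "expectation (\<lambda>\<omega>. w \<bullet> H 0 i x \<omega>) = x * (w $ i + service_rate i * (w \<bullet> rates $ i))"
  using visits.children_mean_service(1)[OF assms, where n=0 and i=i and w=w]
    visits.children_mean[OF assms, where n=0 and i=i and w=w]
  unfolding rate_eq service_rate_def visits.service_rate_def by auto

lemma H_mean_nonneg: "0 \<le> w \<Longrightarrow> 0 \<le> w $ i + service_rate i * (w \<bullet> rates $ i)"
  using visits.children_mean_nonneg[where n=0 and i=i and w=w]
  unfolding rate_eq service_rate_def visits.service_rate_def by auto

lemma service_rate_pos:
  assumes "non_degenerate M (\<tau> 0)"
  shows "0 < service_rate i"
proof -
  obtain x where "0 \<le> x" "\<not> (AE \<omega> in M. \<tau> 0 i x \<omega> = 0)"
    using assms unfolding non_degenerate_def by blast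
  from visits.service_rate_pos[OF this] show ?thesis
    unfolding service_rate_def visits.service_rate_def by auto
qed

text \<open>Adjoint of the mean effect of a visit: weighing the state after a visit to
  \<open>i\<close> by \<open>w\<close> amounts in mean, apart from immigration, to weighing the
  state before it by \<open>next_weight i w\<close>. Weights are therefore carried from the last
  queue back to the first.\<close>

definition next_weight :: "'n \<Rightarrow> (real, 'n) vec \<Rightarrow> (real, 'n) vec" where
  "next_weight i w = (\<chi> j. if j = i then w $ i + service_rate i * (w \<bullet> rates $ i) else w $ j)"

lemma next_weight_nth:
  "next_weight i w $ j = (if j = i then w $ i + service_rate i * (w \<bullet> rates $ i) else w $ j)"
  by (simp add: next_weight_def)

lemma next_weight_nonneg: "0 \<le> w \<Longrightarrow> 0 \<le> next_weight i w"
  using H_mean_nonneg[of w i] by (auto simp: next_weight_def less_eq_vec_def)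

lemma kernel_linear:
  assumes w: "0 \<le> w" and x: "0 \<le> x"
  shows "kernel i (\<lambda>x. ennreal (w \<bullet> x)) x =
    ennreal (next_weight i w \<bullet> x) + (\<integral>\<^sup>+\<omega>. ennreal (w \<bullet> immigration 0 i \<omega>) \<partial>M)"
proof -
  have xi: "0 \<le> x $ i" using x by (simp add: less_eq_vec_def)
  have nn: "0 \<le> next_weight i w \<bullet> x" by (intro inner_nonneg_vec next_weight_nonneg w x)
  have inner: "(\<integral>\<^sup>+\<omega>. ennreal (w \<bullet> (off i x + H 0 i (x $ i) \<omega> + y)) \<partial>M) = ennreal (next_weight i w \<bullet> x + w \<bullet> y)"
    if y: "0 \<le> y" for y
  proof -
    have "(\<integral>\<^sup>+\<omega>. ennreal (w \<bullet> (off i x + H 0 i (x $ i) \<omega> + y)) \<partial>M) = ennreal (\<integral>\<omega>. w \<bullet> (off i x + H 0 i (x $ i) \<omega> + y) \<partial>M)"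
    proof (rule nn_integral_eq_integral)
      show "integrable M (\<lambda>\<omega>. w \<bullet> (off i x + H 0 i (x $ i) \<omega> + y))"
        using H_mean(1)[OF xi] by (simp add: inner_add_right)
      show "AE \<omega> in M. 0 \<le> w \<bullet> (off i x + H 0 i (x $ i) \<omega> + y)"
        using visits.children.AE_nonneg[of i 0]
      proof eventually_elim
        case (elim \<omega>)
        then show ?case using xi y x w by (intro inner_nonneg_vec add_nonneg_nonneg off_nonneg) auto
      qed
    qed
    also have "(\<integral>\<omega>. w \<bullet> (off i x + H 0 i (x $ i) \<omega> + y) \<partial>M) = w \<bullet> off i x + (w $ i + service_rate i * (w \<bullet> rates $ i)) * x $ i + w \<bullet> y"
      using H_mean[OF xi, of w i] by (simp add: inner_add_right prob_space mult.commute)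
    also have "\<dots> = next_weight i w \<bullet> x + w \<bullet> y"
      unfolding replace_inner next_weight_def by simp
    finally show ?thesis .
  qed
  note [measurable] = measurable_immigration
  have "kernel i (\<lambda>x. ennreal (w \<bullet> x)) x = (\<integral>\<^sup>+\<omega>'. ennreal (next_weight i w \<bullet> x) + ennreal (w \<bullet> immigration 0 i \<omega>') \<partial>M)"
    unfolding kernel_eq[OF x, where f="\<lambda>x. ennreal (w \<bullet> x)", simplified]
  proof (rule nn_integral_cong_AE, use AE_immigration_nonneg[of 0 i] in eventually_elim)
    case (elim \<omega>')
    show ?case unfolding inner[OF elim] using nn inner_nonneg_vec[OF w elim] by (rule ennreal_plus)
  qed
  also have "\<dots> = (\<integral>\<^sup>+\<omega>'. ennreal (next_weight i w \<bullet> x) \<partial>M) + (\<integral>\<^sup>+\<omega>. ennreal (w \<bullet> immigration 0 i \<omega>) \<partial>M)"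
    by (rule nn_integral_add) measurable
  finally show ?thesis by (simp add: emeasure_space_1)
qed

lemma mean_step:
  assumes w: "0 \<le> w" and X: "determined J X" "step_sources n i \<inter> J = {}"
  shows "(\<integral>\<^sup>+\<omega>. ennreal (w \<bullet> step n i (X \<omega>) \<omega>) \<partial>M) =
    (\<integral>\<^sup>+\<omega>. ennreal (next_weight i w \<bullet> X \<omega>) \<partial>M) + (\<integral>\<^sup>+\<omega>. ennreal (w \<bullet> immigration 0 i \<omega>) \<partial>M)"
proof -
  note [measurable] = determined_measurable[OF X(1)]
  have "(\<integral>\<^sup>+\<omega>. ennreal (w \<bullet> step n i (X \<omega>) \<omega>) \<partial>M) = (\<integral>\<^sup>+\<omega>. kernel i (\<lambda>x. ennreal (w \<bullet> x)) (X \<omega>) \<partial>M)"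
    by (rule step_determined(2)[OF X, where f="\<lambda>x. ennreal (w \<bullet> x)"]) measurable
  also have "\<dots> = (\<integral>\<^sup>+\<omega>. ennreal (next_weight i w \<bullet> X \<omega>) + (\<integral>\<^sup>+\<omega>. ennreal (w \<bullet> immigration 0 i \<omega>) \<partial>M) \<partial>M)"
    by (rule nn_integral_cong_AE, use determined_nonneg[OF X(1)] in eventually_elim) (rule kernel_linear[OF w])
  also have "\<dots> = (\<integral>\<^sup>+\<omega>. ennreal (next_weight i w \<bullet> X \<omega>) \<partial>M) + (\<integral>\<^sup>+\<omega>. (\<integral>\<^sup>+\<omega>. ennreal (w \<bullet> immigration 0 i \<omega>) \<partial>M) \<partial>M)"
    by (rule nn_integral_add) measurable
  finally show ?thesis by (simp add: emeasure_space_1)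
qed

text \<open>What immigrates after queue \<open>i\<close> still undergoes the visits to the rest of
  the list, hence the weight \<open>foldr next_weight is w\<close>. The values are in
  \<open>ennreal\<close> because finiteness has to wait for the comparison with
  \<open>G\<close>.\<close>

primrec immigration_mean :: "'n list \<Rightarrow> (real, 'n) vec \<Rightarrow> ennreal" where
  "immigration_mean [] w = 0"
| "immigration_mean (i # is) w = (\<integral>\<^sup>+\<omega>. ennreal (foldr next_weight is w \<bullet> immigration 0 i \<omega>) \<partial>M) + immigration_mean is w"

lemma weights_nonneg: "0 \<le> w \<Longrightarrow> 0 \<le> foldr next_weight is w"
  by (induction "is") (auto intro: next_weight_nonneg)

lemma mean_visit_all:
  assumes w: "0 \<le> w"
  shows "distinct is \<Longrightarrow> determined J X \<Longrightarrow> sources n (set is) \<inter> J = {} \<Longrightarrow>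
    (\<integral>\<^sup>+\<omega>. ennreal (w \<bullet> visit_all n is (X \<omega>) \<omega>) \<partial>M) =
    (\<integral>\<^sup>+\<omega>. ennreal (foldr next_weight is w \<bullet> X \<omega>) \<partial>M) + immigration_mean is w"
proof (induction "is" arbitrary: J X)
  case Nil
  then show ?case by (simp add: visit_all_simps)
next
  case (Cons i "is")
  note s = sources_Cons_disjoint[OF Cons.prems(1,3)]
  have "(\<integral>\<^sup>+\<omega>. ennreal (w \<bullet> visit_all n is (step n i (X \<omega>) \<omega>) \<omega>) \<partial>M) =
      (\<integral>\<^sup>+\<omega>. ennreal (foldr next_weight is w \<bullet> step n i (X \<omega>) \<omega>) \<partial>M) + immigration_mean is w"
    by (rule Cons.IH[OF _ step_determined(1)[OF Cons.prems(2) s(1)] s(2)]) (use Cons.prems(1) in simp)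
  also have "(\<integral>\<^sup>+\<omega>. ennreal (foldr next_weight is w \<bullet> step n i (X \<omega>) \<omega>) \<partial>M) =
      (\<integral>\<^sup>+\<omega>. ennreal (next_weight i (foldr next_weight is w) \<bullet> X \<omega>) \<partial>M) + (\<integral>\<^sup>+\<omega>. ennreal (foldr next_weight is w \<bullet> immigration 0 i \<omega>) \<partial>M)"
    by (rule mean_step[OF weights_nonneg[OF w] Cons.prems(2) s(1)])
  finally show ?case by (simp add: visit_all_simps add.assoc)
qed

abbreviation "cycle_weight \<equiv> foldr next_weight queues"

text \<open>What the switch-over input of a cycle leaves at its end is the state reached from the
  empty system. Its transform will turn out to be the one prescribed for \<open>G\<close>.\<close>

definition "cycle_input w = (\<integral>\<^sup>+\<omega>. ennreal (w \<bullet> full_cycle 0 0 \<omega>) \<partial>M)"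

lemma determined_zero: "determined J (\<lambda>_. 0)"
  by (rule determinedI[where X'="\<lambda>_. 0"]) auto

lemma mean_cycle:
  assumes w: "0 \<le> w" and X: "determined J X" "cycle_sources n \<inter> J = {}"
  shows "(\<integral>\<^sup>+\<omega>. ennreal (w \<bullet> full_cycle n (X \<omega>) \<omega>) \<partial>M) = (\<integral>\<^sup>+\<omega>. ennreal (cycle_weight w \<bullet> X \<omega>) \<partial>M) + cycle_input w"
proof -
  have "cycle_input w = immigration_mean queues w"
    using mean_visit_all[OF w queues(1) determined_zero[of "{}"], of 0] by (simp add: cycle_input_def)
  then show ?thesis
    using mean_visit_all[OF w queues(1) X(1), of n] X(2) by (simp add: queues(2))
qed

primrec total_input :: "nat \<Rightarrow> (real, 'n) vec \<Rightarrow> ennreal" where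
  "total_input 0 w = 0"
| "total_input (Suc n) w = total_input n (cycle_weight w) + cycle_input w"

lemma mean_backward:
  assumes X: "determined {Initial} X"
  shows "0 \<le> w \<Longrightarrow> (\<integral>\<^sup>+\<omega>. ennreal (w \<bullet> backward m n (X \<omega>) \<omega>) \<partial>M) =
    (\<integral>\<^sup>+\<omega>. ennreal ((cycle_weight ^^ n) w \<bullet> X \<omega>) \<partial>M) + total_input n w"
proof (induction n arbitrary: m w)
  case (Suc n)
  have "(\<integral>\<^sup>+\<omega>. ennreal (w \<bullet> full_cycle m (backward (Suc m) n (X \<omega>) \<omega>) \<omega>) \<partial>M) =
      (\<integral>\<^sup>+\<omega>. ennreal (cycle_weight w \<bullet> backward (Suc m) n (X \<omega>) \<omega>) \<partial>M) + cycle_input w"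
    by (rule mean_cycle[OF Suc.prems backward_determined[OF X, of "Suc m" n] cycle_sources_disjoint]) simp
  also have "(\<integral>\<^sup>+\<omega>. ennreal (cycle_weight w \<bullet> backward (Suc m) n (X \<omega>) \<omega>) \<partial>M) =
      (\<integral>\<^sup>+\<omega>. ennreal ((cycle_weight ^^ n) (cycle_weight w) \<bullet> X \<omega>) \<partial>M) + total_input n (cycle_weight w)"
    by (rule Suc.IH[OF weights_nonneg[OF Suc.prems]])
  finally show ?case by (simp add: funpow_swap1 add.assoc)
qed simp

lemma AE_cycle_nonneg: "AE \<omega> in M. 0 \<le> full_cycle n 0 \<omega>"
  using AE_good by eventually_elim (rule good_visit_all, auto)

end

text \<open>Of the eigenvector equation an inequality is kept, with one factor
  \<open>\<theta>\<close> below 1 for all queues; \<open>g\<close> records that the mean input of a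
  cycle is finite.\<close>

locale subcritical_polling_system = polling_system M S V W A F \<tau> B\<^sub>0
  for M :: "'a measure"
    and S :: "nat \<Rightarrow> 'n::{finite,linorder} \<Rightarrow> 'a \<Rightarrow> real"
    and V :: "nat \<Rightarrow> 'n \<Rightarrow> real \<Rightarrow> 'a \<Rightarrow> (real, 'n) vec"
    and W :: "nat \<Rightarrow> 'n \<Rightarrow> real \<Rightarrow> 'a \<Rightarrow> (real, 'n) vec"
    and A :: "nat \<Rightarrow> 'n \<Rightarrow> real \<Rightarrow> 'a \<Rightarrow> real"
    and F :: "nat \<Rightarrow> 'n \<Rightarrow> real \<Rightarrow> 'a measure"
    and \<tau> :: "nat \<Rightarrow> 'n \<Rightarrow> real \<Rightarrow> 'a \<Rightarrow> real"
    and B\<^sub>0 :: "'a \<Rightarrow> (real, 'n) vec" +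
  fixes v :: "(real, 'n) vec" and \<theta> g :: real
  assumes v_pos: "\<And>j. 0 < v $ j" and theta: "0 \<le> \<theta>" "\<theta> < 1"
    and contraction: "\<And>i. v $ i + service_rate i * (v \<bullet> rates $ i) \<le> \<theta> * v $ i"
    and input: "cycle_input v = ennreal g" "0 \<le> g"
begin

lemma v_nonneg: "0 \<le> v"
  using v_pos by (auto simp: less_eq_vec_def less_imp_le)

text \<open>A visit brings the weight of its queue below \<open>c \<theta> v\<close> and leaves the
  other weights alone. Passing from the given weights to \<open>c v\<close> is monotonicity of the
  mean, obtained from \<open>H_mean_nonneg\<close> for the difference.\<close>

lemma weights_contract:
  assumes w: "0 \<le> w" "w \<le> c *\<^sub>R v" and c: "0 \<le> c"
  shows "foldr next_weight is w $ j \<le> (if j \<in> set is then c * \<theta> * v $ j else c * v $ j)"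
proof (induction "is" arbitrary: j)
  case Nil
  then show ?case using w(2) by (simp add: scaleR_vec_mono)
next
  case (Cons i "is")
  let ?w = "foldr next_weight is w"
  have "c * \<theta> * v $ j \<le> c * v $ j" for j
    using theta c v_pos[of j] by (intro mult_right_mono mult_left_le) auto
  then have le: "?w $ j \<le> c * v $ j" for j using Cons.IH[of j] by (auto split: if_splits intro: order_trans)
  have "0 \<le> c *\<^sub>R v - ?w" using le by (simp add: less_eq_vec_def)
  from H_mean_nonneg[OF this, of i]
  have "?w $ i + service_rate i * (?w \<bullet> rates $ i) \<le> c * (v $ i + service_rate i * (v \<bullet> rates $ i))"
    by (simp add: inner_diff_left algebra_simps)
  also have "\<dots> \<le> c * (\<theta> * v $ i)" by (intro mult_left_mono contraction c)
  finally show ?case using Cons.IH[of j] by (auto simp: next_weight_nth algebra_simps)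
qed

lemma cycle_weight_contract:
  assumes "0 \<le> w" "w \<le> c *\<^sub>R v" "0 \<le> c"
  shows "cycle_weight w \<le> (c * \<theta>) *\<^sub>R v"
  using weights_contract[OF assms, of queues] by (simp add: scaleR_vec_mono queues(2))

lemma funpow_cycle_weight:
  "0 \<le> (cycle_weight ^^ n) v \<and> (cycle_weight ^^ n) v \<le> (\<theta> ^ n) *\<^sub>R v"
proof (induction n)
  case (Suc n)
  then show ?case
    using cycle_weight_contract[of "(cycle_weight ^^ n) v" "\<theta> ^ n"] theta weights_nonneg by (simp add: mult.commute)
qed (simp add: v_nonneg)

lemma cycle_input_le:
  assumes w: "0 \<le> w" "w \<le> c *\<^sub>R v" and c: "0 \<le> c"
  shows "cycle_input w \<le> ennreal (c * g)"
proof -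
  have m: "full_cycle 0 0 \<in> borel_measurable M"
    using determined_measurable[OF cycle_determined[OF determined_zero[of "{}"], of 0]] by simp
  have "cycle_input w \<le> (\<integral>\<^sup>+\<omega>. ennreal c * ennreal (v \<bullet> full_cycle 0 0 \<omega>) \<partial>M)"
    unfolding cycle_input_def
  proof (rule nn_integral_mono_AE, use AE_cycle_nonneg[of 0] in eventually_elim)
    case (elim \<omega>)
    have "w \<bullet> full_cycle 0 0 \<omega> \<le> (c *\<^sub>R v) \<bullet> full_cycle 0 0 \<omega>"
      using inner_mono_vec[OF elim w(2)] by (simp only: inner_commute)
    then show ?case using c inner_nonneg_vec[OF v_nonneg elim] by (simp add: ennreal_leI flip: ennreal_mult)
  qed
  also have "\<dots> = ennreal c * cycle_input v"
    unfolding cycle_input_def using m by (intro nn_integral_cmult) measurable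
  also have "\<dots> = ennreal (c * g)" using input c by (simp add: ennreal_mult)
  finally show ?thesis .
qed

text \<open>A geometric series: the bound \<open>c g / (1 - \<theta>)\<close> reproduces itself when
  \<open>c\<close> is replaced by \<open>c \<theta>\<close> and the input \<open>c g\<close> of one
  cycle is added.\<close>

lemma total_input_le: "0 \<le> w \<Longrightarrow> w \<le> c *\<^sub>R v \<Longrightarrow> 0 \<le> c \<Longrightarrow> total_input n w \<le> ennreal (c * g / (1 - \<theta>))"
proof (induction n arbitrary: w c)
  case (Suc n)
  have "total_input (Suc n) w \<le> ennreal (c * \<theta> * g / (1 - \<theta>)) + ennreal (c * g)"
    unfolding total_input.simps using Suc.prems theta
    by (intro add_mono Suc.IH cycle_input_le weights_nonneg cycle_weight_contract) auto
  also have "\<dots> = ennreal (c * \<theta> * g / (1 - \<theta>) + c * g)"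
    using Suc.prems theta input(2) by (intro ennreal_plus[symmetric]) auto
  also have "c * \<theta> * g / (1 - \<theta>) + c * g = c * g / (1 - \<theta>)"
    using theta by (simp add: field_simps)
  finally show ?case .
qed simp

definition "stationary \<omega> = lim (\<lambda>n. backward 0 n 0 \<omega>)"

text \<open>Monotone convergence bounds the mean of the supremum of the weighted iterates. Since
  \<open>v\<close> is strictly positive, finiteness of that supremum bounds every coordinate of the
  increasing iterates.\<close>

lemma AE_stationary: "AE \<omega> in M. (\<lambda>n. backward 0 n 0 \<omega>) \<longlonglongrightarrow> stationary \<omega>"
proof -
  have [measurable]: "backward 0 n 0 \<in> borel_measurable M" for n
    using measurable_backward[OF determined_zero, of 0 n] by simp
  have mean: "(\<integral>\<^sup>+\<omega>. ennreal (v \<bullet> backward 0 n 0 \<omega>) \<partial>M) \<le> ennreal (g / (1 - \<theta>))" for n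
    using mean_backward[OF determined_zero v_nonneg, of 0 n] total_input_le[OF v_nonneg, of 1 n] by simp
  have "(\<integral>\<^sup>+\<omega>. (SUP n. ennreal (v \<bullet> backward 0 n 0 \<omega>)) \<partial>M) = (SUP n. \<integral>\<^sup>+\<omega>. ennreal (v \<bullet> backward 0 n 0 \<omega>) \<partial>M)"
  proof (rule nn_integral_monotone_convergence_SUP_AE)
    fix n
    show "AE \<omega> in M. ennreal (v \<bullet> backward 0 n 0 \<omega>) \<le> ennreal (v \<bullet> backward 0 (Suc n) 0 \<omega>)"
      using AE_good by eventually_elim (intro ennreal_leI inner_mono_vec[OF v_nonneg] good_backward_Suc)
  qed measurable
  also have "\<dots> \<le> ennreal (g / (1 - \<theta>))" by (intro SUP_least mean)
  also have "\<dots> < \<infinity>" by simp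
  finally have "AE \<omega> in M. (SUP n. ennreal (v \<bullet> backward 0 n 0 \<omega>)) \<noteq> \<infinity>"
    by (intro nn_integral_noteq_infinite) (auto simp: less_top)
  then show ?thesis
    using AE_good
  proof eventually_elim
    case (elim \<omega>)
    then obtain b where b: "(SUP n. ennreal (v \<bullet> backward 0 n 0 \<omega>)) = ennreal b" "0 \<le> b"
      by (cases "SUP n. ennreal (v \<bullet> backward 0 n 0 \<omega>)") auto
    have bd: "v \<bullet> backward 0 n 0 \<omega> \<le> b" for n
    proof -
      have "ennreal (v \<bullet> backward 0 n 0 \<omega>) \<le> ennreal b" unfolding b(1)[symmetric] by (rule SUP_upper) simp
      then show ?thesis using b(2) by (simp add: ennreal_le_iff)
    qed
    have nn: "0 \<le> backward 0 n 0 \<omega>" for n by (rule good_backward_nonneg[OF elim(2)]) simp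
    define K where "K = (\<Sum>j\<in>UNIV. b / v $ j)"
    have "backward 0 n 0 \<omega> $ j \<le> K" for n j
    proof -
      have "v $ j * backward 0 n 0 \<omega> $ j \<le> b"
        using inner_pos_component[OF v_pos nn] bd[of n] by (rule order_trans)
      then have "backward 0 n 0 \<omega> $ j \<le> b / v $ j" using v_pos[of j] by (simp add: field_simps)
      also have "\<dots> \<le> K"
        unfolding K_def using b(2) v_pos by (intro member_le_sum) (auto intro: divide_nonneg_pos)
      finally show ?thesis .
    qed
    then obtain L where "(\<lambda>n. backward 0 n 0 \<omega>) \<longlonglongrightarrow> L"
      using incseq_vec_convergent[of "\<lambda>n. backward 0 n 0 \<omega>" K] good_backward_Suc[OF elim(2)] by blast
    then show ?case unfolding stationary_def by (simp add: limI)
  qed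
qed

text \<open>The iterates from \<open>X\<close> lie above those from 0, so their weighted gap is
  nonnegative. The input terms cancel in its mean, which leaves \<open>(cycle_weight ^^ n) v\<close>
  applied to \<open>X\<close> and decays like \<open>\<theta> ^ n\<close>; summability gives almost
  sure convergence. Boundedness of \<open>X\<close> provides the finite mean.\<close>

lemma AE_forget_bounded:
  assumes X: "determined {Initial} X" and bd: "\<And>\<omega>. norm (X \<omega>) \<le> R"
  shows "AE \<omega> in M. (\<lambda>n. backward 0 n (X \<omega>) \<omega>) \<longlonglongrightarrow> stationary \<omega>"
proof -
  have [measurable]: "backward 0 n 0 \<in> borel_measurable M" "(\<lambda>\<omega>. backward 0 n (X \<omega>) \<omega>) \<in> borel_measurable M" for n
    using measurable_backward[OF determined_zero, of 0 n] measurable_backward[OF X, of 0 n] by simp_all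
  let ?d = "\<lambda>n \<omega>. backward 0 n (X \<omega>) \<omega> - backward 0 n 0 \<omega>"
  have nn: "AE \<omega> in M. \<forall>n. 0 \<le> backward 0 n 0 \<omega> \<and> 0 \<le> ?d n \<omega>"
    using AE_good determined_nonneg[OF X]
    by eventually_elim (simp add: good_backward_nonneg good_backward_mono)
  have R: "0 \<le> R" using order_trans[OF norm_ge_zero bd] .
  have mean: "(\<integral>\<^sup>+\<omega>. ennreal (v \<bullet> ?d n \<omega>) \<partial>M) \<le> ennreal (\<theta> ^ n * (norm v * R))" for n
  proof -
    have zero: "(\<integral>\<^sup>+\<omega>. ennreal (v \<bullet> backward 0 n 0 \<omega>) \<partial>M) = total_input n v"
      using mean_backward[OF determined_zero v_nonneg, of 0 n] by simp
    \<comment> \<open>Cancellation in \<open>ennreal\<close> requires the common term to be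
      finite.\<close>
    have fin: "total_input n v \<noteq> \<infinity>"
      using total_input_le[OF v_nonneg, of 1 n] by (auto simp: top_unique)
    have "total_input n v + (\<integral>\<^sup>+\<omega>. ennreal (v \<bullet> ?d n \<omega>) \<partial>M) =
        (\<integral>\<^sup>+\<omega>. ennreal (v \<bullet> backward 0 n 0 \<omega>) + ennreal (v \<bullet> ?d n \<omega>) \<partial>M)"
      unfolding zero[symmetric] by (rule nn_integral_add[symmetric]) measurable
    also have "\<dots> = (\<integral>\<^sup>+\<omega>. ennreal (v \<bullet> backward 0 n (X \<omega>) \<omega>) \<partial>M)"
    proof (rule nn_integral_cong_AE, use nn in eventually_elim)
      case (elim \<omega>)
      then have "0 \<le> v \<bullet> backward 0 n 0 \<omega>" "0 \<le> v \<bullet> ?d n \<omega>" using inner_nonneg_vec[OF v_nonneg] by blast+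
      then have "ennreal (v \<bullet> backward 0 n 0 \<omega>) + ennreal (v \<bullet> ?d n \<omega>) = ennreal (v \<bullet> backward 0 n 0 \<omega> + v \<bullet> ?d n \<omega>)"
        by (rule ennreal_plus[symmetric])
      then show ?case by (simp add: inner_diff_right)
    qed
    also have "\<dots> = total_input n v + (\<integral>\<^sup>+\<omega>. ennreal ((cycle_weight ^^ n) v \<bullet> X \<omega>) \<partial>M)"
      using mean_backward[OF X v_nonneg, of 0 n] by (simp add: add.commute)
    finally have "(\<integral>\<^sup>+\<omega>. ennreal (v \<bullet> ?d n \<omega>) \<partial>M) = (\<integral>\<^sup>+\<omega>. ennreal ((cycle_weight ^^ n) v \<bullet> X \<omega>) \<partial>M)"
      using fin by (simp add: ennreal_add_left_cancel)
    also have "\<dots> \<le> (\<integral>\<^sup>+\<omega>. ennreal (\<theta> ^ n * (norm v * R)) \<partial>M)"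
    proof (rule nn_integral_mono_AE, use determined_nonneg[OF X] in eventually_elim)
      case (elim \<omega>)
      have "(cycle_weight ^^ n) v \<bullet> X \<omega> \<le> ((\<theta> ^ n) *\<^sub>R v) \<bullet> X \<omega>"
        using inner_mono_vec[OF elim, of "(cycle_weight ^^ n) v" "(\<theta> ^ n) *\<^sub>R v"] funpow_cycle_weight[of n]
        by (simp only: inner_commute)
      also have "\<dots> = \<theta> ^ n * (v \<bullet> X \<omega>)" by simp
      also have "\<dots> \<le> \<theta> ^ n * (norm v * R)"
        using theta by (intro mult_left_mono order_trans[OF norm_cauchy_schwarz] bd) auto
      finally show ?case by (rule ennreal_leI)
    qed
    finally show ?thesis by (simp add: emeasure_space_1)
  qed
  have "AE \<omega> in M. (\<lambda>n. v \<bullet> ?d n \<omega>) \<longlonglongrightarrow> 0"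
  proof (rule AE_tendsto_zero_of_summable[OF _ _ mean])
    show "(\<lambda>\<omega>. v \<bullet> ?d n \<omega>) \<in> borel_measurable M" for n by measurable
    show "AE \<omega> in M. 0 \<le> v \<bullet> ?d n \<omega>" for n
      using nn by eventually_elim (intro inner_nonneg_vec[OF v_nonneg], blast)
    show "summable (\<lambda>n. \<theta> ^ n * (norm v * R))"
      using theta by (intro summable_mult2 summable_geometric) simp
    show "0 \<le> \<theta> ^ n * (norm v * R)" for n using theta R by simp
  qed
  then show ?thesis
    using AE_stationary nn
  proof eventually_elim
    case (elim \<omega>)
    have le: "?d n \<omega> $ j \<le> (v \<bullet> ?d n \<omega>) / v $ j" for n j
      using inner_pos_component[OF v_pos, of "?d n \<omega>" j] v_pos[of j] elim(3) by (simp add: field_simps)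
    have ge: "0 \<le> ?d n \<omega> $ j" for n j using elim(3) by (simp add: less_eq_vec_def)
    have lim: "(\<lambda>n. (v \<bullet> ?d n \<omega>) / v $ j) \<longlonglongrightarrow> 0" for j
      using tendsto_divide[OF elim(1) tendsto_const, of "v $ j"] v_pos[of j] by simp
    have "(\<lambda>n. ?d n \<omega> $ j) \<longlonglongrightarrow> 0" for j
    proof (rule tendsto_sandwich[OF _ _ tendsto_const lim[of j]])
      show "\<forall>\<^sub>F n in sequentially. 0 \<le> ?d n \<omega> $ j" by (intro always_eventually allI ge)
      show "\<forall>\<^sub>F n in sequentially. ?d n \<omega> $ j \<le> (v \<bullet> ?d n \<omega>) / v $ j" by (intro always_eventually allI le)
    qed
    then have "(\<lambda>n. ?d n \<omega>) \<longlonglongrightarrow> 0" by (intro vec_tendstoI) (simp only: zero_index)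
    from tendsto_add[OF this elim(2)] show ?case by simp
  qed
qed

text \<open>The initial workload need not have a mean. It is set to 0 where its norm exceeds
  \<open>R\<close>; the iteration is pathwise, so nothing changes on the event that the norm is at
  most \<open>R\<close>, and these events exhaust the space.\<close>

lemma AE_forget: "AE \<omega> in M. (\<lambda>n. backward 0 n (B\<^sub>0 \<omega>) \<omega>) \<longlonglongrightarrow> stationary \<omega>"
proof -
  let ?X = "\<lambda>R \<omega>. if norm (B\<^sub>0 \<omega>) \<le> real R then B\<^sub>0 \<omega> else 0"
  have "determined {Initial} (?X R)" for R
  proof (rule determinedI)
    note [measurable] = measurable_initial
    show "?X R \<in> borel_measurable (known {Initial})" by measurable
    show "AE \<omega> in M. 0 \<le> ?X R \<omega>" using initial_nonneg by eventually_elim simp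
  qed simp
  then have "AE \<omega> in M. (\<lambda>n. backward 0 n (?X R \<omega>) \<omega>) \<longlonglongrightarrow> stationary \<omega>" for R
    by (rule AE_forget_bounded[where R="real R"]) simp
  then have "AE \<omega> in M. \<forall>R. (\<lambda>n. backward 0 n (?X R \<omega>) \<omega>) \<longlonglongrightarrow> stationary \<omega>"
    by (simp add: AE_all_countable)
  then show ?thesis
  proof eventually_elim
    case (elim \<omega>)
    obtain R where "norm (B\<^sub>0 \<omega>) \<le> real R" using real_arch_simple by blast
    then show ?case using spec[OF elim, of R] by simp
  qed
qed

theorem stable: "polling_stable M B"
  unfolding polling_stable_def
proof (intro exI conjI allI impI)
  have [measurable]: "backward 0 n 0 \<in> borel_measurable M" for n
    using measurable_backward[OF determined_zero, of 0 n] by simp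
  have st [measurable]: "stationary \<in> borel_measurable M"
    unfolding stationary_def[abs_def] by measurable
  show "prob_space (distr M borel stationary)" by (rule prob_space_distr) measurable
  show "sets (distr M borel stationary) = sets borel" by simp
  have "{x :: (real, 'n) vec. 0 \<le> x} = {x. \<forall>j. 0 \<le> x $ j}" by (auto simp: less_eq_vec_def)
  moreover have "closed {x :: (real, 'n) vec. \<forall>j. 0 \<le> x $ j}"
    by (intro closed_Collect_all closed_Collect_le continuous_intros)
  ultimately have closed: "{x :: (real, 'n) vec. 0 \<le> x} \<in> sets borel" by simp
  have "AE \<omega> in M. 0 \<le> stationary \<omega>"
    using AE_stationary AE_good
  proof eventually_elim
    case (elim \<omega>)
    have "0 \<le> stationary \<omega> $ j" for j
      using tendsto_vec_nth[OF elim(1), of j] good_backward_nonneg[OF elim(2), of 0 0]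
      by (intro LIMSEQ_le_const) (auto simp: less_eq_vec_def)
    then show ?case by (simp add: less_eq_vec_def)
  qed
  then show "AE x in distr M borel stationary. 0 \<le> x"
    using closed by (subst AE_distr_iff) auto
  fix f :: "(real, 'n) vec \<Rightarrow> real" assume f: "continuous_on UNIV f \<and> bounded (range f)"
  then have [measurable]: "f \<in> borel_measurable borel" by (simp add: borel_measurable_continuous_onI)
  obtain b where b: "\<And>x. norm (f x) \<le> b" using f by (auto simp: bounded_iff)
  have mB [measurable]: "(\<lambda>\<omega>. backward 0 n (B\<^sub>0 \<omega>) \<omega>) \<in> borel_measurable M" for n
    by (rule measurable_backward[OF determined_initial])
  have "(\<lambda>n. \<integral>\<omega>. f (backward 0 n (B\<^sub>0 \<omega>) \<omega>) \<partial>M) \<longlonglongrightarrow> (\<integral>\<omega>. f (stationary \<omega>) \<partial>M)"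
  proof (rule integral_dominated_convergence[where w="\<lambda>_. b"])
    show "AE \<omega> in M. (\<lambda>n. f (backward 0 n (B\<^sub>0 \<omega>) \<omega>)) \<longlonglongrightarrow> f (stationary \<omega>)"
      using AE_forget
    proof eventually_elim
      case (elim \<omega>)
      have "isCont f (stationary \<omega>)" using f by (simp add: continuous_on_eq_continuous_at)
      then show ?case using elim by (rule isCont_tendsto_compose)
    qed
  qed (use b in auto)
  \<comment> \<open>Forward and backward iterates agree in law at each \<open>n\<close>, and
    convergence in distribution concerns nothing but these laws.\<close>
  moreover have "(\<integral>x. f x \<partial>distr M borel (B n)) = (\<integral>\<omega>. f (backward 0 n (B\<^sub>0 \<omega>) \<omega>) \<partial>M)" for n
    unfolding distr_backward by (rule integral_distr) measurable
  moreover have "(\<integral>x. f x \<partial>distr M borel stationary) = (\<integral>\<omega>. f (stationary \<omega>) \<partial>M)"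
    by (rule integral_distr) measurable
  ultimately show "(\<lambda>n. \<integral>x. f x \<partial>distr M borel (B n)) \<longlonglongrightarrow> (\<integral>x. f x \<partial>distr M borel stationary)" by simp
qed

end

section \<open>Instability\<close>

text \<open>The difference quotient of the exponential at 0 recovers \<open>a\<close>; with the
  upper bound \<open>a\<close> it lets means be read off Laplace transforms.\<close>

lemma scaled_exp_tendsto: "(\<lambda>n. real (Suc n) * (1 - exp (- (a / real (Suc n))))) \<longlonglongrightarrow> a"
  by real_asymp

lemma scaled_exp_le: "real (Suc n) * (1 - exp (- (a / real (Suc n)))) \<le> a"
proof -
  have "1 - exp (- (a / real (Suc n))) \<le> a / real (Suc n)"
    using exp_ge_add_one_self[of "- (a / real (Suc n))"] by simp
  then have "real (Suc n) * (1 - exp (- (a / real (Suc n)))) \<le> real (Suc n) * (a / real (Suc n))"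
    by (rule mult_left_mono) simp
  then show ?thesis by simp
qed

context prob_space begin

text \<open>The mean of \<open>v \<bullet> X\<close> is the slope at 0 of the transform along the
  ray of \<open>v\<close>. Fatou on the side of \<open>X\<close> and the pointwise bound on the side
  of \<open>Y\<close> yield the inequality without presuming that either mean is finite.\<close>

lemma nn_integral_le_of_laplace_eq:
  fixes X Y :: "'a \<Rightarrow> real ^ 'n"
  assumes X: "X \<in> borel_measurable M" "AE \<omega> in M. 0 \<le> X \<omega>"
    and Y: "Y \<in> borel_measurable M" "AE \<omega> in M. 0 \<le> Y \<omega>"
    and eq: "\<And>u. 0 \<le> u \<Longrightarrow> expectation (\<lambda>\<omega>. exp (- (u \<bullet> X \<omega>))) = expectation (\<lambda>\<omega>. exp (- (u \<bullet> Y \<omega>)))"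
    and v: "0 \<le> v"
  shows "(\<integral>\<^sup>+\<omega>. ennreal (v \<bullet> X \<omega>) \<partial>M) \<le> (\<integral>\<^sup>+\<omega>. ennreal (v \<bullet> Y \<omega>) \<partial>M)"
proof -
  note [measurable] = X(1) Y(1)
  let ?f = "\<lambda>Z n \<omega>. real (Suc n) * (1 - exp (- ((v \<bullet> Z \<omega>) / real (Suc n))))"
  have nn_f: "(\<integral>\<^sup>+\<omega>. ennreal (?f Z n \<omega>) \<partial>M) = ennreal (real (Suc n) * (1 - expectation (\<lambda>\<omega>. exp (- (((1 / real (Suc n)) *\<^sub>R v) \<bullet> Z \<omega>)))))"
    if Z [measurable]: "Z \<in> borel_measurable M" and nn: "AE \<omega> in M. 0 \<le> Z \<omega>" for Z n
  proof -
    have vz: "AE \<omega> in M. 0 \<le> (v \<bullet> Z \<omega>) / real (Suc n)"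
      using nn by eventually_elim (intro divide_nonneg_nonneg inner_nonneg_vec v, auto)
    have int: "integrable M (\<lambda>\<omega>. exp (- ((v \<bullet> Z \<omega>) / real (Suc n))))"
      by (rule integrable_exp_neg) (use vz in measurable)
    have "(\<integral>\<^sup>+\<omega>. ennreal (?f Z n \<omega>) \<partial>M) = ennreal (expectation (?f Z n))"
    proof (rule nn_integral_eq_integral)
      show "integrable M (?f Z n)" using int by (intro integrable_mult_right Bochner_Integration.integrable_diff) auto
      show "AE \<omega> in M. 0 \<le> ?f Z n \<omega>"
        using vz by eventually_elim (intro mult_nonneg_nonneg, auto)
    qed
    also have "expectation (?f Z n) = real (Suc n) * (1 - expectation (\<lambda>\<omega>. exp (- ((v \<bullet> Z \<omega>) / real (Suc n)))))"
      using int by (simp add: prob_space)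
    finally show ?thesis by simp
  qed
  have "(\<integral>\<^sup>+\<omega>. ennreal (v \<bullet> X \<omega>) \<partial>M) = (\<integral>\<^sup>+\<omega>. liminf (\<lambda>n. ennreal (?f X n \<omega>)) \<partial>M)"
  proof (rule nn_integral_cong)
    fix \<omega>
    have "(\<lambda>n. ennreal (?f X n \<omega>)) \<longlonglongrightarrow> ennreal (v \<bullet> X \<omega>)"
      by (rule tendsto_ennrealI[OF scaled_exp_tendsto])
    then show "ennreal (v \<bullet> X \<omega>) = liminf (\<lambda>n. ennreal (?f X n \<omega>))"
      by (rule lim_imp_Liminf[symmetric, rotated]) simp
  qed
  also have "\<dots> \<le> liminf (\<lambda>n. \<integral>\<^sup>+\<omega>. ennreal (?f X n \<omega>) \<partial>M)"
    by (rule nn_integral_liminf) measurable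
  also have "\<dots> \<le> liminf (\<lambda>n. \<integral>\<^sup>+\<omega>. ennreal (v \<bullet> Y \<omega>) \<partial>M)"
  proof (rule Liminf_mono, rule always_eventually, rule allI)
    fix n
    have "0 \<le> (1 / real (Suc n)) *\<^sub>R v" using v by (simp add: less_eq_vec_def)
    then have "(\<integral>\<^sup>+\<omega>. ennreal (?f X n \<omega>) \<partial>M) = (\<integral>\<^sup>+\<omega>. ennreal (?f Y n \<omega>) \<partial>M)"
      unfolding nn_f[OF X] nn_f[OF Y] by (simp only: eq)
    also have "\<dots> \<le> (\<integral>\<^sup>+\<omega>. ennreal (v \<bullet> Y \<omega>) \<partial>M)"
      by (intro nn_integral_mono ennreal_leI scaled_exp_le)
    finally show "(\<integral>\<^sup>+\<omega>. ennreal (?f X n \<omega>) \<partial>M) \<le> (\<integral>\<^sup>+\<omega>. ennreal (v \<bullet> Y \<omega>) \<partial>M)" .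
  qed
  also have "\<dots> = (\<integral>\<^sup>+\<omega>. ennreal (v \<bullet> Y \<omega>) \<partial>M)" by (simp add: Liminf_const)
  finally show ?thesis .
qed

end

section \<open>Laplace transforms of visits and cycles\<close>

context polling_system begin

definition "exponent i = laplace_exponent M (H 0 i)"

text \<open>Counterpart of \<open>next_weight\<close> for transforms: the mean offspring weight is
  the linear part at 0 of the Laplace exponent used here.\<close>

definition laplace_weight :: "'n \<Rightarrow> (real, 'n) vec \<Rightarrow> (real, 'n) vec" where
  "laplace_weight i u = (\<chi> j. if j = i then exponent i u else u $ j)"

lemma exponent:
  assumes "0 \<le> u"
  shows "0 \<le> exponent i u"
    and "0 \<le> t \<Longrightarrow> expectation (\<lambda>\<omega>. exp (- (u \<bullet> H 0 i t \<omega>))) = exp (- (t * exponent i u))"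
  using visits.children.laplace_exponent[OF assms, where n=0 and i=i] by (auto simp: exponent_def)

lemma laplace_weight_nonneg: "0 \<le> u \<Longrightarrow> 0 \<le> laplace_weight i u"
  using exponent(1)[of u i] by (auto simp: laplace_weight_def less_eq_vec_def)

definition "immigration_laplace i u = expectation (\<lambda>\<omega>. exp (- (u \<bullet> immigration 0 i \<omega>)))"

lemma inner_immigration:
  assumes u: "0 \<le> u"
  shows "(\<lambda>\<omega>. u \<bullet> immigration 0 i \<omega>) \<in> borel_measurable M" "AE \<omega> in M. 0 \<le> u \<bullet> immigration 0 i \<omega>"
proof -
  note [measurable] = measurable_immigration
  show "(\<lambda>\<omega>. u \<bullet> immigration 0 i \<omega>) \<in> borel_measurable M" by measurable
  show "AE \<omega> in M. 0 \<le> u \<bullet> immigration 0 i \<omega>"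
    using AE_immigration_nonneg[of 0 i] by eventually_elim (rule inner_nonneg_vec[OF u])
qed

lemma nn_immigration_laplace:
  "0 \<le> u \<Longrightarrow> (\<integral>\<^sup>+\<omega>. ennreal (exp (- (u \<bullet> immigration 0 i \<omega>))) \<partial>M) = ennreal (immigration_laplace i u)"
  unfolding immigration_laplace_def by (intro nn_integral_exp_neg inner_immigration)

lemma immigration_laplace_bounds: "0 \<le> u \<Longrightarrow> 0 \<le> immigration_laplace i u" "0 \<le> u \<Longrightarrow> immigration_laplace i u \<le> 1"
  unfolding immigration_laplace_def by (simp, intro expectation_exp_neg_le_1 inner_immigration)

text \<open>With the duration frozen at \<open>s\<close>, the transform of the input is
  \<open>exp (- (s * c))\<close>, where \<open>c\<close> is the Laplace exponent of the input
  process; what remains is the mean over the duration.\<close>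

lemma immigration_laplace_eq:
  assumes u: "0 \<le> u"
  shows "immigration_laplace i u = expectation (\<lambda>\<omega>. exp (- (laplace_exponent M (V 0 i) u * S 0 i \<omega>)))"
proof -
  note [measurable] = duration_measurable
  let ?c = "laplace_exponent M (V 0 i) u"
  have c: "0 \<le> ?c" by (rule switches.laplace_exponent(1)[OF u])
  have "ennreal (immigration_laplace i u) = (\<integral>\<^sup>+\<omega>'. \<integral>\<^sup>+\<omega>. ennreal (exp (- (u \<bullet> V 0 i (max 0 (S 0 i \<omega>')) \<omega>))) \<partial>M \<partial>M)"
    unfolding nn_immigration_laplace[OF u, symmetric]
    by (rule nn_integral_immigration[where f="\<lambda>y. ennreal (exp (- (u \<bullet> y)))"]) measurable
  also have "\<dots> = (\<integral>\<^sup>+\<omega>'. ennreal (exp (- (?c * S 0 i \<omega>'))) \<partial>M)"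
  proof (rule nn_integral_cong_AE, use duration_pos[of 0 i] in eventually_elim)
    case (elim \<omega>')
    have "(\<integral>\<^sup>+\<omega>. ennreal (exp (- (u \<bullet> V 0 i (S 0 i \<omega>') \<omega>))) \<partial>M) = ennreal (exp (- (S 0 i \<omega>' * ?c)))"
      using switches.nn_laplace_eq[OF u, of "S 0 i \<omega>'" 0 i] switches.laplace_exponent(2)[OF u, of "S 0 i \<omega>'" 0 i] elim
      by (simp add: switches.nn_laplace_def)
    then show ?case using elim by (simp add: mult.commute)
  qed
  also have "\<dots> = ennreal (expectation (\<lambda>\<omega>. exp (- (?c * S 0 i \<omega>))))"
  proof (rule nn_integral_exp_neg)
    show "AE \<omega> in M. 0 \<le> ?c * S 0 i \<omega>"
      using duration_pos[of 0 i] by eventually_elim (use c in auto)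
  qed measurable
  finally show ?thesis using immigration_laplace_bounds(1)[OF u] by (simp add: integral_nonneg)
qed

text \<open>A step maps exponentials to multiples of exponentials: the log-transform of the
  offspring is proportional to \<open>x $ i\<close>, and the immigration does not depend on
  \<open>x\<close>.\<close>

lemma kernel_exp:
  assumes u: "0 \<le> u" and x: "0 \<le> x"
  shows "kernel i (\<lambda>x. ennreal (exp (- (u \<bullet> x)))) x =
    ennreal (exp (- (laplace_weight i u \<bullet> x))) * ennreal (immigration_laplace i u)"
proof -
  note [measurable] = measurable_immigration
  have xi: "0 \<le> x $ i" using x by (simp add: less_eq_vec_def)
  have split: "laplace_weight i u \<bullet> x = u \<bullet> off i x + exponent i u * x $ i"
    unfolding replace_inner laplace_weight_def ..
  have inner: "(\<integral>\<^sup>+\<omega>. ennreal (exp (- (u \<bullet> (off i x + H 0 i (x $ i) \<omega> + y)))) \<partial>M) =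
      ennreal (exp (- (laplace_weight i u \<bullet> x))) * ennreal (exp (- (u \<bullet> y)))" for y
  proof -
    note [measurable] = visits.children.measurable_X[OF xi]
    have "(\<integral>\<^sup>+\<omega>. ennreal (exp (- (u \<bullet> (off i x + H 0 i (x $ i) \<omega> + y)))) \<partial>M) =
        (\<integral>\<^sup>+\<omega>. ennreal (exp (- (u \<bullet> off i x)) * exp (- (u \<bullet> y))) * ennreal (exp (- (u \<bullet> H 0 i (x $ i) \<omega>))) \<partial>M)"
      by (intro nn_integral_cong) (simp add: inner_add_right algebra_simps flip: ennreal_mult exp_add)
    also have "\<dots> = ennreal (exp (- (u \<bullet> off i x)) * exp (- (u \<bullet> y))) * (\<integral>\<^sup>+\<omega>. ennreal (exp (- (u \<bullet> H 0 i (x $ i) \<omega>))) \<partial>M)"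
      by (rule nn_integral_cmult) measurable
    also have "(\<integral>\<^sup>+\<omega>. ennreal (exp (- (u \<bullet> H 0 i (x $ i) \<omega>))) \<partial>M) = ennreal (exp (- (x $ i * exponent i u)))"
      using visits.children.nn_laplace_eq[OF u xi, where n=0 and i=i] exponent(2)[OF u xi]
      by (simp add: visits.children.nn_laplace_def)
    finally show ?thesis by (simp add: split algebra_simps flip: ennreal_mult exp_add)
  qed
  have "kernel i (\<lambda>x. ennreal (exp (- (u \<bullet> x)))) x =
      (\<integral>\<^sup>+\<omega>'. ennreal (exp (- (laplace_weight i u \<bullet> x))) * ennreal (exp (- (u \<bullet> immigration 0 i \<omega>'))) \<partial>M)"
    unfolding inner[symmetric] by (rule kernel_eq[OF x]) measurable
  also have "\<dots> = ennreal (exp (- (laplace_weight i u \<bullet> x))) * (\<integral>\<^sup>+\<omega>. ennreal (exp (- (u \<bullet> immigration 0 i \<omega>))) \<partial>M)"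
    by (rule nn_integral_cmult) measurable
  finally show ?thesis by (simp only: nn_immigration_laplace[OF u])
qed

lemma laplace_step:
  assumes u: "0 \<le> u" and X: "determined J X" "step_sources n i \<inter> J = {}"
  shows "(\<integral>\<^sup>+\<omega>. ennreal (exp (- (u \<bullet> step n i (X \<omega>) \<omega>))) \<partial>M) =
    (\<integral>\<^sup>+\<omega>. ennreal (exp (- (laplace_weight i u \<bullet> X \<omega>))) \<partial>M) * ennreal (immigration_laplace i u)"
proof -
  note [measurable] = determined_measurable[OF X(1)]
  have "(\<integral>\<^sup>+\<omega>. ennreal (exp (- (u \<bullet> step n i (X \<omega>) \<omega>))) \<partial>M) = (\<integral>\<^sup>+\<omega>. kernel i (\<lambda>x. ennreal (exp (- (u \<bullet> x)))) (X \<omega>) \<partial>M)"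
    by (rule step_determined(2)[OF X, where f="\<lambda>x. ennreal (exp (- (u \<bullet> x)))"]) measurable
  also have "\<dots> = (\<integral>\<^sup>+\<omega>. ennreal (exp (- (laplace_weight i u \<bullet> X \<omega>))) * ennreal (immigration_laplace i u) \<partial>M)"
    by (rule nn_integral_cong_AE, use determined_nonneg[OF X(1)] in eventually_elim) (rule kernel_exp[OF u])
  also have "\<dots> = (\<integral>\<^sup>+\<omega>. ennreal (exp (- (laplace_weight i u \<bullet> X \<omega>))) \<partial>M) * ennreal (immigration_laplace i u)"
    by (rule nn_integral_multc) measurable
  finally show ?thesis .
qed

primrec laplace_product :: "'n list \<Rightarrow> (real, 'n) vec \<Rightarrow> real" where
  "laplace_product [] u = 1"
| "laplace_product (i # is) u = immigration_laplace i (foldr laplace_weight is u) * laplace_product is u"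

lemma laplace_weights_nonneg: "0 \<le> u \<Longrightarrow> 0 \<le> foldr laplace_weight is u"
  by (induction "is") (auto intro: laplace_weight_nonneg)

lemma laplace_product_nonneg: "0 \<le> u \<Longrightarrow> 0 \<le> laplace_product is u"
  by (induction "is") (auto intro: mult_nonneg_nonneg immigration_laplace_bounds laplace_weights_nonneg)

lemma laplace_visit_all:
  assumes u: "0 \<le> u"
  shows "distinct is \<Longrightarrow> determined J X \<Longrightarrow> sources n (set is) \<inter> J = {} \<Longrightarrow>
    (\<integral>\<^sup>+\<omega>. ennreal (exp (- (u \<bullet> visit_all n is (X \<omega>) \<omega>))) \<partial>M) =
    (\<integral>\<^sup>+\<omega>. ennreal (exp (- (foldr laplace_weight is u \<bullet> X \<omega>))) \<partial>M) * ennreal (laplace_product is u)"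
proof (induction "is" arbitrary: J X)
  case Nil
  then show ?case by (simp add: visit_all_simps)
next
  case (Cons i "is")
  note s = sources_Cons_disjoint[OF Cons.prems(1,3)]
  let ?u = "foldr laplace_weight is u"
  have "(\<integral>\<^sup>+\<omega>. ennreal (exp (- (u \<bullet> visit_all n is (step n i (X \<omega>) \<omega>) \<omega>))) \<partial>M) =
      (\<integral>\<^sup>+\<omega>. ennreal (exp (- (?u \<bullet> step n i (X \<omega>) \<omega>))) \<partial>M) * ennreal (laplace_product is u)"
    by (rule Cons.IH[OF _ step_determined(1)[OF Cons.prems(2) s(1)] s(2)]) (use Cons.prems(1) in simp)
  also have "(\<integral>\<^sup>+\<omega>. ennreal (exp (- (?u \<bullet> step n i (X \<omega>) \<omega>))) \<partial>M) =
      (\<integral>\<^sup>+\<omega>. ennreal (exp (- (laplace_weight i ?u \<bullet> X \<omega>))) \<partial>M) * ennreal (immigration_laplace i ?u)"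
    by (rule laplace_step[OF laplace_weights_nonneg[OF u] Cons.prems(2) s(1)])
  finally show ?case
    using immigration_laplace_bounds(1)[OF laplace_weights_nonneg[OF u]] laplace_product_nonneg[OF u]
    by (simp add: visit_all_simps mult.assoc ennreal_mult)
qed

text \<open>\<open>foldr\<close> replaces coordinates from the last queue backwards, and
  \<open>kappa\<close> at \<open>i\<close> asks for its values at all larger queues. The two match
  if the list is an upper segment of the order, since then exactly the coordinates beyond
  \<open>i\<close> have been replaced when \<open>i\<close> is reached.\<close>

lemma laplace_weights_kappa:
  assumes "sorted is" "distinct is" "\<And>j k. j \<in> set is \<Longrightarrow> j < k \<Longrightarrow> k \<in> set is"
  shows "foldr laplace_weight is u = (\<chi> j. if j \<in> set is then kappa exponent j u else u $ j) \<and>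
    laplace_product is u = (\<Prod>i\<in>set is. immigration_laplace i (\<chi> j. if j \<le> i then u $ j else kappa exponent j u))"
  using assms
proof (induction "is")
  case Nil
  show ?case by (simp add: vec_eq_iff)
next
  case (Cons i "is")
  have mem: "j \<in> set is \<longleftrightarrow> i < j" for j
  proof
    assume "j \<in> set is"
    then have "i \<le> j" "j \<noteq> i" using Cons.prems(1,2) by auto
    then show "i < j" by simp
  next
    assume "i < j"
    then have "j \<in> set (i # is)" using Cons.prems(3)[of i j] by simp
    then show "j \<in> set is" using \<open>i < j\<close> by auto
  qed
  have sd: "sorted is" "distinct is" using Cons.prems(1,2) by auto
  have up: "k \<in> set is" if "j \<in> set is" "j < k" for j k
    using that unfolding mem by (rule less_trans)
  have IH: "foldr laplace_weight is u = (\<chi> j. if j \<in> set is then kappa exponent j u else u $ j) \<and>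
    laplace_product is u = (\<Prod>i\<in>set is. immigration_laplace i (\<chi> j. if j \<le> i then u $ j else kappa exponent j u))"
    by (rule Cons.IH[OF sd]) (rule up)
  have fold: "foldr laplace_weight is u = (\<chi> j. if j \<le> i then u $ j else kappa exponent j u)"
    unfolding IH[THEN conjunct1] mem by (auto simp: vec_eq_iff)
  have "laplace_weight i (foldr laplace_weight is u) $ j = (if j \<in> set (i # is) then kappa exponent j u else u $ j)" for j
  proof (cases "j = i")
    case True
    then show ?thesis unfolding fold laplace_weight_def by (simp add: kappa.simps[of exponent i u])
  next
    case False
    then show ?thesis unfolding fold laplace_weight_def by (auto simp: mem)
  qed
  moreover have "laplace_product (i # is) u =
      (\<Prod>i\<in>set (i # is). immigration_laplace i (\<chi> j. if j \<le> i then u $ j else kappa exponent j u))"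
    using Cons.prems(2) unfolding laplace_product.simps fold IH[THEN conjunct2] by simp
  ultimately show ?case by (simp add: vec_eq_iff)
qed

lemma laplace_cycle_input:
  assumes u: "0 \<le> u"
  shows "expectation (\<lambda>\<omega>. exp (- (u \<bullet> full_cycle 0 0 \<omega>))) = cycle_input_transform M (S 0) (V 0) (W 0) (A 0) (\<tau> 0) u"
proof -
  have m: "full_cycle 0 0 \<in> borel_measurable M"
    using determined_measurable[OF cycle_determined[OF determined_zero[of "{}"], of 0]] by simp
  note [measurable] = m
  have nn: "AE \<omega> in M. 0 \<le> u \<bullet> full_cycle 0 0 \<omega>"
    using AE_cycle_nonneg[of 0] by eventually_elim (rule inner_nonneg_vec[OF u])
  have "ennreal (expectation (\<lambda>\<omega>. exp (- (u \<bullet> full_cycle 0 0 \<omega>)))) = ennreal (laplace_product queues u)"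
    using laplace_visit_all[OF u queues(1) determined_zero[of "{}"], of 0]
    by (subst nn_integral_exp_neg[symmetric]) (use nn in \<open>auto simp: emeasure_space_1\<close>)
  then have "expectation (\<lambda>\<omega>. exp (- (u \<bullet> full_cycle 0 0 \<omega>))) = laplace_product queues u"
    using laplace_product_nonneg[OF u] by (simp add: integral_nonneg)
  also have "\<dots> = (\<Prod>i\<in>UNIV. immigration_laplace i (\<chi> j. if j \<le> i then u $ j else kappa exponent j u))"
    using laplace_weights_kappa[OF queues(3,1)] by (simp add: queues(2))
  also have "\<dots> = cycle_input_transform M (S 0) (V 0) (W 0) (A 0) (\<tau> 0) u"
    unfolding cycle_input_transform_def Let_def exponent_def[abs_def, symmetric]
  proof (intro prod.cong refl immigration_laplace_eq)
    fix i
    \<comment> \<open>The argument of factor \<open>i\<close> is the weight carried back through the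
      queues after \<open>i\<close>, which shows that it is nonnegative.\<close>
    have fold: "foldr laplace_weight (filter (\<lambda>j. i < j) queues) u = (\<chi> j. if j \<in> set (filter (\<lambda>j. i < j) queues) then kappa exponent j u else u $ j)"
      by (rule laplace_weights_kappa[THEN conjunct1]) (use queues in \<open>auto simp: sorted_wrt_filter\<close>)
    then have "foldr laplace_weight (filter (\<lambda>j. i < j) queues) u = (\<chi> j. if j \<le> i then u $ j else kappa exponent j u)"
      by (auto simp: vec_eq_iff queues(2))
    then show "0 \<le> (\<chi> j. if j \<le> i then u $ j else kappa exponent j u)"
      using laplace_weights_nonneg[OF u, of "filter (\<lambda>j. i < j) queues"] by simp
  qed
  finally show ?thesis .
qed

lemma cycle_input_finite:
  assumes G: "G \<in> borel_measurable M" "AE \<omega> in M. 0 \<le> G \<omega>" "integrable M (\<lambda>\<omega>. norm (G \<omega>))"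
    and transform: "\<And>u. 0 \<le> u \<Longrightarrow> expectation (\<lambda>\<omega>. exp (- (u \<bullet> G \<omega>))) = cycle_input_transform M (S 0) (V 0) (W 0) (A 0) (\<tau> 0) u"
    and v: "0 \<le> v"
  shows "cycle_input v < \<infinity>"
proof -
  have m: "full_cycle 0 0 \<in> borel_measurable M"
    using determined_measurable[OF cycle_determined[OF determined_zero[of "{}"], of 0]] by simp
  have "cycle_input v \<le> (\<integral>\<^sup>+\<omega>. ennreal (v \<bullet> G \<omega>) \<partial>M)"
    unfolding cycle_input_def
    by (rule nn_integral_le_of_laplace_eq[OF m AE_cycle_nonneg G(1,2) _ v]) (simp add: transform laplace_cycle_input)
  also have "\<dots> \<le> (\<integral>\<^sup>+\<omega>. ennreal (norm v * norm (G \<omega>)) \<partial>M)"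
    by (intro nn_integral_mono ennreal_leI norm_cauchy_schwarz)
  also have "\<dots> = ennreal (\<integral>\<omega>. norm v * norm (G \<omega>) \<partial>M)"
    using G(3) by (intro nn_integral_eq_integral) auto
  finally show ?thesis by (simp add: le_less_trans)
qed

text \<open>The slope of \<open>exponent i\<close> at 0 along \<open>v\<close> is the mean weight of
  the offspring of one unit of work, which exceeds \<open>v $ i\<close>. The exponent therefore
  dominates the linear function at \<open>v / n\<close> for large \<open>n\<close>, and one
  \<open>n\<close> serves the finitely many queues.\<close>

lemma exponent_supercritical:
  assumes v: "0 \<le> v" and grow: "\<And>i. v $ i < v $ i + service_rate i * (v \<bullet> rates $ i)"
  obtains e where "0 < e" "\<And>i. e * v $ i \<le> exponent i (e *\<^sub>R v)"
proof -
  have ev: "\<forall>\<^sub>F n in sequentially. v $ i / real (Suc n) \<le> exponent i ((1 / real (Suc n)) *\<^sub>R v)" for i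
  proof -
    note [measurable] = visits.children.measurable_X[of 1 i 0]
    let ?Y = "\<lambda>\<omega>. v \<bullet> H 0 i 1 \<omega>"
    have int: "integrable M ?Y" and mean: "expectation ?Y = v $ i + service_rate i * (v \<bullet> rates $ i)"
      using H_mean[of 1 v i] by auto
    have nn: "AE \<omega> in M. 0 \<le> ?Y \<omega>"
      using visits.children.AE_nonneg[of i 0] by eventually_elim (simp add: inner_nonneg_vec[OF v])
    have "(\<lambda>n. expectation (\<lambda>\<omega>. real (Suc n) * (1 - exp (- (?Y \<omega> / real (Suc n)))))) \<longlonglongrightarrow> expectation ?Y"
    proof (rule integral_dominated_convergence[where w="?Y"])
      show "AE \<omega> in M. (\<lambda>n. real (Suc n) * (1 - exp (- (?Y \<omega> / real (Suc n))))) \<longlonglongrightarrow> ?Y \<omega>"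
        by (intro AE_I2 scaled_exp_tendsto)
      fix n
      show "AE \<omega> in M. norm (real (Suc n) * (1 - exp (- (?Y \<omega> / real (Suc n))))) \<le> ?Y \<omega>"
        using nn
      proof eventually_elim
        case (elim \<omega>)
        then have "0 \<le> real (Suc n) * (1 - exp (- (?Y \<omega> / real (Suc n))))" by (intro mult_nonneg_nonneg) auto
        then show ?case using scaled_exp_le[of n "?Y \<omega>"] by simp
      qed
    qed (use int in measurable)
    from order_tendstoD(1)[OF this, of "v $ i"] grow[of i]
    have "\<forall>\<^sub>F n in sequentially. v $ i < expectation (\<lambda>\<omega>. real (Suc n) * (1 - exp (- (?Y \<omega> / real (Suc n)))))"
      by (simp add: mean)
    then show ?thesis
    proof eventually_elim
      case (elim n)
      let ?u = "(1 / real (Suc n)) *\<^sub>R v"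
      have u: "0 \<le> ?u" using v by (simp add: less_eq_vec_def)
      have ie: "integrable M (\<lambda>\<omega>. exp (- (?Y \<omega> / real (Suc n))))"
      proof (rule integrable_exp_neg)
        show "AE \<omega> in M. 0 \<le> ?Y \<omega> / real (Suc n)" using nn by eventually_elim simp
      qed measurable
      have "expectation (\<lambda>\<omega>. real (Suc n) * (1 - exp (- (?Y \<omega> / real (Suc n))))) =
          real (Suc n) * (1 - expectation (\<lambda>\<omega>. exp (- (?u \<bullet> H 0 i 1 \<omega>))))"
        using ie by (simp add: prob_space)
      also have "\<dots> = real (Suc n) * (1 - exp (- exponent i ?u))"
        using exponent(2)[OF u, of 1 i] by simp
      \<comment> \<open>\<open>1 - exp (- x) \<le> x\<close> passes from the transform to the
        exponent.\<close>
      also have "\<dots> \<le> real (Suc n) * exponent i ?u"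
        using exp_ge_add_one_self[of "- exponent i ?u"] by (intro mult_left_mono) auto
      finally have "v $ i \<le> real (Suc n) * exponent i ?u" using elim by linarith
      then show ?case by (simp add: pos_divide_le_eq mult.commute)
    qed
  qed
  have "\<forall>\<^sub>F n in sequentially. \<forall>i. v $ i / real (Suc n) \<le> exponent i ((1 / real (Suc n)) *\<^sub>R v)"
    by (rule eventually_all_finite) (rule ev)
  then obtain n where "\<And>i. v $ i / real (Suc n) \<le> exponent i ((1 / real (Suc n)) *\<^sub>R v)"
    by (auto simp: eventually_sequentially)
  then show ?thesis by (intro that[of "1 / real (Suc n)"]) auto
qed

text \<open>As \<open>u \<le> laplace_weight i u\<close>, the weight can be lowered to
  \<open>u\<close> again after each visit, and the error has the wanted sign. The same
  \<open>u\<close> then serves every visit and every cycle, and the immigration factors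
  accumulate.\<close>

lemma laplace_visit_all_le:
  assumes u: "0 \<le> u" and le: "\<And>i. u $ i \<le> exponent i u"
  shows "distinct is \<Longrightarrow> determined J X \<Longrightarrow> sources n (set is) \<inter> J = {} \<Longrightarrow>
    (\<integral>\<^sup>+\<omega>. ennreal (exp (- (u \<bullet> visit_all n is (X \<omega>) \<omega>))) \<partial>M) \<le>
    (\<integral>\<^sup>+\<omega>. ennreal (exp (- (u \<bullet> X \<omega>))) \<partial>M) * ennreal (\<Prod>i\<in>set is. immigration_laplace i u)"
proof (induction "is" arbitrary: J X)
  case Nil
  then show ?case by (simp add: visit_all_simps)
next
  case (Cons i "is")
  note s = sources_Cons_disjoint[OF Cons.prems(1,3)]
  let ?P = "\<Prod>i\<in>set is. immigration_laplace i u"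
  have P: "0 \<le> ?P" by (intro prod_nonneg ballI immigration_laplace_bounds u)
  have lw: "u \<le> laplace_weight i u" using le[of i] by (auto simp: less_eq_vec_def laplace_weight_def)
  have weight: "(\<integral>\<^sup>+\<omega>. ennreal (exp (- (laplace_weight i u \<bullet> X \<omega>))) \<partial>M) \<le> (\<integral>\<^sup>+\<omega>. ennreal (exp (- (u \<bullet> X \<omega>))) \<partial>M)"
  proof (intro nn_integral_mono_AE, use determined_nonneg[OF Cons.prems(2)] in eventually_elim)
    case (elim \<omega>)
    have "u \<bullet> X \<omega> \<le> laplace_weight i u \<bullet> X \<omega>"
      using inner_mono_vec[OF elim lw] by (simp only: inner_commute)
    then show ?case by (simp add: ennreal_leI)
  qed
  have "(\<integral>\<^sup>+\<omega>. ennreal (exp (- (u \<bullet> visit_all n is (step n i (X \<omega>) \<omega>) \<omega>))) \<partial>M) \<le>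
      (\<integral>\<^sup>+\<omega>. ennreal (exp (- (u \<bullet> step n i (X \<omega>) \<omega>))) \<partial>M) * ennreal ?P"
    by (rule Cons.IH[OF _ step_determined(1)[OF Cons.prems(2) s(1)] s(2)]) (use Cons.prems(1) in simp)
  also have "(\<integral>\<^sup>+\<omega>. ennreal (exp (- (u \<bullet> step n i (X \<omega>) \<omega>))) \<partial>M) =
      (\<integral>\<^sup>+\<omega>. ennreal (exp (- (laplace_weight i u \<bullet> X \<omega>))) \<partial>M) * ennreal (immigration_laplace i u)"
    by (rule laplace_step[OF u Cons.prems(2) s(1)])
  also have "\<dots> * ennreal ?P \<le> (\<integral>\<^sup>+\<omega>. ennreal (exp (- (u \<bullet> X \<omega>))) \<partial>M) * ennreal (immigration_laplace i u) * ennreal ?P"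
    by (intro mult_right_mono weight) auto
  also have "\<dots> = (\<integral>\<^sup>+\<omega>. ennreal (exp (- (u \<bullet> X \<omega>))) \<partial>M) * ennreal (\<Prod>i\<in>set (i # is). immigration_laplace i u)"
    using Cons.prems(1) P immigration_laplace_bounds(1)[OF u] by (simp add: mult.assoc ennreal_mult)
  finally show ?case by (simp add: visit_all_simps)
qed

theorem unstable:
  assumes v: "\<And>j. 0 < v $ j" and grow: "\<And>i. v $ i < v $ i + service_rate i * (v \<bullet> rates $ i)"
    and input: "\<not> (AE \<omega> in M. (\<Sum>i\<in>UNIV. \<Sum>j\<in>UNIV. V 0 i (S 0 i \<omega>) \<omega> $ j) = 0)"
  shows "polling_unstable M B"
proof -
  have v0: "0 \<le> v" using v by (auto simp: less_eq_vec_def less_imp_le)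
  obtain e where e: "0 < e" "\<And>i. e * v $ i \<le> exponent i (e *\<^sub>R v)"
    using exponent_supercritical[OF v0 grow] by metis
  define u where "u = e *\<^sub>R v"
  have u_pos: "0 < u $ j" for j using e v by (simp add: u_def)
  then have u: "0 \<le> u" by (auto simp: less_eq_vec_def less_imp_le)
  have le: "u $ i \<le> exponent i u" for i using e(2)[of i] by (simp add: u_def)
  define \<gamma> where "\<gamma> = (\<Prod>i\<in>UNIV. immigration_laplace i u)"
  have \<gamma>0: "0 \<le> \<gamma>" unfolding \<gamma>_def by (intro prod_nonneg ballI immigration_laplace_bounds u)
  \<comment> \<open>If every transform were 1 at the strictly positive \<open>u\<close>, all
    immigration would vanish almost surely, against \<open>input\<close>.\<close>
  have "\<exists>i. immigration_laplace i u < 1"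
  proof (rule ccontr)
    assume "\<not> (\<exists>i. immigration_laplace i u < 1)"
    then have one: "immigration_laplace i u = 1" for i
      using immigration_laplace_bounds(2)[OF u, of i] by (metis antisym not_le)
    have "AE \<omega> in M. immigration 0 i \<omega> = 0" for i
    proof -
      have ie: "integrable M (\<lambda>\<omega>. exp (- (u \<bullet> immigration 0 i \<omega>)))"
        by (intro integrable_exp_neg inner_immigration u)
      then have "expectation (\<lambda>\<omega>. 1 - exp (- (u \<bullet> immigration 0 i \<omega>))) = 0"
        using one[of i] by (simp add: immigration_laplace_def prob_space)
      moreover have "AE \<omega> in M. 0 \<le> 1 - exp (- (u \<bullet> immigration 0 i \<omega>))"
        using inner_immigration(2)[OF u] by eventually_elim simp
      ultimately have "AE \<omega> in M. 1 - exp (- (u \<bullet> immigration 0 i \<omega>)) = 0"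
        using ie by (subst (asm) integral_nonneg_eq_0_iff_AE) auto
      then show ?thesis
        using AE_immigration_nonneg[of 0 i]
      proof eventually_elim
        case (elim \<omega>)
        have "immigration 0 i \<omega> $ j = 0" for j
          using inner_pos_component[OF u_pos elim(2), of j] elim u_pos[of j]
          by (auto simp: less_eq_vec_def mult_le_0_iff intro: antisym)
        then show ?case by (simp add: vec_eq_iff)
      qed
    qed
    then have "AE \<omega> in M. \<forall>i. immigration 0 i \<omega> = 0" by (simp add: AE_all_countable)
    then have "AE \<omega> in M. (\<Sum>i\<in>UNIV. \<Sum>j\<in>UNIV. V 0 i (S 0 i \<omega>) \<omega> $ j) = 0"
      by eventually_elim (simp add: immigration_def)
    then show False using input by simp
  qed
  then obtain i where i: "immigration_laplace i u < 1" by blast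
  have "\<gamma> = immigration_laplace i u * (\<Prod>i\<in>UNIV - {i}. immigration_laplace i u)"
    unfolding \<gamma>_def by (rule prod.remove) auto
  also have "\<dots> \<le> immigration_laplace i u * 1"
    by (intro mult_left_mono prod_le_1 conjI immigration_laplace_bounds u)
  finally have \<gamma>1: "\<gamma> < 1" using i by simp
  note mB [measurable] = measurable_B
  have bound: "(\<integral>\<^sup>+\<omega>. ennreal (exp (- (u \<bullet> B n \<omega>))) \<partial>M) \<le> ennreal (\<gamma> ^ n)" for n
  proof (induction n)
    case 0
    have "(\<integral>\<^sup>+\<omega>. ennreal (exp (- (u \<bullet> B\<^sub>0 \<omega>))) \<partial>M) \<le> (\<integral>\<^sup>+\<omega>. 1 \<partial>M)"
    proof (rule nn_integral_mono_AE, use initial_nonneg in eventually_elim)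
      case (elim \<omega>)
      show ?case using inner_nonneg_vec[OF u elim] by simp
    qed
    then show ?case by (simp add: emeasure_space_1)
  next
    case (Suc n)
    have "(\<integral>\<^sup>+\<omega>. ennreal (exp (- (u \<bullet> B (Suc n) \<omega>))) \<partial>M) \<le> (\<integral>\<^sup>+\<omega>. ennreal (exp (- (u \<bullet> B n \<omega>))) \<partial>M) * ennreal \<gamma>"
      unfolding workload_Suc \<gamma>_def queues(2)[symmetric]
      by (rule laplace_visit_all_le[OF u le queues(1) workload_determined[of n]])
        (use cycle_sources_disjoint[of n "{..<n}"] in \<open>simp add: queues(2)\<close>)
    also have "\<dots> \<le> ennreal (\<gamma> ^ n) * ennreal \<gamma>" by (intro mult_right_mono Suc.IH) auto
    also have "\<dots> = ennreal (\<gamma> ^ Suc n)" using \<gamma>0 by (simp add: mult.commute flip: ennreal_mult)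
    finally show ?case .
  qed
  have "AE \<omega> in M. (\<lambda>n. exp (- (u \<bullet> B n \<omega>))) \<longlonglongrightarrow> 0"
  proof (rule AE_tendsto_zero_of_summable[OF _ _ bound])
    show "(\<lambda>\<omega>. exp (- (u \<bullet> B n \<omega>))) \<in> borel_measurable M" for n by measurable
    show "summable (\<lambda>n. \<gamma> ^ n)" using \<gamma>0 \<gamma>1 by (intro summable_geometric) simp
  qed (use \<gamma>0 in auto)
  then show ?thesis
    unfolding polling_unstable_def
  proof eventually_elim
    case (elim \<omega>)
    have nu: "0 < norm u" using u_pos[of undefined] by auto
    show ?case
      unfolding filterlim_at_top
    proof
      fix Z
      have "\<forall>\<^sub>F n in sequentially. exp (- (u \<bullet> B n \<omega>)) < exp (- (Z * norm u))"
        using elim by (rule order_tendstoD) simp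
      then show "\<forall>\<^sub>F n in sequentially. Z \<le> norm (B n \<omega>)"
      proof eventually_elim
        case (elim n)
        then have "Z * norm u < u \<bullet> B n \<omega>" by simp
        also have "\<dots> \<le> norm (B n \<omega>) * norm u" using norm_cauchy_schwarz[of u "B n \<omega>"] by (simp add: mult.commute)
        finally show ?case using nu by simp
      qed
    qed
  qed
qed

lemma rates_nonneg: "i \<noteq> j \<Longrightarrow> 0 \<le> rates $ i $ j"
  using visits.rate_nonneg[of j i 0] by (simp add: rate_eq)

end

section \<open>The dichotomy\<close>

theorem corollary2:
  fixes M :: "'a measure"
    and S :: "nat \<Rightarrow> 'n::{finite,linorder} \<Rightarrow> 'a \<Rightarrow> real"
    and V :: "nat \<Rightarrow> 'n \<Rightarrow> real \<Rightarrow> 'a \<Rightarrow> (real, 'n) vec"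
    and W :: "nat \<Rightarrow> 'n \<Rightarrow> real \<Rightarrow> 'a \<Rightarrow> (real, 'n) vec"
    and A :: "nat \<Rightarrow> 'n \<Rightarrow> real \<Rightarrow> 'a \<Rightarrow> real"
    and F :: "nat \<Rightarrow> 'n \<Rightarrow> real \<Rightarrow> 'a measure"
    and \<tau> :: "nat \<Rightarrow> 'n \<Rightarrow> real \<Rightarrow> 'a \<Rightarrow> real"
    and B\<^sub>0 G :: "'a \<Rightarrow> (real, 'n) vec"
  assumes "polling_system M S V W A F \<tau> B\<^sub>0"
    and "non_degenerate M (\<tau> 0)"
    and "G \<in> borel_measurable M" and "AE \<omega> in M. 0 \<le> G \<omega>"
    and "\<And>u. 0 \<le> u \<Longrightarrow>
           (\<integral>\<omega>. exp (- (u \<bullet> G \<omega>)) \<partial>M) = cycle_input_transform M (S 0) (V 0) (W 0) (A 0) (\<tau> 0) u"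
    and "integrable M (\<lambda>\<omega>. norm (G \<omega>))"
    and "\<not> (AE \<omega> in M. (\<Sum>i\<in>UNIV. \<Sum>j\<in>UNIV. V 0 i (S 0 i \<omega>) \<omega> $ j) = 0)"
    and "irreducible_matrix (rate_matrix M (W 0) (A 0))"
  shows "(dominant_eigenvalue (rate_matrix M (W 0) (A 0)) < 0 \<longrightarrow>
            polling_stable M (workload S V W A \<tau> B\<^sub>0)) \<and>
         (dominant_eigenvalue (rate_matrix M (W 0) (A 0)) > 0 \<longrightarrow>
            polling_unstable M (workload S V W A \<tau> B\<^sub>0))"
proof -
  interpret polling_system M S V W A F \<tau> B\<^sub>0 by (rule assms(1))
  obtain v where v: "\<And>i. 0 < v $ i" "rates *v v = dominant_eigenvalue rates *s v"
    using dominant_eigenvalue_positive_eigenvector[of rates] rates_nonneg assms(8)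
    unfolding rates_def by metis
  let ?\<rho> = "dominant_eigenvalue rates"
  \<comment> \<open>Row \<open>i\<close> holds the rates at all queues during a visit to
    \<open>i\<close>, which is why a right eigenvector supplies the weights.\<close>
  have vr: "v \<bullet> rates $ i = ?\<rho> * v $ i" for i
    using arg_cong[OF v(2), of "\<lambda>x. x $ i"]
    by (simp add: matrix_vector_mult_def inner_vec_def mult.commute)
  have v0: "0 \<le> v" using v(1) by (auto simp: less_eq_vec_def less_imp_le)
  note c = service_rate_pos[OF assms(2)]
  have "polling_stable M B" if neg: "?\<rho> < 0"
  proof -
    \<comment> \<open>One factor for all queues; 0 is inserted because the contraction factor has to
      be nonnegative.\<close>
    define \<theta> where "\<theta> = Max (insert 0 (range (\<lambda>i. 1 + ?\<rho> * service_rate i)))"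
    have \<theta>: "0 \<le> \<theta>" "1 + ?\<rho> * service_rate i \<le> \<theta>" for i
      unfolding \<theta>_def by (rule Max_ge, simp, blast)+
    have "?\<rho> * service_rate i < 0" for i using neg c[of i] by (rule mult_neg_pos)
    then have "\<theta> < 1" unfolding \<theta>_def by (subst Max_less_iff) auto
    moreover have "v $ i + service_rate i * (v \<bullet> rates $ i) \<le> \<theta> * v $ i" for i
      using mult_right_mono[OF \<theta>(2)[of i], of "v $ i"] v(1)[of i] by (simp add: vr algebra_simps)
    moreover have "cycle_input v < \<infinity>"
      by (rule cycle_input_finite[OF assms(3,4,6,5) v0])
    then obtain g where "cycle_input v = ennreal g" "0 \<le> g"
      by (cases "cycle_input v") auto
    ultimately interpret subcritical_polling_system M S V W A F \<tau> B\<^sub>0 v \<theta> g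
      using v(1) \<theta>(1) by unfold_locales auto
    show ?thesis by (rule stable)
  qed
  moreover have "polling_unstable M B" if pos: "0 < ?\<rho>"
    by (rule unstable[OF v(1) _ assms(7)]) (use pos c v(1) in \<open>simp add: vr\<close>)
  ultimately show ?thesis unfolding rates_def by blast
qed

end
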